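(* Let $q\ge4$ and $\beta>2$. There is a constant $C$ depending only on $\beta$ and $q$ such that the following holds. Let $X_t=G_t(\boldsymbol\epsilon_t)$, $t=1,\ldots,n$, be random vectors in $\mathbb{R}^d$ such that, for some $\Theta>0$ and $\Gamma\ge1$, for all $t=1,\ldots,n$ $$\left(\mathbb{E}\|G_t(\boldsymbol\epsilon_t)-G_t(\tilde{\boldsymbol\epsilon}_{t,t-j})\|^q\right)^{1/q}\le\Theta\,(j\vee1)^{-\beta}\quad (j\ge0),\qquad \left(\mathbb{E}\|G_t(\boldsymbol\epsilon_0)\|^q\right)^{1/q}\le\Theta,$$ and $$\sum_{t=2}^n\left(\mathbb{E}\|G_t(\boldsymbol\epsilon_0)-G_{t-1}(\boldsymbol\epsilon_0)\|^2\right)^{1/2}\le\Gamma\,\Theta.$$ Let $\Sigma_t=\sum_{h=-\infty}^\infty\operatorname{Cov}(G_t(\boldsymbol\epsilon_0),G_t(\boldsymbol\epsilon_h))$ and, for a window size $b\in\{1,\ldots,n\}$, $$\hat Q(k)=\sum_{t=b}^k\frac1b\left(\sum_{s=t-b+1}^tX_s\right)\left(\sum_{s=t-b+1}^tX_s\right)^T,\qquad k=1,\ldots,n,$$ where the empty sum ($k<b$) is zero. Then $$\mathbb{E}\max_{k=1,\ldots,n}\left\|\hat Q(k)-\sum_{t=1}^k\Sigma_t\right\|_{\mathrm{tr}}\le C\,\Theta^2\left(\Gamma\sqrt b+\sqrt{ndb}+nb^{-1}+nb^{2-\beta}\right).$$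
   Context: Setting: $(\epsilon_i)_{i\in\mathbb{Z}}$ and $(\tilde\epsilon_i)_{i\in\mathbb{Z}}$ are two mutually independent sequences of iid $U[0,1]$ random variables. For integers $t$ and $j\le t$, $\boldsymbol\epsilon_t=(\epsilon_t,\epsilon_{t-1},\ldots)\in\mathbb{R}^\infty$ and $\tilde{\boldsymbol\epsilon}_{t,j}=(\epsilon_t,\ldots,\epsilon_{j+1},\tilde\epsilon_j,\epsilon_{j-1},\ldots)\in\mathbb{R}^\infty$ (only the innovation with index $j$ is replaced). The maps $G_t:\mathbb{R}^\infty\to\mathbb{R}^d$ are measurable, with $\mathbb{R}^\infty$ carrying the $\sigma$-algebra generated by all finite projections. $\|\cdot\|$ is the Euclidean norm on $\mathbb{R}^d$, $a\vee b=\max(a,b)$, $\operatorname{Cov}(U,V)=\mathbb{E}[(U-\mathbb{E}U)(V-\mathbb{E}V)^T]$, and $\|A\|_{\mathrm{tr}}=\operatorname{tr}((A^TA)^{1/2})$ is the trace (nuclear) norm.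
   Formalization: The formal theorem additionally assumes E X_t = 0 for t = 1,…,n; without it the claim is false (d = 1, G_t constantly Θ, n = 2b: the left side is at least b²Θ², while the right side is of smaller order than b²). *)

theory Defs
  imports "HOL-Probability.Probability" "Jordan_Normal_Form.Matrix"
begin

hide_const (open) Finite_Cartesian_Product.mat Finite_Cartesian_Product.vec
  Finite_Cartesian_Product.row Finite_Cartesian_Product.column

section \<open>Matrices\<close>

text \<open>The dimension is quantified inside the theorem, since its constant must not depend on it.
  Matrices are therefore those of the AFP entry on Jordan normal forms, and a vector of
  dimension \<open>d\<close> is a function whose indices range over \<open>{..<d}\<close>.\<close>

definition psd_mat :: "nat \<Rightarrow> real mat \<Rightarrow> bool" where
  "psd_mat d A \<longleftrightarrow> A \<in> carrier_mat d d \<and> transpose_mat A = A \<and>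
     (\<forall>v\<in>carrier_vec d. 0 \<le> v \<bullet> (A *\<^sub>v v))"

text \<open>A positive semidefinite matrix has exactly one positive semidefinite square root.\<close>

definition psd_sqrt :: "nat \<Rightarrow> real mat \<Rightarrow> real mat" where
  "psd_sqrt d A = (THE B. psd_mat d B \<and> B * B = A)"

definition mat_trace :: "real mat \<Rightarrow> real" where
  "mat_trace A = (\<Sum>i<dim_row A. A $$ (i, i))"

definition trace_norm :: "real mat \<Rightarrow> real" where
  "trace_norm A = mat_trace (psd_sqrt (dim_col A) (transpose_mat A * A))"

definition outer_prod :: "nat \<Rightarrow> (nat \<Rightarrow> real) \<Rightarrow> (nat \<Rightarrow> real) \<Rightarrow> real mat" where
  "outer_prod d u v = Matrix.mat d d (\<lambda>(i, j). u i * v j)"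

text \<open>Matrices of this type form no additive monoid (the dimension is not part of the type),
  so sums of matrices are taken entrywise.\<close>

definition mat_sum :: "nat \<Rightarrow> (nat \<Rightarrow> real mat) \<Rightarrow> nat set \<Rightarrow> real mat" where
  "mat_sum d F I = Matrix.mat d d (\<lambda>ij. \<Sum>t\<in>I. F t $$ ij)"

abbreviation eucl_norm :: "nat \<Rightarrow> (nat \<Rightarrow> real) \<Rightarrow> real" where
  "eucl_norm d v \<equiv> L2_set v {..<d}"


section \<open>Innovations\<close>

text \<open>Joint independence of the whole family, indexed by the disjoint union of two copies of
  the integers, says that each sequence is independent and that the two sequences are
  independent of each other.\<close>

definition iid_uniform_pair ::
    "'a measure \<Rightarrow> (int \<Rightarrow> 'a \<Rightarrow> real) \<Rightarrow> (int \<Rightarrow> 'a \<Rightarrow> real) \<Rightarrow> bool" where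
  "iid_uniform_pair M \<epsilon> \<epsilon>' \<longleftrightarrow>
     prob_space.indep_vars M (\<lambda>_. borel) (case_sum \<epsilon> \<epsilon>') (UNIV :: (int + int) set) \<and>
     (\<forall>i. distr M borel (\<epsilon> i) = uniform_measure lborel {0..1}) \<and>
     (\<forall>i. distr M borel (\<epsilon>' i) = uniform_measure lborel {0..1})"

text \<open>The sequence \<open>(\<epsilon>\<^sub>t, \<epsilon>\<^sub>t\<^sub>-\<^sub>1, \<dots>)\<close>. The coupled sequence, with only the innovation of
  index \<open>j\<close> replaced, is \<open>history (\<epsilon>(j := \<epsilon>' j)) t\<close>.\<close>

definition history :: "(int \<Rightarrow> 'a \<Rightarrow> real) \<Rightarrow> int \<Rightarrow> 'a \<Rightarrow> (nat \<Rightarrow> real)" where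
  "history \<epsilon> t \<omega> = (\<lambda>k. \<epsilon> (t - int k) \<omega>)"


section \<open>Moments and covariances\<close>

text \<open>Without the integrability conjunct an infinite moment would satisfy the bound, because
  the Bochner integral of a function that is not integrable is \<open>0\<close>.\<close>

definition Lp_norm_le :: "'a measure \<Rightarrow> real \<Rightarrow> ('a \<Rightarrow> real) \<Rightarrow> real \<Rightarrow> bool" where
  "Lp_norm_le M p Y c \<longleftrightarrow>
     integrable M (\<lambda>\<omega>. \<bar>Y \<omega>\<bar> powr p) \<and> (\<integral>\<omega>. \<bar>Y \<omega>\<bar> powr p \<partial>M) powr (1 / p) \<le> c"

definition Cov :: "'a measure \<Rightarrow> nat \<Rightarrow> ('a \<Rightarrow> nat \<Rightarrow> real) \<Rightarrow> ('a \<Rightarrow> nat \<Rightarrow> real) \<Rightarrow> real mat" where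
  "Cov M d U V = Matrix.mat d d (\<lambda>(i, j).
     \<integral>\<omega>. (U \<omega> i - (\<integral>\<omega>'. U \<omega>' i \<partial>M)) * (V \<omega> j - (\<integral>\<omega>'. V \<omega>' j \<partial>M)) \<partial>M)"

text \<open>The matrix \<open>\<Sigma>\<^sub>t\<close>, for \<open>g = G\<^sub>t\<close>.\<close>

definition long_run_cov ::
    "'a measure \<Rightarrow> (int \<Rightarrow> 'a \<Rightarrow> real) \<Rightarrow> nat \<Rightarrow> ((nat \<Rightarrow> real) \<Rightarrow> nat \<Rightarrow> real) \<Rightarrow> real mat" where
  "long_run_cov M \<epsilon> d g = Matrix.mat d d (\<lambda>ij. \<Sum>\<^sub>\<infinity>h\<in>(UNIV :: int set).
     Cov M d (\<lambda>\<omega>. g (history \<epsilon> 0 \<omega>)) (\<lambda>\<omega>. g (history \<epsilon> h \<omega>)) $$ ij)"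


section \<open>The estimator\<close>

definition Qhat :: "nat \<Rightarrow> nat \<Rightarrow> (nat \<Rightarrow> nat \<Rightarrow> real) \<Rightarrow> nat \<Rightarrow> real mat" where
  "Qhat d b x k = mat_sum d
     (\<lambda>t. (1 / real b) \<cdot>\<^sub>m outer_prod d (\<lambda>i. \<Sum>s=t-b+1..t. x s i) (\<lambda>i. \<Sum>s=t-b+1..t. x s i)) {b..k}"

end

theory Submission
  imports Defs "Jordan_Normal_Form.Determinant"
begin

text \<open>The trace norm of \<open>A\<close> is the maximum of \<open>tr (W\<^sup>T A)\<close> over orthogonal \<open>W\<close>, which splits the
  error into a fluctuation, bounded by \<open>\<surd>d\<close> times its Frobenius norm, and a deterministic bias,
  tested against each fixed \<open>W\<close>.

  Fluctuation: a causal sequence is the sum over lags \<open>l\<close> of its projections onto the innovation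
  \<open>l\<close> steps back. Each projection is bounded by the coupling distance, and for a fixed lag they are
  martingale differences. A fourth-moment martingale inequality bounds the window sums by
  \<open>O(\<Theta> \<surd>b)\<close>, so the rescaled outer products are again physically dependent, with summed coupling
  distances \<open>O(\<Theta>\<^sup>2 \<surd>b)\<close>, and Doob's inequality applied lag by lag gives \<open>O(\<Theta>\<^sup>2 \<surd>(n b))\<close>.

  Bias: the expected estimator is a weighted sum of the covariances of \<open>X (r - h)\<close> and \<open>X r\<close>.
  Replacing \<open>G (r - h)\<close> by \<open>G r\<close> costs at most the variation of \<open>G\<close> over \<open>h\<close> steps times the size
  \<open>O(\<Theta> h powr (1/2 - \<beta>))\<close> of the prediction of \<open>X r\<close> from the innovations up to \<open>r - h\<close>; the
  weights differ from \<open>1\<close> by \<open>h / b\<close>, except at \<open>2 b\<close> boundary times.\<close>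

section \<open>Trace norm\<close>

text \<open>The matrix \<open>W\<close> attaining the trace norm varies with the sample point, so
  the fluctuation cannot be tested against a fixed \<open>W\<close>; the Frobenius norm removes
  \<open>W\<close> at the price of \<open>sqrt d\<close>, the source of the term
  \<open>sqrt (n d b)\<close>. The bias is bounded uniformly over orthogonal \<open>W\<close>, and
  such a \<open>W\<close> preserves Euclidean norms, so no dimension enters there.

  Predictions of \<open>X r\<close> are measured in L2, where projections onto different innovations
  are orthogonal. Summing squares of coupling distances instead of the distances themselves gives
  \<open>h powr (1/2 - \<beta>)\<close> rather than \<open>h powr (1 - \<beta>)\<close>. With the
  extra half power, h times this bound is at most \<open>h powr (-1/2)\<close> when \<beta> > 2,
  which sums to the factor \<open>sqrt b\<close> beside \<Gamma>; it also leaves room to avoid a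
  logarithm at every \<beta>.

  \<open>Qhat\<close> is not centred: the mean-zero assumption is what makes the expected outer
  products covariances. All estimates take place on a product of uniform laws, where conditioning on
  the past integrates out the later coordinates and a coupling changes one coordinate.\<close>

definition mat_inner :: "nat \<Rightarrow> real mat \<Rightarrow> real mat \<Rightarrow> real" where
  "mat_inner d A B = (\<Sum>i<d. \<Sum>j<d. A $$ (i, j) * B $$ (i, j))"

section \<open>Orthogonal matrices and reflections\<close>

definition orth_mat :: "nat \<Rightarrow> real mat \<Rightarrow> bool" where
  "orth_mat d W \<longleftrightarrow> W \<in> carrier_mat d d \<and> transpose_mat W * W = 1\<^sub>m d"

lemma mult_mat_index:
  assumes "A \<in> carrier_mat d d" "B \<in> carrier_mat d d" "i < d" "j < d"
  shows "(A * B) $$ (i, j) = (\<Sum>k<d. A $$ (i, k) * B $$ (k, j))"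
  using assms by (simp add: scalar_prod_def atLeast0LessThan)

lemma orth_mat_iff:
  "orth_mat d W \<longleftrightarrow> W \<in> carrier_mat d d \<and>
     (\<forall>i<d. \<forall>j<d. (\<Sum>k<d. W $$ (k, i) * W $$ (k, j)) = (if i = j then 1 else 0))"
proof (cases "W \<in> carrier_mat d d")
  case True
  have ix: "(transpose_mat W * W) $$ (i, j) = (\<Sum>k<d. W $$ (k, i) * W $$ (k, j))"
    if "i < d" "j < d" for i j
    using that True by (subst mult_mat_index[of _ d]) auto
  show ?thesis
    unfolding orth_mat_def using True ix by (auto simp: mat_eq_iff)
qed (simp add: orth_mat_def)

lemma orth_mat_right:
  assumes "orth_mat d W"
  shows "W * transpose_mat W = 1\<^sub>m d"
  using assms mat_mult_left_right_inverse[of "transpose_mat W" d W] by (auto simp: orth_mat_def)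

lemma orth_mat_one: "orth_mat d (1\<^sub>m d)"
  by (simp add: orth_mat_def)

lemma orth_mat_mult:
  assumes "orth_mat d V" "orth_mat d W"
  shows "orth_mat d (V * W)"
proof -
  have c: "V \<in> carrier_mat d d" "W \<in> carrier_mat d d"
    and o: "transpose_mat V * V = 1\<^sub>m d" "transpose_mat W * W = 1\<^sub>m d"
    using assms by (auto simp: orth_mat_def)
  have "transpose_mat (V * W) * (V * W) = transpose_mat W * transpose_mat V * (V * W)"
    using c by (simp add: transpose_mult[of V d d W d])
  also have "\<dots> = transpose_mat W * (transpose_mat V * V) * W"
    using c by (simp add: assoc_mult_mat[of _ d d _ d _ d])
  also have "\<dots> = 1\<^sub>m d"
    using c o by simp
  finally show ?thesis
    using c by (simp add: orth_mat_def)
qed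

lemma orth_mat_entry_le:
  assumes "orth_mat d W" "i < d" "j < d"
  shows "\<bar>W $$ (i, j)\<bar> \<le> 1"
proof -
  have "(W $$ (i, j))\<^sup>2 \<le> (\<Sum>k<d. (W $$ (k, j))\<^sup>2)"
    using assms by (intro member_le_sum) auto
  also have "\<dots> = 1"
    using assms by (auto simp: orth_mat_iff power2_eq_square)
  finally show ?thesis
    by (simp add: abs_square_le_1)
qed

text \<open>Left multiplication by \<open>W\<close> and by its transpose are adjoint. A competitor
  \<open>W * H\<close> of \<open>W\<close> against \<open>A\<close> thus becomes a competitor
  \<open>H\<close> of the identity against \<open>transpose_mat W * A\<close>, and maximality at
  \<open>W\<close> becomes maximality at the identity.\<close>

lemma mat_inner_mult:
  assumes "W \<in> carrier_mat d d" "H \<in> carrier_mat d d" "A \<in> carrier_mat d d"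
  shows "mat_inner d (W * H) A = mat_inner d H (transpose_mat W * A)"
proof -
  have "mat_inner d (W * H) A = (\<Sum>i<d. \<Sum>j<d. \<Sum>k<d. W $$ (i, k) * H $$ (k, j) * A $$ (i, j))"
    unfolding mat_inner_def using assms
    by (intro sum.cong refl) (simp add: mult_mat_index[of W d H] sum_distrib_right del: index_mult_mat)
  also have "\<dots> = (\<Sum>k<d. \<Sum>j<d. \<Sum>i<d. W $$ (i, k) * H $$ (k, j) * A $$ (i, j))"
    by (subst sum.swap[of _ "{..<d}" "{..<d}"], subst (2) sum.swap, subst sum.swap)
      (rule refl)
  also have "\<dots> = (\<Sum>k<d. \<Sum>j<d. H $$ (k, j) * (transpose_mat W * A) $$ (k, j))"
    using assms
    by (intro sum.cong refl)
      (simp add: mult_mat_index[of "transpose_mat W" d A] sum_distrib_left ac_simps del: index_mult_mat)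
  finally show ?thesis
    by (simp add: mat_inner_def)
qed

text \<open>Householder reflection along \<open>v\<close>. For \<open>v = 0\<close> the convention
  \<open>2 / 0 = 0\<close> makes it the identity, so it is orthogonal for every
  \<open>v\<close>.\<close>

definition reflection :: "nat \<Rightarrow> (nat \<Rightarrow> real) \<Rightarrow> real mat" where
  "reflection d v = Matrix.mat d d (\<lambda>(i, j). (if i = j then 1 else 0) - 2 / (\<Sum>k<d. (v k)\<^sup>2) * (v i * v j))"

lemma orth_mat_reflection: "orth_mat d (reflection d v)"
proof -
  define N where "N = (\<Sum>k<d. (v k)\<^sup>2)"
  define c where "c = 2 / N"
  have cN: "c * c * N = 2 * c"
    by (auto simp: c_def power2_eq_square)
  have "(\<Sum>k<d. ((if k = i then 1 else 0) - c * (v k * v i)) * ((if k = j then 1 else 0) - c * (v k * v j)))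
      = (if i = j then 1 else 0)" if "i < d" "j < d" for i j
  proof -
    have "(\<Sum>k<d. ((if k = i then 1 else 0) - c * (v k * v i)) * ((if k = j then 1 else 0) - c * (v k * v j)))
      = (\<Sum>k<d. (if k = i then (if i = j then 1 else 0) - c * (v i * v j) else 0)
           - (if k = j then c * (v i * v j) else 0) + c * c * (v i * v j) * (v k)\<^sup>2)"
      by (intro sum.cong refl) (auto simp: algebra_simps power2_eq_square)
    also have "\<dots> = (if i = j then 1 else 0) - c * (v i * v j) - c * (v i * v j) + c * c * (v i * v j) * N"
      using that by (simp add: sum.distrib sum_subtractf N_def sum_distrib_left)
    also have "\<dots> = (if i = j then 1 else 0)"
      using arg_cong[OF cN, of "\<lambda>x. x * (v i * v j)"] by (auto simp: algebra_simps)
    finally show ?thesis .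
  qed
  then show ?thesis
    unfolding orth_mat_iff by (auto simp: reflection_def N_def c_def)
qed

lemma mat_inner_reflection:
  assumes "B \<in> carrier_mat d d"
  shows "mat_inner d (reflection d v) B = mat_inner d (1\<^sub>m d) B
    - 2 / (\<Sum>k<d. (v k)\<^sup>2) * (\<Sum>i<d. \<Sum>j<d. v i * v j * B $$ (i, j))"
  unfolding mat_inner_def reflection_def
  by (simp add: left_diff_distrib sum_subtractf sum_distrib_left mult.assoc)

section \<open>Positive semidefinite matrices and uniqueness of their square roots\<close>

lemma psd_mat_iff:
  "psd_mat d B \<longleftrightarrow> B \<in> carrier_mat d d \<and> (\<forall>i<d. \<forall>j<d. B $$ (i, j) = B $$ (j, i)) \<and>
     (\<forall>v. 0 \<le> (\<Sum>i<d. \<Sum>j<d. v i * v j * B $$ (i, j)))"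
proof (cases "B \<in> carrier_mat d d")
  case True
  have *: "v \<bullet> (B *\<^sub>v v) = (\<Sum>i<d. \<Sum>j<d. v $ i * v $ j * B $$ (i, j))" if "v \<in> carrier_vec d" for v
    using that True
    by (auto simp: scalar_prod_def atLeast0LessThan sum_distrib_left ac_simps intro!: sum.cong)
  have s: "transpose_mat B = B \<longleftrightarrow> (\<forall>i<d. \<forall>j<d. B $$ (i, j) = B $$ (j, i))"
    using True by (auto simp: mat_eq_iff)
  have p: "(\<forall>v\<in>carrier_vec d. 0 \<le> v \<bullet> (B *\<^sub>v v)) \<longleftrightarrow>
      (\<forall>v. 0 \<le> (\<Sum>i<d. \<Sum>j<d. v i * v j * B $$ (i, j)))"
  proof
    assume l: "\<forall>v\<in>carrier_vec d. 0 \<le> v \<bullet> (B *\<^sub>v v)"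
    show "\<forall>v. 0 \<le> (\<Sum>i<d. \<Sum>j<d. v i * v j * B $$ (i, j))"
    proof
      fix v :: "nat \<Rightarrow> real"
      have "0 \<le> Matrix.vec d v \<bullet> (B *\<^sub>v Matrix.vec d v)"
        using l by simp
      then show "0 \<le> (\<Sum>i<d. \<Sum>j<d. v i * v j * B $$ (i, j))"
        by (subst (asm) *) auto
    qed
  qed (simp add: *)
  show ?thesis
    unfolding psd_mat_def s p ..
qed (simp add: psd_mat_def)

text \<open>Maximality of \<open>tr B\<close> against one reflection makes the quadratic form of \<open>B\<close> nonnegative;
  against the product of the reflections at \<open>e\<^sub>p\<close> and \<open>e\<^sub>p + t e\<^sub>q\<close>, to first order in \<open>t\<close>, it
  makes \<open>B\<close> symmetric.\<close>

lemma psd_mat_of_max: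
  assumes B: "B \<in> carrier_mat d d"
    and max: "\<And>H. orth_mat d H \<Longrightarrow> mat_inner d H B \<le> mat_inner d (1\<^sub>m d) B"
  shows "psd_mat d B"
proof -
  have nonneg: "0 \<le> (\<Sum>i<d. \<Sum>j<d. v i * v j * B $$ (i, j))" for v
  proof -
    define N where "N = (\<Sum>k<d. (v k)\<^sup>2)"
    have N0: "N \<ge> 0"
      by (simp add: N_def sum_nonneg)
    show ?thesis
    proof (cases "N = 0")
      case True
      then have "\<forall>k<d. v k = 0"
        by (simp add: N_def sum_nonneg_eq_0_iff)
      then show ?thesis
        by simp
    next
      case False
      have "0 \<le> 2 / N * (\<Sum>i<d. \<Sum>j<d. v i * v j * B $$ (i, j))"
        using max[OF orth_mat_reflection[of d v]] by (simp add: mat_inner_reflection[OF B] N_def)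
      then show ?thesis
        using False N0 by (simp add: zero_le_mult_iff zero_le_divide_iff)
    qed
  qed
  have le: "B $$ (p, q) - B $$ (q, p) \<le> t * (B $$ (p, p) + B $$ (q, q))"
    if pq: "p < d" "q < d" "p \<noteq> q" and t: "t > 0" for p q t
  proof -
    define u where "u = (\<lambda>k. if k = p then 1 else 0 :: real)"
    define v where "v = (\<lambda>k. if k = p then 1 else if k = q then t else 0)"
    define R where "R = reflection d u"
    \<comment> \<open>Reflecting at the unit vector of index \<open>p\<close> changes the sign of
      row \<open>p\<close> of \<open>B\<close> and nothing else.\<close>
    define B' where "B' = transpose_mat R * B"
    have sum_v: "(\<Sum>k<d. v k * f k) = f p + t * f q" for f
    proof -
      have "(\<Sum>k<d. v k * f k) = (\<Sum>k<d. (if k = p then f p else 0) + (if k = q then t * f q else 0))"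
        using pq by (intro sum.cong refl) (auto simp: v_def)
      then show ?thesis
        using pq by (simp add: sum.distrib)
    qed
    have R: "R \<in> carrier_mat d d" "orth_mat d R"
      using orth_mat_reflection by (auto simp: R_def reflection_def)
    have Nu: "(\<Sum>k<d. (u k)\<^sup>2) = 1"
      using pq by (simp add: u_def if_distrib[of "\<lambda>x. x\<^sup>2"] cong: if_cong)
    have Nv: "(\<Sum>k<d. (v k)\<^sup>2) = 1 + t\<^sup>2"
      using sum_v[of v] pq by (simp add: power2_eq_square) (simp add: v_def)
    have B': "B' $$ (i, j) = B $$ (i, j) - (if i = p then 2 * B $$ (p, j) else 0)" if "i < d" "j < d" for i j
    proof -
      have "B' $$ (i, j) = (\<Sum>k<d. R $$ (k, i) * B $$ (k, j))"
        unfolding B'_def using that R B by (subst mult_mat_index[of _ d]) auto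
      also have "\<dots> = (\<Sum>k<d. (if k = i then B $$ (i, j) else 0) - (if k = p then (if i = p then 2 * B $$ (p, j) else 0) else 0))"
        using that by (intro sum.cong refl) (auto simp: R_def reflection_def Nu, auto simp: u_def)
      also have "\<dots> = B $$ (i, j) - (if i = p then 2 * B $$ (p, j) else 0)"
        using that pq by (simp add: sum_subtractf)
      finally show ?thesis .
    qed
    have B'c: "B' \<in> carrier_mat d d"
      using R B by (simp add: B'_def)
    have quad: "(\<Sum>i<d. \<Sum>j<d. v i * v j * B' $$ (i, j))
        = - B $$ (p, p) - t * B $$ (p, q) + t * (B $$ (q, p) + t * B $$ (q, q))"
    proof -
      have "(\<Sum>i<d. \<Sum>j<d. v i * v j * B' $$ (i, j)) = (\<Sum>i<d. v i * (\<Sum>j<d. v j * B' $$ (i, j)))"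
        by (simp add: sum_distrib_left mult.assoc)
      also have "\<dots> = - B $$ (p, p) - t * B $$ (p, q) + t * (B $$ (q, p) + t * B $$ (q, q))"
        unfolding sum_v using pq by (simp add: B' algebra_simps)
      finally show ?thesis .
    qed
    have tr: "mat_inner d (1\<^sub>m d) B' = mat_inner d (1\<^sub>m d) B - 2 * B $$ (p, p)"
    proof -
      have one: "mat_inner d (1\<^sub>m d) C = (\<Sum>i<d. C $$ (i, i))" for C
        unfolding mat_inner_def
        by (intro sum.cong refl) (simp add: if_distrib[of "\<lambda>x. x * _"] cong: if_cong)
      have "(\<Sum>i<d. B' $$ (i, i)) = (\<Sum>i<d. B $$ (i, i) - (if i = p then 2 * B $$ (p, p) else 0))"
        by (intro sum.cong refl) (auto simp: B')
      also have "\<dots> = (\<Sum>i<d. B $$ (i, i)) - 2 * B $$ (p, p)"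
        using pq by (simp add: sum_subtractf)
      finally show ?thesis
        by (simp add: one)
    qed
    have Rv: "reflection d v \<in> carrier_mat d d"
      by (simp add: reflection_def)
    have "mat_inner d (reflection d v) B' \<le> mat_inner d (1\<^sub>m d) B"
      using max[OF orth_mat_mult[OF R(2) orth_mat_reflection[of d v]]]
      by (simp add: mat_inner_mult[OF R(1) Rv B] B'_def)
    then have "- (2 * B $$ (p, p)) - 2 / (1 + t\<^sup>2) *
        (- B $$ (p, p) - t * B $$ (p, q) + t * (B $$ (q, p) + t * B $$ (q, q))) \<le> 0"
      unfolding mat_inner_reflection[OF B'c] quad Nv tr by simp
    moreover have pos: "1 + t\<^sup>2 > 0"
      by (simp add: add_pos_nonneg)
    ultimately have "- (B $$ (p, p) * (1 + t\<^sup>2)) \<le>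
        - B $$ (p, p) - t * B $$ (p, q) + t * (B $$ (q, p) + t * B $$ (q, q))"
      by (simp add: field_simps)
    then have "t * (B $$ (p, q) - B $$ (q, p)) \<le> t * (t * (B $$ (p, p) + B $$ (q, q)))"
      by (simp add: algebra_simps power2_eq_square)
    then show ?thesis
      using t by simp
  qed
  have sym_le: "B $$ (p, q) \<le> B $$ (q, p)" if pq: "p < d" "q < d" "p \<noteq> q" for p q
  proof (rule ccontr)
    assume neg: "\<not> ?thesis"
    define c where "c = B $$ (p, q) - B $$ (q, p)"
    define a where "a = B $$ (p, p) + B $$ (q, q)"
    have c: "c > 0"
      using neg by (simp add: c_def)
    \<comment> \<open>A value of \<open>t\<close> so small that \<open>t * a\<close> is at most
      \<open>c / 2\<close>; the \<open>+ 1\<close> covers \<open>a = 0\<close>.\<close>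
    have "c / (2 * (\<bar>a\<bar> + 1)) > 0"
      using c by simp
    from le[OF pq this] have "c \<le> (c / (2 * (\<bar>a\<bar> + 1))) * a"
      by (simp only: c_def a_def)
    also have "\<dots> \<le> (c / (2 * (\<bar>a\<bar> + 1))) * (\<bar>a\<bar> + 1)"
      using c by (intro mult_left_mono) auto
    also have "\<dots> = c / 2"
      by (simp add: field_simps)
    finally show False
      using c by simp
  qed
  show ?thesis
    unfolding psd_mat_iff using B nonneg sym_le by (metis order_antisym)
qed

text \<open>Compactness: entries of orthogonal matrices lie in \<open>{-1..1}\<close>, and the
  orthogonality equations are closed conditions. Matrices are represented by functions on index
  pairs under the product topology; pinning the coordinates outside the d by d block to 0 makes
  \<open>box\<close> a product of compact sets.\<close>

lemma orth_mat_max: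
  assumes A: "A \<in> carrier_mat d d"
  shows "\<exists>W. orth_mat d W \<and> (\<forall>V. orth_mat d V \<longrightarrow> mat_inner d V A \<le> mat_inner d W A)"
proof -
  define box where "box = (PiE UNIV (\<lambda>p. if p \<in> {..<d} \<times> {..<d} then {-1..1} else {0::real}) :: (nat \<times> nat \<Rightarrow> real) set)"
  define O' where "O' = {f :: nat \<times> nat \<Rightarrow> real. \<forall>i<d. \<forall>j<d. (\<Sum>k<d. f (k, i) * f (k, j)) = (if i = j then 1 else 0)}"
  define \<phi> where "\<phi> = (\<lambda>f :: nat \<times> nat \<Rightarrow> real. \<Sum>i<d. \<Sum>j<d. f (i, j) * A $$ (i, j))"
  have "compactin (product_topology (\<lambda>_. euclidean) UNIV) box"
    unfolding box_def compactin_PiE by (auto simp: compactin_euclidean_iff)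
  then have "compact box"
    by (simp add: euclidean_product_topology compactin_euclidean_iff)
  moreover have "closed O'"
    unfolding O'_def
    by (intro closed_Collect_all closed_Collect_imp open_Collect_const closed_Collect_eq continuous_intros
        continuous_on_product_coordinates)
  ultimately have comp: "compact (box \<inter> O')"
    by (rule compact_Int_closed)
  have cont: "continuous_on (box \<inter> O') \<phi>"
    unfolding \<phi>_def by (intro continuous_intros continuous_on_product_coordinates
        continuous_on_subset[OF continuous_on_product_coordinates])  auto
  define rep where "rep = (\<lambda>(V :: real mat) p. if p \<in> {..<d} \<times> {..<d} then V $$ p else 0)"
  have rep: "rep V \<in> box \<inter> O'" "\<phi> (rep V) = mat_inner d V A" if "orth_mat d V" for V
  proof -
    show "rep V \<in> box \<inter> O'"
      using that orth_mat_entry_le[OF that]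
      unfolding box_def O'_def orth_mat_iff rep_def by (auto simp: abs_le_iff minus_le_iff)
    show "\<phi> (rep V) = mat_inner d V A"
      by (simp add: \<phi>_def mat_inner_def rep_def)
  qed
  have "box \<inter> O' \<noteq> {}"
    using rep(1)[OF orth_mat_one] by auto
  then obtain f where f: "f \<in> box \<inter> O'" "\<And>g. g \<in> box \<inter> O' \<Longrightarrow> \<phi> g \<le> \<phi> f"
    using continuous_attains_sup[OF comp _ cont] by auto
  define W where "W = Matrix.mat d d f"
  have "orth_mat d W"
    unfolding orth_mat_iff using f(1) by (simp add: W_def O'_def)
  moreover have "mat_inner d W A = \<phi> f"
    by (simp add: W_def mat_inner_def \<phi>_def)
  ultimately show ?thesis
    using f(2) rep by (metis (no_types))
qed

text \<open>A nonnegative form that vanishes at \<open>x\<close> has \<open>x\<close> in its kernel: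
  with \<open>y = B x\<close>, its value at \<open>x - t y\<close> is
  \<open>t\<^sup>2 * q y y - 2 * t * |y|\<^sup>2\<close>, which is negative for small positive
  \<open>t\<close> unless \<open>y = 0\<close>.\<close>

lemma psd_mat_null:
  assumes B: "psd_mat d B" and x: "(\<Sum>i<d. \<Sum>j<d. x i * x j * B $$ (i, j)) = 0" and "i < d"
  shows "(\<Sum>j<d. B $$ (i, j) * x j) = 0"
proof -
  define y where "y = (\<lambda>i. \<Sum>j<d. B $$ (i, j) * x j)"
  define q where "q = (\<lambda>u v. \<Sum>i<d. \<Sum>j<d. u i * v j * B $$ (i, j))"
  have sym: "q u v = q v u" for u v
  proof -
    have "q u v = (\<Sum>j<d. \<Sum>i<d. u i * v j * B $$ (i, j))"
      unfolding q_def by (rule sum.swap)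
    also have "\<dots> = q v u"
      unfolding q_def using B by (intro sum.cong refl) (auto simp: psd_mat_iff)
    finally show ?thesis .
  qed
  have qyx: "q y x = (\<Sum>i<d. (y i)\<^sup>2)"
    unfolding q_def by (auto simp: y_def power2_eq_square sum_distrib_left ac_simps intro!: sum.cong)
  have expand: "q (\<lambda>i. x i - t * y i) (\<lambda>i. x i - t * y i) = q x x - 2 * t * q y x + t\<^sup>2 * q y y" for t
  proof -
    have "q (\<lambda>i. x i - t * y i) (\<lambda>i. x i - t * y i) = q x x - t * q x y - t * q y x + t\<^sup>2 * q y y"
      unfolding q_def
      by (simp add: sum_distrib_left sum_subtractf[symmetric] sum.distrib[symmetric])
        (intro sum.cong refl, simp add: algebra_simps power2_eq_square)
    then show ?thesis
      by (simp add: sym[of x y])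
  qed
  have ineq: "2 * t * q y x \<le> t\<^sup>2 * q y y" for t
  proof -
    have "0 \<le> q (\<lambda>i. x i - t * y i) (\<lambda>i. x i - t * y i)"
      using B by (simp add: psd_mat_iff q_def)
    then show ?thesis
      using x by (simp add: expand) (simp add: q_def)
  qed
  have qyy: "q y y \<ge> 0"
    using B by (simp add: psd_mat_iff q_def)
  have "q y x \<le> 0"
  proof (rule ccontr)
    assume "\<not> q y x \<le> 0"
    then have pos: "q y x > 0"
      by simp
    define t where "t = q y x / (q y y + 1)"
    have t: "t > 0"
      using pos qyy by (simp add: t_def)
    have "t * (2 * q y x) \<le> t * (t * q y y)"
      using ineq[of t] by (simp add: power2_eq_square algebra_simps)
    then have "2 * q y x \<le> t * q y y"
      using t by simp
    also have "\<dots> \<le> t * (q y y + 1)"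
      using t by simp
    also have "\<dots> = q y x"
      using qyy by (simp add: t_def)
    finally show False
      using pos by simp
  qed
  then have "(\<Sum>i<d. (y i)\<^sup>2) = 0"
    unfolding qyx by (intro order_antisym sum_nonneg) auto
  then show ?thesis
    using \<open>i < d\<close> by (simp add: sum_nonneg_eq_0_iff y_def)
qed

text \<open>With \<open>D = B - C\<close>, the equation \<open>BD + DC = 0\<close> gives \<open>tr (DBD) + tr (DCD) = 0\<close>; both traces
  are nonnegative, so \<open>BD = CD = 0\<close> and hence \<open>D\<^sup>2 = 0\<close>.\<close>

lemma psd_mat_sqrt_unique:
  assumes B: "psd_mat d B" and C: "psd_mat d C" and eq: "B * B = C * C"
  shows "B = C"
proof -
  have Bc: "B \<in> carrier_mat d d" and Cc: "C \<in> carrier_mat d d"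
    and Bs: "\<And>i j. i < d \<Longrightarrow> j < d \<Longrightarrow> B $$ (i, j) = B $$ (j, i)"
    and Cs: "\<And>i j. i < d \<Longrightarrow> j < d \<Longrightarrow> C $$ (i, j) = C $$ (j, i)"
    using B C by (auto simp: psd_mat_iff)
  define D where "D = (\<lambda>i j. B $$ (i, j) - C $$ (i, j))"
  have Ds: "D i j = D j i" if "i < d" "j < d" for i j
    using Bs[OF that] Cs[OF that] by (simp add: D_def)
  have BDDC: "(\<Sum>k<d. B $$ (i, k) * D k j) + (\<Sum>k<d. D i k * C $$ (k, j)) = 0" if "i < d" "j < d" for i j
  proof -
    have "(\<Sum>k<d. B $$ (i, k) * B $$ (k, j)) = (\<Sum>k<d. C $$ (i, k) * C $$ (k, j))"
      using arg_cong[OF eq, of "\<lambda>X. X $$ (i, j)"] Bc Cc that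
      by (simp add: mult_mat_index[of _ d] del: index_mult_mat)
    then show ?thesis
      by (simp add: D_def sum.distrib[symmetric] algebra_simps sum_subtractf)
  qed
  \<comment> \<open>\<open>qB m\<close> is the form of \<open>B\<close> at column \<open>m\<close>
    of \<open>D\<close>; summed over \<open>m\<close> it is the trace of
    \<open>D B D\<close>.\<close>
  define qB where "qB = (\<lambda>m. \<Sum>i<d. \<Sum>j<d. D i m * D j m * B $$ (i, j))"
  define qC where "qC = (\<lambda>m. \<Sum>i<d. \<Sum>j<d. D i m * D j m * C $$ (i, j))"
  have "(\<Sum>m<d. qB m) + (\<Sum>m<d. qC m) = 0"
  proof -
    have "(\<Sum>i<d. \<Sum>m<d. D i m * ((\<Sum>k<d. B $$ (i, k) * D k m) + (\<Sum>k<d. D i k * C $$ (k, m)))) = 0"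
      by (intro sum.neutral ballI) (simp add: BDDC)
    moreover have "(\<Sum>i<d. \<Sum>m<d. D i m * (\<Sum>k<d. B $$ (i, k) * D k m)) = (\<Sum>m<d. qB m)"
      by (subst sum.swap) (simp add: qB_def sum_distrib_left ac_simps)
    moreover have "(\<Sum>i<d. \<Sum>m<d. D i m * (\<Sum>k<d. D i k * C $$ (k, m))) = (\<Sum>i<d. qC i)"
      unfolding qC_def sum_distrib_left
      by (intro sum.cong refl) (simp add: Ds Cs ac_simps)
    ultimately show ?thesis
      by (simp add: algebra_simps sum.distrib)
  qed
  moreover have nB: "qB m \<ge> 0" and nC: "qC m \<ge> 0" for m
    using B C by (auto simp: qB_def qC_def psd_mat_iff)
  moreover have "(\<Sum>m<d. qB m) \<ge> 0" "(\<Sum>m<d. qC m) \<ge> 0"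
    by (auto intro!: sum_nonneg nB nC)
  ultimately have "(\<Sum>m<d. qB m) = 0" "(\<Sum>m<d. qC m) = 0"
    by linarith+
  then have q0: "qB m = 0" "qC m = 0" if "m < d" for m
    using that nB nC by (simp_all add: sum_nonneg_eq_0_iff)
  have "D m m' = 0" if m: "m < d" "m' < d" for m m'
  proof -
    have "(\<Sum>j<d. B $$ (i, j) * D j m) = 0" "(\<Sum>j<d. C $$ (i, j) * D j m) = 0" if "i < d" for i
      using psd_mat_null[OF B _ that] psd_mat_null[OF C _ that] q0[OF m(1)]
      by (auto simp: qB_def qC_def)
    then have "(\<Sum>j<d. D m j * D j m) = 0"
      using m by (simp add: D_def left_diff_distrib sum_subtractf)
    then have "(\<Sum>j<d. (D m j)\<^sup>2) = 0"
      using m by (simp add: power2_eq_square Ds)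
    then show ?thesis
      using m by (simp add: sum_nonneg_eq_0_iff)
  qed
  then show ?thesis
    using Bc Cc by (intro eq_matI) (auto simp: D_def)
qed

text \<open>For a maximiser \<open>W\<close> over the orthogonal matrices,
  \<open>B = W\<^sup>T A\<close> is positive semidefinite by maximality, and
  \<open>B B = B\<^sup>T B = A\<^sup>T W W\<^sup>T A = A\<^sup>T A\<close>. By uniqueness
  \<open>B\<close> is the square root in the definition of the trace norm, which is therefore the
  trace of \<open>B\<close>. This is a polar decomposition obtained without diagonalising
  anything.\<close>

lemma trace_norm_orth:
  assumes A: "A \<in> carrier_mat d d"
  obtains W where "orth_mat d W" "trace_norm A = mat_inner d W A"
    "\<And>V. orth_mat d V \<Longrightarrow> mat_inner d V A \<le> trace_norm A"
proof -
  obtain W where W: "orth_mat d W" "\<And>V. orth_mat d V \<Longrightarrow> mat_inner d V A \<le> mat_inner d W A"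
    using orth_mat_max[OF A] by blast
  have Wc: "W \<in> carrier_mat d d"
    using W by (simp add: orth_mat_def)
  define B where "B = transpose_mat W * A"
  have Bc: "B \<in> carrier_mat d d"
    using A Wc by (simp add: B_def)
  have tr: "mat_inner d (1\<^sub>m d) B = mat_inner d W A"
    using mat_inner_mult[OF Wc one_carrier_mat A] Wc by (simp add: B_def)
  have psd: "psd_mat d B"
  proof (rule psd_mat_of_max[OF Bc])
    fix H assume H: "orth_mat d H"
    then have "H \<in> carrier_mat d d"
      by (simp add: orth_mat_def)
    then have "mat_inner d H B = mat_inner d (W * H) A"
      by (simp add: mat_inner_mult[OF Wc _ A] B_def)
    then show "mat_inner d H B \<le> mat_inner d (1\<^sub>m d) B"
      using W(2)[OF orth_mat_mult[OF W(1) H]] by (simp add: tr)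
  qed
  have "B * B = transpose_mat B * B"
    using psd by (simp add: psd_mat_def)
  also have "\<dots> = transpose_mat A * W * (transpose_mat W * A)"
    using A Wc by (simp add: B_def transpose_mult[of _ d d _ d])
  also have "\<dots> = transpose_mat A * (W * transpose_mat W) * A"
    using A Wc by (simp add: assoc_mult_mat[of _ d d _ d _ d])
  also have "\<dots> = transpose_mat A * A"
    using A by (simp add: orth_mat_right[OF W(1)])
  finally have BB: "B * B = transpose_mat A * A" .
  have "psd_sqrt d (transpose_mat A * A) = B"
    unfolding psd_sqrt_def
    by (rule the_equality) (use psd BB psd_mat_sqrt_unique in auto)
  then have "trace_norm A = mat_trace B"
    using A by (simp add: trace_norm_def)
  also have "\<dots> = mat_inner d (1\<^sub>m d) B"
    unfolding mat_inner_def mat_trace_def using Bc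
    by (intro sum.cong) (auto simp: if_distrib[of "\<lambda>x. x * _"] cong: if_cong)
  finally have "trace_norm A = mat_inner d W A"
    by (simp add: tr)
  then show ?thesis
    using that W by simp
qed

section \<open>Duality bounds, continuity and measurability of the trace norm\<close>

lemma orth_mat_uminus: "orth_mat d W \<Longrightarrow> orth_mat d (- W)"
  by (auto simp: orth_mat_iff)

text \<open>\<open>- W\<close> is orthogonal along with \<open>W\<close>, so the maximum is at least
  its own negative.\<close>

lemma trace_norm_nonneg:
  assumes A: "A \<in> carrier_mat d d"
  shows "0 \<le> trace_norm A"
proof -
  obtain W where W: "orth_mat d W" "trace_norm A = mat_inner d W A"
    "\<And>V. orth_mat d V \<Longrightarrow> mat_inner d V A \<le> trace_norm A"
    using trace_norm_orth[OF A] by blast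
  have "W \<in> carrier_mat d d"
    using W(1) by (simp add: orth_mat_def)
  then have "mat_inner d (- W) A = - mat_inner d W A"
    by (simp add: mat_inner_def sum_negf)
  then show ?thesis
    using W(2) W(3)[OF orth_mat_uminus[OF W(1)]] by simp
qed

text \<open>\<open>W\<^sup>T u\<close> has the length of \<open>u\<close> because the rows of
  \<open>W\<close> are orthonormal; Cauchy-Schwarz does the rest. The absence of a dimension factor
  is what keeps the bias free of \<open>d\<close>.\<close>

lemma orth_mat_bilinear_le:
  assumes W: "orth_mat d W"
  shows "\<bar>\<Sum>i<d. \<Sum>j<d. W $$ (i, j) * (u i * v j)\<bar> \<le> eucl_norm d u * eucl_norm d v"
proof -
  define w where "w = (\<lambda>j. \<Sum>i<d. W $$ (i, j) * u i)"
  have Wr: "(\<Sum>j<d. W $$ (i, j) * W $$ (k, j)) = (if i = k then 1 else 0)" if "i < d" "k < d" for i k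
  proof -
    have "(W * transpose_mat W) $$ (i, k) = (\<Sum>j<d. W $$ (i, j) * W $$ (k, j))"
      using W that by (subst mult_mat_index[of _ d]) (auto simp: orth_mat_def)
    then show ?thesis
      using that by (simp add: orth_mat_right[OF W])
  qed
  have "(\<Sum>j<d. (w j)\<^sup>2) = (\<Sum>j<d. \<Sum>i<d. \<Sum>k<d. u i * u k * (W $$ (i, j) * W $$ (k, j)))"
    by (simp add: w_def power2_eq_square sum_product ac_simps)
  also have "\<dots> = (\<Sum>i<d. \<Sum>k<d. \<Sum>j<d. u i * u k * (W $$ (i, j) * W $$ (k, j)))"
    by (subst sum.swap, subst (2) sum.swap) (rule refl)
  also have "\<dots> = (\<Sum>i<d. \<Sum>k<d. u i * u k * (if i = k then 1 else 0))"
    by (intro sum.cong refl) (simp add: sum_distrib_left[symmetric] Wr)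
  also have "\<dots> = (\<Sum>i<d. (u i)\<^sup>2)"
    by (simp add: power2_eq_square if_distrib[of "\<lambda>x. _ * x"] cong: if_cong)
  finally have Nw: "eucl_norm d w = eucl_norm d u"
    by (simp add: L2_set_def)
  have "(\<Sum>i<d. \<Sum>j<d. W $$ (i, j) * (u i * v j)) = (\<Sum>j<d. w j * v j)"
    by (subst sum.swap) (simp add: w_def sum_distrib_left sum_distrib_right ac_simps)
  then have "\<bar>\<Sum>i<d. \<Sum>j<d. W $$ (i, j) * (u i * v j)\<bar> \<le> (\<Sum>j<d. \<bar>w j\<bar> * \<bar>v j\<bar>)"
    by (simp add: sum_abs flip: abs_mult)
  also have "\<dots> \<le> eucl_norm d w * eucl_norm d v"
    by (rule L2_set_mult_ineq)
  finally show ?thesis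
    by (simp add: Nw)
qed

text \<open>Cauchy-Schwarz for the entries: the \<open>d\<close> columns of \<open>W\<close> are
  unit vectors, so its Frobenius norm is \<open>sqrt d\<close>.\<close>

lemma orth_mat_inner_le:
  assumes W: "orth_mat d W"
  shows "mat_inner d W A \<le> sqrt (real d) * L2_set (\<lambda>p. A $$ p) ({..<d} \<times> {..<d})"
proof -
  have "(\<Sum>i<d. \<Sum>j<d. (W $$ (i, j))\<^sup>2) = (\<Sum>j<d. \<Sum>i<d. W $$ (i, j) * W $$ (i, j))"
    unfolding power2_eq_square by (rule sum.swap)
  also have "\<dots> = real d"
    using W by (simp add: orth_mat_iff)
  finally have NW: "L2_set (\<lambda>p. W $$ p) ({..<d} \<times> {..<d}) = sqrt (real d)"
    by (simp add: L2_set_def sum.cartesian_product)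
  have "mat_inner d W A = (\<Sum>p\<in>{..<d} \<times> {..<d}. W $$ p * A $$ p)"
    by (simp add: mat_inner_def sum.cartesian_product)
  also have "\<dots> \<le> (\<Sum>p\<in>{..<d} \<times> {..<d}. \<bar>W $$ p\<bar> * \<bar>A $$ p\<bar>)"
    by (intro sum_mono) (metis abs_ge_self abs_mult)
  also have "\<dots> \<le> L2_set (\<lambda>p. W $$ p) ({..<d} \<times> {..<d}) * L2_set (\<lambda>p. A $$ p) ({..<d} \<times> {..<d})"
    by (rule L2_set_mult_ineq)
  finally show ?thesis
    by (simp add: NW)
qed

text \<open>Both trace norms are maxima over the same orthogonal matrices, whose entries are at most
  1 in absolute value. The crude Lipschitz bound serves for continuity, hence for
  measurability.\<close>

lemma trace_norm_diff_le:
  "\<bar>trace_norm (Matrix.mat d d f) - trace_norm (Matrix.mat d d g)\<bar> \<le> (\<Sum>i<d. \<Sum>j<d. \<bar>f (i, j) - g (i, j)\<bar>)"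
proof -
  have le: "trace_norm (Matrix.mat d d f) \<le> trace_norm (Matrix.mat d d g) + (\<Sum>i<d. \<Sum>j<d. \<bar>f (i, j) - g (i, j)\<bar>)"
    for f g :: "nat \<times> nat \<Rightarrow> real"
  proof -
    obtain W where W: "orth_mat d W" "trace_norm (Matrix.mat d d f) = mat_inner d W (Matrix.mat d d f)"
      using trace_norm_orth[OF mat_carrier] by metis
    have "mat_inner d W (Matrix.mat d d f) - mat_inner d W (Matrix.mat d d g)
        = (\<Sum>i<d. \<Sum>j<d. W $$ (i, j) * (f (i, j) - g (i, j)))"
      by (simp add: mat_inner_def sum_subtractf right_diff_distrib)
    also have "\<dots> \<le> (\<Sum>i<d. \<Sum>j<d. \<bar>f (i, j) - g (i, j)\<bar>)"
    proof (intro sum_mono)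
      fix i j assume "i \<in> {..<d}" "j \<in> {..<d}"
      then have "\<bar>W $$ (i, j)\<bar> * \<bar>f (i, j) - g (i, j)\<bar> \<le> 1 * \<bar>f (i, j) - g (i, j)\<bar>"
        using orth_mat_entry_le[OF W(1)] by (intro mult_right_mono) auto
      then show "W $$ (i, j) * (f (i, j) - g (i, j)) \<le> \<bar>f (i, j) - g (i, j)\<bar>"
        by (metis abs_ge_self abs_mult mult_1 order_trans)
    qed
    moreover have "mat_inner d W (Matrix.mat d d g) \<le> trace_norm (Matrix.mat d d g)"
      using trace_norm_orth[OF mat_carrier] W(1) by metis
    ultimately show ?thesis
      using W(2) by linarith
  qed
  show ?thesis
    using le[of f g] le[of g f] by (simp add: abs_minus_commute)
qed

text \<open>The definite description behind \<open>psd_sqrt\<close> gives no handle on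
  measurability, so the trace norm is shown to be continuous in the entries. The map
  \<open>f'\<close> extends the entries by 0 because the product space is indexed by all pairs of
  naturals.\<close>

lemma borel_measurable_trace_norm:
  assumes [measurable]: "\<And>i j. i < d \<Longrightarrow> j < d \<Longrightarrow> (\<lambda>\<omega>. f \<omega> (i, j)) \<in> borel_measurable M"
  shows "(\<lambda>\<omega>. trace_norm (Matrix.mat d d (f \<omega>))) \<in> borel_measurable M"
proof -
  define F where "F = (\<lambda>a :: nat \<times> nat \<Rightarrow> real. trace_norm (Matrix.mat d d a))"
  have "isCont F a" for a
    unfolding isCont_def
  proof (rule LIM_zero_cancel, rule Lim_null_comparison)
    show "\<forall>\<^sub>F x in at a. norm (F x - F a) \<le> (\<Sum>i<d. \<Sum>j<d. \<bar>x (i, j) - a (i, j)\<bar>)"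
      unfolding F_def real_norm_def by (intro always_eventually allI trace_norm_diff_le)
    have c: "continuous_on UNIV (\<lambda>x :: nat \<times> nat \<Rightarrow> real. \<Sum>i<d. \<Sum>j<d. \<bar>x (i, j) - a (i, j)\<bar>)"
      by (intro continuous_intros continuous_on_product_coordinates)
    then show "((\<lambda>x. \<Sum>i<d. \<Sum>j<d. \<bar>x (i, j) - a (i, j)\<bar>) \<longlongrightarrow> 0) (at a)"
      using continuous_on_def[THEN iffD1, OF c, rule_format, of a] by simp
  qed
  then have F: "F \<in> borel_measurable borel"
    by (intro borel_measurable_continuous_onI continuous_at_imp_continuous_on) auto
  define f' where "f' = (\<lambda>\<omega> p. if fst p < d \<and> snd p < d then f \<omega> p else 0)"
  have "(\<lambda>\<omega>. f' \<omega> p) \<in> borel_measurable M" for p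
    using assms[of "fst p" "snd p"] by (cases "fst p < d \<and> snd p < d") (auto simp: f'_def)
  then have "f' \<in> borel_measurable M"
    by (rule measurable_coordinatewise_then_product)
  then have "(\<lambda>\<omega>. F (f' \<omega>)) \<in> borel_measurable M"
    using F by measurable
  moreover have "F (f' \<omega>) = trace_norm (Matrix.mat d d (f \<omega>))" for \<omega>
    unfolding F_def by (rule arg_cong[of _ _ trace_norm]) (auto simp: f'_def)
  ultimately show ?thesis
    by simp
qed

section \<open>Moments\<close>

text \<open>For even \<open>p\<close> this says that the \<open>L\<^sup>p\<close> norm of \<open>f\<close> is at most \<open>c\<close>.\<close>

definition moment_le :: "'a measure \<Rightarrow> nat \<Rightarrow> ('a \<Rightarrow> real) \<Rightarrow> real \<Rightarrow> bool" where
  "moment_le N p f c \<longleftrightarrow> f \<in> borel_measurable N \<and> integrable N (\<lambda>x. f x ^ p) \<and> (\<integral>x. f x ^ p \<partial>N) \<le> c ^ p"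

lemma moment_leD:
  assumes "moment_le N p f c"
  shows "f \<in> borel_measurable N" "integrable N (\<lambda>x. f x ^ p)" "(\<integral>x. f x ^ p \<partial>N) \<le> c ^ p"
  using assms by (auto simp: moment_le_def)

lemma moment_le_mono:
  assumes f: "moment_le N p f c" and p: "even p" and g: "g \<in> borel_measurable N"
    and le: "AE x in N. \<bar>g x\<bar> \<le> \<bar>f x\<bar>" and c: "0 \<le> c" "c \<le> c'"
  shows "moment_le N p g c'"
proof -
  have le': "AE x in N. g x ^ p \<le> f x ^ p"
    using le by eventually_elim (use p in \<open>metis power_even_abs power_mono abs_ge_zero\<close>)
  have g0: "0 \<le> g x ^ p" for x
    using p by (simp add: zero_le_even_power)
  have i: "integrable N (\<lambda>x. g x ^ p)"
    using moment_leD[OF f] le' g g0 p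
    by (intro Bochner_Integration.integrable_bound[of N "\<lambda>x. f x ^ p" "\<lambda>x. g x ^ p"]) (auto simp: zero_le_even_power)
  have "(\<integral>x. g x ^ p \<partial>N) \<le> (\<integral>x. f x ^ p \<partial>N)"
    using le' i moment_leD[OF f] by (intro integral_mono_AE)
  also have "\<dots> \<le> c' ^ p"
    using moment_leD(3)[OF f] power_mono[OF c(2,1), of p] by linarith
  finally show ?thesis
    using i g by (simp add: moment_le_def)
qed

lemma moment_le_cong:
  assumes "moment_le N p f c" "even p" "0 \<le> c" "g \<in> borel_measurable N" "AE x in N. g x = f x"
  shows "moment_le N p g c"
  by (rule moment_le_mono[OF assms(1,2,4) _ assms(3) order_refl]) (use assms(5) in eventually_elim, simp)

lemma moment_le_distr:
  assumes "distr N N' T = N'" "T \<in> measurable N N'"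
  shows "f \<in> borel_measurable N' \<Longrightarrow> moment_le N p (\<lambda>x. f (T x)) c \<longleftrightarrow> moment_le N' p f c"
proof -
  assume f: "f \<in> borel_measurable N'"
  have "integrable N (\<lambda>x. f (T x) ^ p) \<longleftrightarrow> integrable N' (\<lambda>x. f x ^ p)"
    using integrable_distr_eq[OF assms(2), of "\<lambda>x. f x ^ p"] f assms(1) by simp
  moreover have "(\<integral>x. f (T x) ^ p \<partial>N) = (\<integral>x. f x ^ p \<partial>N')"
    using integral_distr[OF assms(2), of "\<lambda>x. f x ^ p"] f assms(1) by simp
  ultimately show ?thesis
    using f measurable_compose[OF assms(2) f] by (auto simp: moment_le_def)
qed

text \<open>Allows the constants of a bound to be taken positive, as division by them requires,
  before the excess tends to 0.\<close>

lemma moment_le_eps: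
  assumes "\<And>e. e > 0 \<Longrightarrow> moment_le N p f (c + e)"
  shows "moment_le N p f c"
proof -
  have "((\<lambda>e. (c + e) ^ p) \<longlongrightarrow> (c + 0) ^ p) (at_right 0)"
    by (intro tendsto_intros)
  moreover have "\<forall>\<^sub>F e in at_right 0. (\<integral>x. f x ^ p \<partial>N) \<le> (c + e) ^ p"
    using eventually_at_right_less[of 0] by eventually_elim (use assms moment_leD in blast)
  ultimately have "(\<integral>x. f x ^ p \<partial>N) \<le> c ^ p"
    using tendsto_lowerbound[of _ "(c + 0) ^ p" "at_right 0"] trivial_limit_at_right_real by fastforce
  then show ?thesis
    using assms[of 1] by (simp add: moment_le_def)
qed

lemma moment_le_scale:
  assumes "moment_le N p f c" "even p"
  shows "moment_le N p (\<lambda>x. a * f x) (a * c)"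
  using assms unfolding moment_le_def
  by (auto simp: power_mult_distrib intro!: mult_left_mono)

text \<open>Minkowski's inequality, from the convexity of \<open>x\<^sup>p\<close> with weights \<open>c l / \<Sum>c\<close>.\<close>

lemma moment_le_sum_pos:
  assumes S: "finite S" "S \<noteq> {}" and p: "even p"
    and f: "\<And>l. l \<in> S \<Longrightarrow> moment_le N p (f l) (c l)" and c: "\<And>l. l \<in> S \<Longrightarrow> c l > 0"
  shows "moment_le N p (\<lambda>x. \<Sum>l\<in>S. f l x) (\<Sum>l\<in>S. c l)"
proof -
  define C where "C = (\<Sum>l\<in>S. c l)"
  have C: "C > 0"
    unfolding C_def using S c by (intro sum_pos) auto
  have meas: "(\<lambda>x. \<Sum>l\<in>S. f l x) \<in> borel_measurable N"
    using f by (intro borel_measurable_sum) (auto dest: moment_leD(1))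
  define h where "h = (\<lambda>x. \<Sum>l\<in>S. c l / C * (C / c l * f l x) ^ p)"
  have conv: "(\<Sum>l\<in>S. f l x) ^ p \<le> h x" for x
  proof -
    have "(\<Sum>l\<in>S. (c l / C) *\<^sub>R (C / c l * f l x)) ^ p \<le> (\<Sum>l\<in>S. c l / C * (C / c l * f l x) ^ p)"
      using S c C by (intro convex_on_sum[OF _ _ convex_power_even[OF p]])
        (auto simp: sum_divide_distrib[symmetric] C_def less_imp_le)
    moreover have "(\<Sum>l\<in>S. (c l / C) *\<^sub>R (C / c l * f l x)) = (\<Sum>l\<in>S. f l x)"
      using c C by (intro sum.cong refl) (auto simp: less_imp_neq[symmetric])
    ultimately show ?thesis
      by (simp add: h_def)
  qed
  have hi: "integrable N h"
    unfolding h_def power_mult_distrib using moment_leD(2)[OF f]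
    by (intro Bochner_Integration.integrable_sum integrable_mult_right) auto
  have i: "integrable N (\<lambda>x. (\<Sum>l\<in>S. f l x) ^ p)"
    by (rule Bochner_Integration.integrable_bound[OF hi])
      (use meas p conv in \<open>auto simp: zero_le_even_power intro!: AE_I2 order_trans[OF conv]\<close>)
  have "(\<integral>x. (\<Sum>l\<in>S. f l x) ^ p \<partial>N) \<le> (\<integral>x. h x \<partial>N)"
    using i hi conv by (intro integral_mono)
  also have "\<dots> = (\<Sum>l\<in>S. c l / C * ((C / c l) ^ p * (\<integral>x. f l x ^ p \<partial>N)))"
    unfolding h_def power_mult_distrib using moment_leD(2)[OF f]
    by (subst Bochner_Integration.integral_sum) (auto intro!: integrable_divide integrable_mult_right)
  also have "\<dots> \<le> (\<Sum>l\<in>S. c l / C * ((C / c l) ^ p * (c l) ^ p))"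
    using f c C by (intro sum_mono mult_left_mono) (auto dest: moment_leD simp: less_imp_le)
  also have "\<dots> = (\<Sum>l\<in>S. c l / C * C ^ p)"
    using c by (intro sum.cong refl) (auto simp: power_divide less_imp_neq[symmetric])
  also have "\<dots> = C ^ p"
    using C by (simp add: sum_distrib_right[symmetric] sum_divide_distrib[symmetric] C_def)
  finally show ?thesis
    using meas i by (simp add: moment_le_def C_def)
qed

lemma moment_le_sum:
  assumes S: "finite S" and p: "even p" "p > 0"
    and f: "\<And>l. l \<in> S \<Longrightarrow> moment_le N p (f l) (c l)" and c: "\<And>l. l \<in> S \<Longrightarrow> c l \<ge> 0"
  shows "moment_le N p (\<lambda>x. \<Sum>l\<in>S. f l x) (\<Sum>l\<in>S. c l)"
proof (cases "S = {}")
  case True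
  then show ?thesis
    using p by (simp add: moment_le_def zero_power)
next
  case False
  show ?thesis
  proof (rule moment_le_eps)
    fix e :: real assume e: "e > 0"
    have cS: "card S > 0"
      using S False by (simp add: card_gt_0_iff)
    have "moment_le N p (\<lambda>x. \<Sum>l\<in>S. f l x) (\<Sum>l\<in>S. c l + e / card S)"
    proof (rule moment_le_sum_pos[OF S False p(1)])
      fix l assume l: "l \<in> S"
      have "f l \<in> borel_measurable N"
        using f[OF l] by (simp add: moment_le_def)
      then show "moment_le N p (f l) (c l + e / card S)"
        by (intro moment_le_mono[OF f[OF l] p(1)]) (use c[OF l] e in auto)
      show "c l + e / card S > 0"
        using c[OF l] e cS by (simp add: add_nonneg_pos)
    qed
    then show "moment_le N p (\<lambda>x. \<Sum>l\<in>S. f l x) ((\<Sum>l\<in>S. c l) + e)"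
      using cS by (simp add: sum.distrib)
  qed
qed

lemma moment_le_add:
  assumes "even p" "p > 0" "moment_le N p f a" "moment_le N p g b" "a \<ge> 0" "b \<ge> 0"
  shows "moment_le N p (\<lambda>x. f x + g x) (a + b)"
proof -
  have "moment_le N p (\<lambda>x. \<Sum>l\<in>UNIV. (if l then f x else g x)) (\<Sum>l\<in>UNIV. if l then a else b)"
    using assms moment_le_sum[of "UNIV :: bool set" p N "\<lambda>l x. if l then f x else g x" "\<lambda>l. if l then a else b"]
    by simp
  then show ?thesis
    by (simp add: UNIV_bool add.commute)
qed

text \<open>Young's inequality with weight \<open>s\<close>, integrated;
  \<open>s = (b + e) / (a + e)\<close> balances the two terms, and \<open>e\<close> is sent to 0
  afterwards because \<open>a\<close> or \<open>b\<close> may vanish.\<close>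

lemma Cauchy_Schwarz_integral:
  assumes f: "moment_le N 2 f a" and g: "moment_le N 2 g b" and ab: "a \<ge> 0" "b \<ge> 0"
  shows "integrable N (\<lambda>x. f x * g x)" "\<bar>\<integral>x. f x * g x \<partial>N\<bar> \<le> a * b"
proof -
  note f' = moment_leD[OF f] and g' = moment_leD[OF g]
  note [measurable] = f'(1) g'(1)
  have young: "\<bar>f x * g x\<bar> \<le> s / 2 * f x ^ 2 + 1 / (2 * s) * g x ^ 2" if "s > 0" for s x
  proof -
    have "0 \<le> (sqrt s * \<bar>f x\<bar> - \<bar>g x\<bar> / sqrt s)\<^sup>2"
      by simp
    also have "\<dots> = s * (f x)\<^sup>2 + (g x)\<^sup>2 / s - 2 * \<bar>f x * g x\<bar>"
      using that by (simp add: power2_diff power_mult_distrib power_divide abs_mult)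
    finally show ?thesis
      by (simp add: field_simps)
  qed
  show i: "integrable N (\<lambda>x. f x * g x)"
  proof (rule Bochner_Integration.integrable_bound)
    show "integrable N (\<lambda>x. 1 / 2 * f x ^ 2 + 1 / (2 * 1) * g x ^ 2)"
      using f' g' by auto
    show "AE x in N. norm (f x * g x) \<le> norm (1 / 2 * f x ^ 2 + 1 / (2 * 1) * g x ^ 2)"
      using young[of 1] by (auto simp: order_trans[OF _ abs_ge_self])
  qed auto
  have bnd: "\<bar>\<integral>x. f x * g x \<partial>N\<bar> \<le> s / 2 * a ^ 2 + 1 / (2 * s) * b ^ 2" if s: "s > 0" for s
  proof -
    have "\<bar>\<integral>x. f x * g x \<partial>N\<bar> \<le> (\<integral>x. \<bar>f x * g x\<bar> \<partial>N)"
      by (rule integral_abs_bound)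
    also have "\<dots> \<le> (\<integral>x. s / 2 * f x ^ 2 + 1 / (2 * s) * g x ^ 2 \<partial>N)"
      using i f' g' young[OF s] by (intro integral_mono) auto
    also have "\<dots> = s / 2 * (\<integral>x. f x ^ 2 \<partial>N) + 1 / (2 * s) * (\<integral>x. g x ^ 2 \<partial>N)"
      using f' g' by simp
    also have "\<dots> \<le> s / 2 * a ^ 2 + 1 / (2 * s) * b ^ 2"
      using f' g' s by (intro add_mono mult_left_mono) auto
    finally show ?thesis .
  qed
  have pos: "\<bar>\<integral>x. f x * g x \<partial>N\<bar> \<le> (a + e) * (b + e)" if e: "e > 0" for e
  proof -
    have "\<bar>\<integral>x. f x * g x \<partial>N\<bar> \<le> (b + e) / (a + e) / 2 * a ^ 2 + 1 / (2 * ((b + e) / (a + e))) * b ^ 2"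
      using ab e by (intro bnd) (auto intro!: divide_pos_pos add_nonneg_pos)
    also have "\<dots> \<le> (b + e) / (a + e) / 2 * (a + e) ^ 2 + 1 / (2 * ((b + e) / (a + e))) * (b + e) ^ 2"
      using ab e by (intro add_mono mult_left_mono power_mono) auto
    also have "\<dots> = (a + e) * (b + e)"
    proof -
      have "B / A / 2 * A ^ 2 + 1 / (2 * (B / A)) * B ^ 2 = A * B" if "A > 0" "B > 0" for A B :: real
        using that by (simp add: power2_eq_square)
      from this[of "a + e" "b + e"] show ?thesis
        using ab e by (simp only: add_nonneg_pos)
    qed
    finally show ?thesis .
  qed
  have "((\<lambda>e. (a + e) * (b + e)) \<longlongrightarrow> (a + 0) * (b + 0)) (at_right 0)"
    by (intro tendsto_intros)
  moreover have "\<forall>\<^sub>F e in at_right 0. \<bar>\<integral>x. f x * g x \<partial>N\<bar> \<le> (a + e) * (b + e)"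
    using eventually_at_right_less[of 0] by eventually_elim (rule pos)
  ultimately show "\<bar>\<integral>x. f x * g x \<partial>N\<bar> \<le> a * b"
    using tendsto_lowerbound[of _ "(a + 0) * (b + 0)" "at_right 0"] trivial_limit_at_right_real by fastforce
qed

lemma moment_le_square:
  "moment_le N 4 f a \<Longrightarrow> moment_le N 2 (\<lambda>x. (f x)\<^sup>2) (a\<^sup>2)"
  by (auto simp: moment_le_def power_mult[symmetric] simp flip: power_mult)

text \<open>Turns the fourth moments of window sums into second moments of their outer
  products.\<close>

lemma moment_le_mult:
  assumes f: "moment_le N 4 f a" and g: "moment_le N 4 g b" and ab: "a \<ge> 0" "b \<ge> 0"
  shows "moment_le N 2 (\<lambda>x. f x * g x) (a * b)"
proof -
  have "(\<lambda>x. f x * g x) \<in> borel_measurable N"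
    using moment_leD(1)[OF f] moment_leD(1)[OF g] by measurable
  then show ?thesis
    using Cauchy_Schwarz_integral[OF moment_le_square[OF f] moment_le_square[OF g]]
    by (auto simp: moment_le_def power_mult_distrib abs_le_iff)
qed

lemma moment_le_const:
  assumes "prob_space N"
  shows "moment_le N p (\<lambda>x. c) c"
proof -
  interpret prob_space N by fact
  show ?thesis
    by (simp add: moment_le_def prob_space)
qed

lemma moment_le_4_2:
  assumes "prob_space N" "moment_le N 4 f c" "c \<ge> 0"
  shows "moment_le N 2 f c"
proof -
  have "integrable N (\<lambda>x. (f x)\<^sup>2 * 1)" "\<bar>\<integral>x. (f x)\<^sup>2 * 1 \<partial>N\<bar> \<le> c\<^sup>2 * 1"
    using Cauchy_Schwarz_integral[OF moment_le_square[OF assms(2)] moment_le_const[OF assms(1), of 2 1]] by simp_all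
  then show ?thesis
    using moment_leD(1)[OF assms(2)] by (auto simp: moment_le_def abs_le_iff)
qed

lemma moment_le_2_integrable:
  assumes "prob_space N" "moment_le N 2 f c" "c \<ge> 0"
  shows "integrable N f" "\<bar>\<integral>x. f x \<partial>N\<bar> \<le> c"
  using Cauchy_Schwarz_integral[OF assms(2) moment_le_const[OF assms(1)], of 1] assms(3) by simp_all

text \<open>Convergence in L1 gives an almost everywhere convergent subsequence, and Fatou's lemma
  along it bounds the nonnegative integral of the limit. Integrability of its \<open>p\<close>-th
  power is part of what is obtained.\<close>

lemma moment_le_limit:
  assumes fL: "\<And>L. moment_le N p (f L) c" and p: "even p" and f: "f' \<in> borel_measurable N"
    and i: "\<And>L. integrable N (\<lambda>x. f L x - f' x)" and lim: "(\<lambda>L :: nat. \<integral>x. \<bar>f L x - f' x\<bar> \<partial>N) \<longlonglongrightarrow> 0"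
  shows "moment_le N p f' c"
proof -
  obtain r where r: "strict_mono r" "AE x in N. (\<lambda>L. f (r L) x - f' x) \<longlonglongrightarrow> 0"
    using tendsto_L1_AE_subseq[of N "\<lambda>L x. f L x - f' x", OF i] lim by auto
  have nn: "(\<integral>\<^sup>+x. ennreal (f L x ^ p) \<partial>N) \<le> ennreal (c ^ p)" for L
  proof -
    have "(\<integral>\<^sup>+x. ennreal (f L x ^ p) \<partial>N) = ennreal (\<integral>x. f L x ^ p \<partial>N)"
      using fL[of L] p by (intro nn_integral_eq_integral) (auto simp: moment_le_def zero_le_even_power)
    then show ?thesis
      using moment_leD(3)[OF fL[of L]] by (simp add: ennreal_leI)
  qed
  have fm: "f L \<in> borel_measurable N" for L
    using fL[of L] by (simp add: moment_le_def)
  have "(\<integral>\<^sup>+x. ennreal (f' x ^ p) \<partial>N) = (\<integral>\<^sup>+x. liminf (\<lambda>L. ennreal (f (r L) x ^ p)) \<partial>N)"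
  proof (rule nn_integral_cong_AE)
    show "AE x in N. ennreal (f' x ^ p) = liminf (\<lambda>L. ennreal (f (r L) x ^ p))"
      using r(2)
    proof eventually_elim
      case (elim x)
      then have "(\<lambda>L. f (r L) x) \<longlonglongrightarrow> f' x"
        by (simp add: LIM_zero_iff)
      then have "(\<lambda>L. ennreal (f (r L) x ^ p)) \<longlonglongrightarrow> ennreal (f' x ^ p)"
        by (intro tendsto_ennrealI tendsto_power)
      then show ?case
        by (simp add: lim_imp_Liminf)
    qed
  qed
  also have "\<dots> \<le> liminf (\<lambda>L. \<integral>\<^sup>+x. ennreal (f (r L) x ^ p) \<partial>N)"
    using fm by (intro nn_integral_liminf) measurable
  also have "\<dots> \<le> ennreal (c ^ p)"
    by (rule order_trans[OF Liminf_mono[where g="\<lambda>_. ennreal (c ^ p)"]]) (auto simp: nn Liminf_const)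
  finally have le: "(\<integral>\<^sup>+x. ennreal (f' x ^ p) \<partial>N) \<le> ennreal (c ^ p)" .
  have int: "integrable N (\<lambda>x. f' x ^ p)"
    using f le p by (intro integrableI_nonneg) (auto simp: zero_le_even_power le_less_trans ennreal_less_top)
  have "ennreal (\<integral>x. f' x ^ p \<partial>N) \<le> ennreal (c ^ p)"
    using le nn_integral_eq_integral[OF int] p by (simp add: zero_le_even_power)
  then have "(\<integral>x. f' x ^ p \<partial>N) \<le> c ^ p"
    using p by (simp add: zero_le_even_power)
  then show ?thesis
    using int f by (simp add: moment_le_def)
qed

section \<open>Averaging Euclidean norms over one factor of a product space\<close>

lemma borel_measurable_L2_set [measurable]:
  assumes "\<And>i. i \<in> I \<Longrightarrow> (\<lambda>x. g x i) \<in> borel_measurable N"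
  shows "(\<lambda>x. L2_set (g x) I) \<in> borel_measurable N"
  unfolding L2_set_def using assms by (intro measurable_compose[OF _ borel_measurable_sqrt]) measurable

text \<open>The vector \<open>v\<close> of integrals is tested against itself:
  \<open>|v|\<^sup>2\<close> is the integral of the inner product of \<open>v\<close> with
  \<open>g x\<close>, to which Cauchy-Schwarz applies at each \<open>x\<close>; then one factor
  \<open>|v|\<close> is cancelled.\<close>

lemma L2_set_integral_le:
  fixes g :: "'a \<Rightarrow> 'i \<Rightarrow> real"
  assumes I: "finite I" and g: "\<And>i. i \<in> I \<Longrightarrow> integrable N (\<lambda>x. g x i)"
  shows "L2_set (\<lambda>i. \<integral>x. g x i \<partial>N) I \<le> (\<integral>x. L2_set (g x) I \<partial>N)"
    "integrable N (\<lambda>x. L2_set (g x) I)"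
proof -
  have [measurable]: "(\<lambda>x. g x i) \<in> borel_measurable N" if "i \<in> I" for i
    using g that by auto
  have meas: "(\<lambda>x. L2_set (g x) I) \<in> borel_measurable N"
    by measurable
  show i: "integrable N (\<lambda>x. L2_set (g x) I)"
  proof (rule Bochner_Integration.integrable_bound)
    show "integrable N (\<lambda>x. \<Sum>i\<in>I. \<bar>g x i\<bar>)"
      using g by auto
    show "AE x in N. norm (L2_set (g x) I) \<le> norm (\<Sum>i\<in>I. \<bar>g x i\<bar>)"
      by (auto simp: L2_set_le_sum_abs sum_nonneg)
  qed (rule meas)
  define v where "v = (\<lambda>i. \<integral>x. g x i \<partial>N)"
  have "(L2_set v I)\<^sup>2 = (\<Sum>i\<in>I. v i * (\<integral>x. g x i \<partial>N))"
    by (simp add: L2_set_def sum_nonneg v_def power2_eq_square)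
  also have "\<dots> = (\<integral>x. (\<Sum>i\<in>I. v i * g x i) \<partial>N)"
    using g by (subst Bochner_Integration.integral_sum) auto
  also have "\<dots> \<le> (\<integral>x. L2_set v I * L2_set (g x) I \<partial>N)"
  proof (intro integral_mono)
    show "(\<Sum>i\<in>I. v i * g x i) \<le> L2_set v I * L2_set (g x) I" for x
      by (rule order_trans[OF _ L2_set_mult_ineq]) (auto intro!: sum_mono simp: abs_mult[symmetric])
  qed (use g i in auto)
  also have "\<dots> = L2_set v I * (\<integral>x. L2_set (g x) I \<partial>N)"
    by simp
  finally have "L2_set v I * L2_set v I \<le> L2_set v I * (\<integral>x. L2_set (g x) I \<partial>N)"
    by (simp add: power2_eq_square)
  moreover have "0 \<le> (\<integral>x. L2_set (g x) I \<partial>N)"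
    by (intro Bochner_Integration.integral_nonneg) simp
  ultimately have "L2_set v I \<le> (\<integral>x. L2_set (g x) I \<partial>N)"
    using L2_set_nonneg[of v I] by (cases "L2_set v I = 0") (auto simp: mult_le_cancel_left_pos)
  then show "L2_set (\<lambda>i. \<integral>x. g x i \<partial>N) I \<le> (\<integral>x. L2_set (g x) I \<partial>N)"
    by (simp add: v_def)
qed

lemma abs_le_1_plus_even_power:
  fixes x :: real
  assumes "even p" "p > 0"
  shows "\<bar>x\<bar> \<le> 1 + x ^ p"
proof (cases "\<bar>x\<bar> \<le> 1")
  case True
  then show ?thesis
    using zero_le_even_power[OF assms(1), of x] by linarith
next
  case False
  then have "\<bar>x\<bar> ^ 1 \<le> \<bar>x\<bar> ^ p"
    using assms by (intro power_increasing) auto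
  then show ?thesis
    using assms by (simp add: power_even_abs)
qed

text \<open>On almost every fibre the norm of the average is at most the average of the norm,
  Jensen's inequality moves the power inside, and Fubini integrates over the fibres. Integrability
  of the components on a fibre comes from \<open>|x| \<le> 1 + x ^ p\<close>.\<close>

lemma moment_le_partial_integral:
  fixes g :: "'a \<times> 'b \<Rightarrow> 'i \<Rightarrow> real"
  assumes N: "prob_space N" "prob_space N'" and I: "finite I" and p: "even p" "p > 0"
    and g: "\<And>i. i \<in> I \<Longrightarrow> (\<lambda>z. g z i) \<in> borel_measurable (N \<Otimes>\<^sub>M N')"
    and m: "moment_le (N \<Otimes>\<^sub>M N') p (\<lambda>z. L2_set (g z) I) c"
  shows "moment_le N p (\<lambda>x. L2_set (\<lambda>i. \<integral>y. g (x, y) i \<partial>N') I) c"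
proof -
  interpret N: prob_space N by fact
  interpret N': prob_space N' by fact
  interpret NN: pair_sigma_finite N N' ..
  note [measurable] = g
  have meas: "(\<lambda>x. L2_set (\<lambda>i. \<integral>y. g (x, y) i \<partial>N') I) \<in> borel_measurable N"
    by (intro borel_measurable_L2_set N'.borel_measurable_lebesgue_integral) simp
  have measg: "(\<lambda>z. L2_set (g z) I) \<in> borel_measurable (N \<Otimes>\<^sub>M N')"
    using m by (simp add: moment_le_def)
  define u where "u = (\<lambda>x. \<integral>y. L2_set (g (x, y)) I ^ p \<partial>N')"
  note m' = moment_leD[OF m]
  have le: "AE x in N. L2_set (\<lambda>i. \<integral>y. g (x, y) i \<partial>N') I ^ p \<le> u x"
    using NN.AE_integrable_fst'[OF m'(2)] AE_space
  proof eventually_elim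
    case (elim x)
    have [measurable]: "(\<lambda>y. g (x, y) i) \<in> borel_measurable N'" if "i \<in> I" for i
      using g[OF that] elim(2) by measurable
    have mg: "(\<lambda>y. L2_set (g (x, y)) I) \<in> borel_measurable N'"
      using measg elim(2) by measurable
    have ig: "integrable N' (\<lambda>y. g (x, y) i)" if i: "i \<in> I" for i
    proof (rule Bochner_Integration.integrable_bound)
      show "integrable N' (\<lambda>y. 1 + L2_set (g (x, y)) I ^ p)"
        using elim(1) by simp
      have "\<bar>g (x, y) i\<bar> \<le> 1 + L2_set (g (x, y)) I ^ p" for y
      proof -
        have "\<bar>g (x, y) i\<bar> \<le> L2_set (g (x, y)) I"
          using member_le_L2_set[OF I i, of "\<lambda>i. \<bar>g (x, y) i\<bar>"] by (simp add: L2_set_def)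
        then show ?thesis
          using abs_le_1_plus_even_power[OF p, of "L2_set (g (x, y)) I"] by simp
      qed
      then show "AE y in N'. norm (g (x, y) i) \<le> norm (1 + L2_set (g (x, y)) I ^ p)"
        by (auto intro: order_trans[OF _ abs_ge_self])
    qed (use i in measurable)
    have "L2_set (\<lambda>i. \<integral>y. g (x, y) i \<partial>N') I ^ p \<le> (\<integral>y. L2_set (g (x, y)) I \<partial>N') ^ p"
      using L2_set_integral_le(1)[OF I ig] by (intro power_mono) auto
    also have "\<dots> \<le> u x"
      unfolding u_def using L2_set_integral_le(2)[OF I ig] elim(1) p
      by (intro N'.jensens_inequality[where I=UNIV and q="\<lambda>x. x ^ p"] convex_power_even) auto
    finally show ?case .
  qed
  have iu: "integrable N u"
    unfolding u_def by (rule NN.integrable_fst'[OF m'(2)])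
  have i: "integrable N (\<lambda>x. L2_set (\<lambda>i. \<integral>y. g (x, y) i \<partial>N') I ^ p)"
  proof (rule Bochner_Integration.integrable_bound[OF iu])
    show "AE x in N. norm (L2_set (\<lambda>i. \<integral>y. g (x, y) i \<partial>N') I ^ p) \<le> norm (u x)"
      using le by eventually_elim (simp add: order_trans[OF _ abs_ge_self])
  qed (use meas in measurable)
  have "(\<integral>x. L2_set (\<lambda>i. \<integral>y. g (x, y) i \<partial>N') I ^ p \<partial>N) \<le> (\<integral>x. u x \<partial>N)"
    by (rule integral_mono_AE[OF i iu le])
  also have "\<dots> \<le> c ^ p"
    using m'(3) NN.integral_fst'[OF m'(2)] by (simp add: u_def)
  finally show ?thesis
    using meas i by (simp add: moment_le_def)
qed

section \<open>The space of innovations\<close>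

definition unif :: "real measure" where
  "unif = uniform_measure lborel {0..1}"

text \<open>The law of one innovation sequence on its own path space; the replacement innovations
  come from a second factor \<open>innov\<close>.\<close>

definition innov :: "(int \<Rightarrow> real) measure" where
  "innov = PiM UNIV (\<lambda>_. unif)"

lemma prob_space_unif: "prob_space unif"
  unfolding unif_def by (intro prob_space_uniform_measure) auto

lemma sets_unif [measurable_cong, simp]: "sets unif = sets borel"
  by (simp add: unif_def)

lemma space_unif [simp]: "space unif = UNIV"
  by (simp add: unif_def)

lemma prob_space_innov: "prob_space innov"
  unfolding innov_def by (intro prob_space_PiM prob_space_unif)

lemma sets_innov [measurable_cong]: "sets innov = sets (PiM UNIV (\<lambda>_. borel))"
  unfolding innov_def by (intro sets_PiM_cong) auto

lemma space_innov [simp]: "space innov = UNIV"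
  by (auto simp: innov_def space_PiM)

interpretation innov: prob_space innov
  by (rule prob_space_innov)

interpretation innov2: pair_prob_space innov innov ..

lemma measurable_innovI:
  assumes "\<And>i. (\<lambda>x. f x i) \<in> borel_measurable N"
  shows "f \<in> measurable N innov"
  unfolding measurable_cong_sets[OF refl sets_innov]
  by (rule measurable_PiM_single') (use assms in auto)

lemma measurable_innov_nth [measurable]: "(\<lambda>\<omega>. \<omega> i) \<in> borel_measurable innov"
  unfolding measurable_cong_sets[OF sets_innov refl] by measurable

lemma measurable_innov_compose [measurable (raw)]:
  assumes "f \<in> measurable N innov"
  shows "(\<lambda>x. f x i) \<in> borel_measurable N"
  using measurable_compose[OF assms measurable_innov_nth] .

section \<open>The joint law of the two innovation sequences\<close>

lemma measurable_case_sum: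
  "(\<lambda>(\<omega>, \<omega>'). case_sum \<omega> \<omega>') \<in> measurable (innov \<Otimes>\<^sub>M innov) (PiM UNIV (\<lambda>_ :: int + int. unif))"
proof (rule measurable_PiM_single')
  fix i :: "int + int"
  show "(\<lambda>z. (case z of (\<omega>, \<omega>') \<Rightarrow> case_sum \<omega> \<omega>') i) \<in> measurable (innov \<Otimes>\<^sub>M innov) unif"
    by (cases i) (auto simp: case_prod_unfold)
qed auto

text \<open>A cylinder over \<open>J\<close> splits into cylinders over its \<open>Inl\<close> and
  \<open>Inr\<close> parts, so both measures agree on cylinders, and these determine a law on a
  product space. Together with \<open>distr_split_sum\<close> this identifies a pair of sequences
  with one family indexed by \<open>int + int\<close>.\<close>

lemma distr_case_sum:
  "distr (innov \<Otimes>\<^sub>M innov) (PiM UNIV (\<lambda>_ :: int + int. unif)) (\<lambda>(\<omega>, \<omega>'). case_sum \<omega> \<omega>') =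
    PiM UNIV (\<lambda>_. unif)"
proof (rule measure_eqI_PiM_infinite[symmetric, OF refl])
  interpret S: prob_space "PiM UNIV (\<lambda>_ :: int + int. unif)"
    by (intro prob_space_PiM prob_space_unif)
  show "finite_measure (PiM UNIV (\<lambda>_ :: int + int. unif))"
    by unfold_locales
  fix J :: "(int + int) set" and A
  assume J: "finite J" "J \<subseteq> UNIV" and A: "\<And>i. i \<in> J \<Longrightarrow> A i \<in> sets unif"
  define J1 where "J1 = Inl -` J"
  define J2 where "J2 = Inr -` J"
  have fin: "finite J1" "finite J2"
    using J by (auto simp: J1_def J2_def intro!: finite_vimageI)
  have J_eq: "J = Inl ` J1 \<union> Inr ` J2"
    unfolding J1_def J2_def by (auto simp: image_iff) (metis sumE)
  let ?B = "prod_emb UNIV (\<lambda>_. unif) J (Pi\<^sub>E J A)"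
  let ?B1 = "prod_emb UNIV (\<lambda>_. unif) J1 (\<Pi>\<^sub>E i\<in>J1. A (Inl i))"
  let ?B2 = "prod_emb UNIV (\<lambda>_. unif) J2 (\<Pi>\<^sub>E i\<in>J2. A (Inr i))"
  have B: "?B1 \<in> sets innov" "?B2 \<in> sets innov"
    unfolding innov_def using fin A by (auto simp: J1_def J2_def intro!: sets_PiM_I)
  have "emeasure (PiM UNIV (\<lambda>_ :: int + int. unif)) ?B = (\<Prod>i\<in>J. emeasure unif (A i))"
    using J A by (intro emeasure_PiM_emb prob_space_unif) auto
  also have "\<dots> = (\<Prod>i\<in>J1. emeasure unif (A (Inl i))) * (\<Prod>i\<in>J2. emeasure unif (A (Inr i)))"
    unfolding J_eq using fin by (subst prod.union_disjoint) (auto simp: prod.reindex)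
  also have "(\<Prod>i\<in>J1. emeasure unif (A (Inl i))) = emeasure innov ?B1"
    unfolding innov_def using fin A
    by (intro emeasure_PiM_emb[symmetric] prob_space_unif) (auto simp: J1_def)
  also have "(\<Prod>i\<in>J2. emeasure unif (A (Inr i))) = emeasure innov ?B2"
    unfolding innov_def using fin A
    by (intro emeasure_PiM_emb[symmetric] prob_space_unif) (auto simp: J2_def)
  also have "emeasure innov ?B1 * emeasure innov ?B2 = emeasure (innov \<Otimes>\<^sub>M innov) (?B1 \<times> ?B2)"
    using B by (intro innov.emeasure_pair_measure_Times[symmetric])
  also have "?B1 \<times> ?B2 = (\<lambda>(\<omega>, \<omega>'). case_sum \<omega> \<omega>') -` ?B \<inter> space (innov \<Otimes>\<^sub>M innov)"
    by (auto simp: prod_emb_def space_pair_measure PiE_iff J_eq extensional_def ball_Un)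
  also have "emeasure (innov \<Otimes>\<^sub>M innov) \<dots> =
      emeasure (distr (innov \<Otimes>\<^sub>M innov) (PiM UNIV (\<lambda>_. unif)) (\<lambda>(\<omega>, \<omega>'). case_sum \<omega> \<omega>')) ?B"
    using measurable_case_sum J A by (intro emeasure_distr[symmetric] sets_PiM_I) auto
  finally show "emeasure (PiM UNIV (\<lambda>_ :: int + int. unif)) ?B = \<dots>" .
qed simp

lemma measurable_split_sum:
  "(\<lambda>z. (\<lambda>i. z (Inl i), \<lambda>i. z (Inr i))) \<in> measurable (PiM UNIV (\<lambda>_ :: int + int. unif)) (innov \<Otimes>\<^sub>M innov)"
proof (intro measurable_Pair measurable_innovI)
  fix i :: int
  have "(\<lambda>z. z k) \<in> measurable (PiM UNIV (\<lambda>_ :: int + int. unif)) unif" for k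
    by (rule measurable_component_singleton) simp
  then show "(\<lambda>z. z (Inl i)) \<in> borel_measurable (PiM UNIV (\<lambda>_ :: int + int. unif))"
    "(\<lambda>z. z (Inr i)) \<in> borel_measurable (PiM UNIV (\<lambda>_ :: int + int. unif))"
    by (simp_all add: measurable_cong_sets[OF refl sets_unif])
qed

lemma distr_split_sum:
  "distr (PiM UNIV (\<lambda>_ :: int + int. unif)) (innov \<Otimes>\<^sub>M innov) (\<lambda>z. (\<lambda>i. z (Inl i), \<lambda>i. z (Inr i))) =
    innov \<Otimes>\<^sub>M innov"
proof -
  have "distr (PiM UNIV (\<lambda>_ :: int + int. unif)) (innov \<Otimes>\<^sub>M innov) (\<lambda>z. (\<lambda>i. z (Inl i), \<lambda>i. z (Inr i))) =
     distr (distr (innov \<Otimes>\<^sub>M innov) (PiM UNIV (\<lambda>_. unif)) (\<lambda>(\<omega>, \<omega>'). case_sum \<omega> \<omega>'))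
       (innov \<Otimes>\<^sub>M innov) (\<lambda>z. (\<lambda>i. z (Inl i), \<lambda>i. z (Inr i)))"
    by (simp only: distr_case_sum)
  also have "\<dots> = distr (innov \<Otimes>\<^sub>M innov) (innov \<Otimes>\<^sub>M innov) (\<lambda>z. z)"
    by (subst distr_distr[OF measurable_split_sum measurable_case_sum]) (simp add: comp_def case_prod_unfold)
  finally show ?thesis
    by simp
qed

text \<open>The independence hypothesis concerns the combined family indexed by
  \<open>int + int\<close> and so makes its law a product; splitting the family gives two
  independent copies of \<open>innov\<close>.\<close>

lemma distr_iid_uniform_pair:
  assumes "prob_space M" "iid_uniform_pair M \<epsilon> \<epsilon>'"
  shows "(\<lambda>\<omega>. (\<lambda>i. \<epsilon> i \<omega>, \<lambda>i. \<epsilon>' i \<omega>)) \<in> measurable M (innov \<Otimes>\<^sub>M innov)"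
    "distr M (innov \<Otimes>\<^sub>M innov) (\<lambda>\<omega>. (\<lambda>i. \<epsilon> i \<omega>, \<lambda>i. \<epsilon>' i \<omega>)) = innov \<Otimes>\<^sub>M innov"
proof -
  interpret prob_space M by fact
  have ind: "prob_space.indep_vars M (\<lambda>_. borel) (case_sum \<epsilon> \<epsilon>') UNIV"
    and d: "\<And>i. distr M borel (\<epsilon> i) = unif" "\<And>i. distr M borel (\<epsilon>' i) = unif"
    using assms(2) by (auto simp: iid_uniform_pair_def unif_def)
  have rv: "case_sum \<epsilon> \<epsilon>' i \<in> borel_measurable M" for i
    using ind by (auto simp: prob_space.indep_vars_def[OF assms(1)])
  have e: "\<epsilon> i \<in> borel_measurable M" "\<epsilon>' i \<in> borel_measurable M" for i
    using rv[of "Inl i"] rv[of "Inr i"] by auto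
  have dS: "distr M borel (case_sum \<epsilon> \<epsilon>' i) = unif" for i
    by (cases i) (auto simp: d)
  have sU: "sets (PiM UNIV (\<lambda>_ :: int + int. borel :: real measure)) = sets (PiM UNIV (\<lambda>_. unif))"
    by (intro sets_PiM_cong) auto
  show "(\<lambda>\<omega>. (\<lambda>i. \<epsilon> i \<omega>, \<lambda>i. \<epsilon>' i \<omega>)) \<in> measurable M (innov \<Otimes>\<^sub>M innov)"
    using e by (intro measurable_Pair measurable_innovI) auto
  have "distr M (PiM UNIV (\<lambda>_. borel)) (\<lambda>x. \<lambda>i\<in>UNIV. case_sum \<epsilon> \<epsilon>' i x) = PiM UNIV (\<lambda>_. unif)"
    using prob_space.indep_vars_iff_distr_eq_PiM[OF assms(1), of UNIV "case_sum \<epsilon> \<epsilon>'" "\<lambda>_. borel"] ind rv by (simp add: dS)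
  then have D: "distr M (PiM UNIV (\<lambda>_. unif)) (\<lambda>x i. case_sum \<epsilon> \<epsilon>' i x) = PiM UNIV (\<lambda>_. unif)"
    using distr_cong[OF refl sU, of M] by (simp add: restrict_UNIV)
  have m: "(\<lambda>x i. case_sum \<epsilon> \<epsilon>' i x) \<in> measurable M (PiM UNIV (\<lambda>_. unif))"
    unfolding measurable_cong_sets[OF refl sU[symmetric]]
    by (rule measurable_PiM_single') (use rv in auto)
  have "innov \<Otimes>\<^sub>M innov = distr (distr M (PiM UNIV (\<lambda>_. unif)) (\<lambda>x i. case_sum \<epsilon> \<epsilon>' i x))
      (innov \<Otimes>\<^sub>M innov) (\<lambda>z. (\<lambda>i. z (Inl i), \<lambda>i. z (Inr i)))"
    by (simp only: D distr_split_sum)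
  also have "\<dots> = distr M (innov \<Otimes>\<^sub>M innov) (\<lambda>\<omega>. (\<lambda>i. \<epsilon> i \<omega>, \<lambda>i. \<epsilon>' i \<omega>))"
    by (subst distr_distr[OF measurable_split_sum m]) (simp add: comp_def)
  finally show "distr M (innov \<Otimes>\<^sub>M innov) (\<lambda>\<omega>. (\<lambda>i. \<epsilon> i \<omega>, \<lambda>i. \<epsilon>' i \<omega>)) = innov \<Otimes>\<^sub>M innov" ..
qed

definition mix :: "int set \<Rightarrow> (int \<Rightarrow> real) \<Rightarrow> (int \<Rightarrow> real) \<Rightarrow> (int \<Rightarrow> real)" where
  "mix A \<omega> \<omega>' = (\<lambda>i. if i \<in> A then \<omega> i else \<omega>' i)"

lemma measurable_mix [measurable (raw)]:
  assumes [measurable]: "f \<in> measurable N innov" "g \<in> measurable N innov"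
  shows "(\<lambda>x. mix A (f x) (g x)) \<in> measurable N innov"
  by (rule measurable_innovI) (simp add: mix_def)

text \<open>Exchanging the coordinates outside \<open>A\<close> between the two copies is a
  permutation \<open>\<pi>\<close> of \<open>int + int\<close>, and a product of identical factors
  is invariant under reindexing. The exchanged sequences are thus again independent copies.\<close>

lemma distr_mix_swap:
  "distr (innov \<Otimes>\<^sub>M innov) (innov \<Otimes>\<^sub>M innov) (\<lambda>z. (mix A (fst z) (snd z), mix A (snd z) (fst z))) =
    innov \<Otimes>\<^sub>M innov"
proof -
  define \<pi> where "\<pi> = (\<lambda>i :: int + int. case i of Inl i \<Rightarrow> if i \<in> A then Inl i else Inr i
      | Inr i \<Rightarrow> if i \<in> A then Inr i else Inl i)"
  have inj: "inj \<pi>"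
    by (auto simp: inj_def \<pi>_def split: sum.splits if_splits)
  let ?P = "PiM UNIV (\<lambda>_ :: int + int. unif)"
  have R: "distr ?P ?P (\<lambda>z n. z (\<pi> n)) = ?P"
    using distr_PiM_reindex[of UNIV "\<lambda>_. unif" \<pi> UNIV] prob_space_unif inj by (simp add: restrict_UNIV)
  have mR: "(\<lambda>z n. z (\<pi> n)) \<in> measurable ?P ?P"
    by (rule measurable_PiM_single') auto
  have "innov \<Otimes>\<^sub>M innov = distr (distr (distr (innov \<Otimes>\<^sub>M innov) ?P (\<lambda>(\<omega>, \<omega>'). case_sum \<omega> \<omega>')) ?P (\<lambda>z n. z (\<pi> n)))
      (innov \<Otimes>\<^sub>M innov) (\<lambda>z. (\<lambda>i. z (Inl i), \<lambda>i. z (Inr i)))"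
    by (simp only: R distr_case_sum distr_split_sum)
  also have "\<dots> = distr (innov \<Otimes>\<^sub>M innov) (innov \<Otimes>\<^sub>M innov) (\<lambda>z. (mix A (fst z) (snd z), mix A (snd z) (fst z)))"
    by (subst distr_distr[OF mR measurable_case_sum],
        subst distr_distr[OF measurable_split_sum measurable_comp[OF measurable_case_sum mR]])
      (auto simp: comp_def \<pi>_def mix_def case_prod_unfold if_distrib cong: if_cong intro!: distr_cong)
  finally show ?thesis ..
qed

lemma measurable_mix_swap:
  "(\<lambda>z. (mix A (fst z) (snd z), mix A (snd z) (fst z))) \<in> measurable (innov \<Otimes>\<^sub>M innov) (innov \<Otimes>\<^sub>M innov)"
  by measurable

lemma distr_fst_innov: "distr (innov \<Otimes>\<^sub>M innov) innov fst = innov"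
  using innov.distr_pair_fst[of innov] by (simp add: innov.emeasure_space_1)

lemma distr_mix:
  "distr (innov \<Otimes>\<^sub>M innov) innov (\<lambda>z. mix A (fst z) (snd z)) = innov"
proof -
  have "innov = distr (distr (innov \<Otimes>\<^sub>M innov) (innov \<Otimes>\<^sub>M innov) (\<lambda>z. (mix A (fst z) (snd z), mix A (snd z) (fst z)))) innov fst"
    by (simp only: distr_mix_swap distr_fst_innov)
  also have "\<dots> = distr (innov \<Otimes>\<^sub>M innov) innov (\<lambda>z. mix A (fst z) (snd z))"
    by (subst distr_distr) (auto simp: comp_def)
  finally show ?thesis ..
qed

text \<open>The source of stationarity: any fixed map applied to the shifted past keeps its
  law.\<close>

lemma distr_shift: "distr innov innov (\<lambda>\<eta> i. \<eta> (i + c)) = innov"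
proof -
  have inj: "inj (\<lambda>i :: int. i + c)"
    by (simp add: inj_def)
  show ?thesis
    unfolding innov_def
    using distr_PiM_reindex[of UNIV "\<lambda>_. unif" "\<lambda>i :: int. i + c" UNIV] prob_space_unif inj
    by (simp add: restrict_UNIV)
qed

lemma measurable_shift: "(\<lambda>\<eta> i. \<eta> (i + c)) \<in> measurable innov innov"
  by (rule measurable_innovI) measurable

section \<open>Conditioning on the past\<close>

text \<open>A concrete version of the conditional expectation given the innovations up to
  \<open>t\<close>. It is defined everywhere, with value 0 where the inner integral does not exist,
  so additivity holds only almost everywhere.\<close>

definition cexp :: "int \<Rightarrow> ((int \<Rightarrow> real) \<Rightarrow> real) \<Rightarrow> (int \<Rightarrow> real) \<Rightarrow> real" where
  "cexp t f \<omega> = (\<integral>\<omega>'. f (mix {..t} \<omega> \<omega>') \<partial>innov)"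

text \<open>Measurability with respect to the past is encoded as Borel measurability plus dependence
  on the coordinates up to \<open>t\<close> alone, so pointwise arguments replace
  sub-\<sigma>-algebras.\<close>

definition adapted :: "int \<Rightarrow> ((int \<Rightarrow> real) \<Rightarrow> real) \<Rightarrow> bool" where
  "adapted t g \<longleftrightarrow> g \<in> borel_measurable innov \<and> (\<forall>\<omega> \<omega>'. (\<forall>i\<le>t. \<omega> i = \<omega>' i) \<longrightarrow> g \<omega> = g \<omega>')"

lemma measure_innov_UNIV [simp]: "measure innov UNIV = 1"
  using innov.prob_space by simp

lemma adaptedI:
  assumes "g \<in> borel_measurable innov" "\<And>\<omega> \<omega>'. (\<And>i. i \<le> t \<Longrightarrow> \<omega> i = \<omega>' i) \<Longrightarrow> g \<omega> = g \<omega>'"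
  shows "adapted t g"
  unfolding adapted_def using assms by blast

lemma adapted_measurable: "adapted t g \<Longrightarrow> g \<in> borel_measurable innov"
  by (simp add: adapted_def)

lemma adapted_eq: "adapted t g \<Longrightarrow> (\<And>i. i \<le> t \<Longrightarrow> \<omega> i = \<omega>' i) \<Longrightarrow> g \<omega> = g \<omega>'"
  by (simp add: adapted_def)

lemma adapted_mono: "adapted s g \<Longrightarrow> s \<le> t \<Longrightarrow> adapted t g"
  by (auto simp: adapted_def)

lemma borel_measurable_cexp [measurable]:
  assumes [measurable]: "f \<in> borel_measurable innov"
  shows "cexp t f \<in> borel_measurable innov"
  unfolding cexp_def[abs_def] by (intro innov.borel_measurable_lebesgue_integral) measurable

lemma integrable_mix:
  fixes f :: "(int \<Rightarrow> real) \<Rightarrow> real"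
  assumes "integrable innov f"
  shows "integrable (innov \<Otimes>\<^sub>M innov) (\<lambda>(\<omega>, \<omega>'). f (mix A \<omega> \<omega>'))"
    "(\<integral>(\<omega>, \<omega>'). f (mix A \<omega> \<omega>') \<partial>(innov \<Otimes>\<^sub>M innov)) = (\<integral>\<omega>. f \<omega> \<partial>innov)"
proof -
  have m: "(\<lambda>z. mix A (fst z) (snd z)) \<in> measurable (innov \<Otimes>\<^sub>M innov) innov"
    by measurable
  have f: "f \<in> borel_measurable innov"
    using assms by simp
  show "integrable (innov \<Otimes>\<^sub>M innov) (\<lambda>(\<omega>, \<omega>'). f (mix A \<omega> \<omega>'))"
    using integrable_distr_eq[OF m, of f] assms f by (simp add: distr_mix case_prod_unfold)
  show "(\<integral>(\<omega>, \<omega>'). f (mix A \<omega> \<omega>') \<partial>(innov \<Otimes>\<^sub>M innov)) = (\<integral>\<omega>. f \<omega> \<partial>innov)"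
    using integral_distr[OF m, of f] f by (simp add: distr_mix case_prod_unfold)
qed

lemma AE_integrable_mix:
  fixes f :: "(int \<Rightarrow> real) \<Rightarrow> real"
  assumes "integrable innov f"
  shows "AE \<omega> in innov. integrable innov (\<lambda>\<omega>'. f (mix A \<omega> \<omega>'))"
  using innov2.AE_integrable_fst[OF integrable_mix(1)[OF assms]] .

lemma integrable_cexp:
  assumes "integrable innov f"
  shows "integrable innov (cexp t f)"
  unfolding cexp_def[abs_def] by (rule innov2.integrable_fst[OF integrable_mix(1)[OF assms]])

lemma integral_cexp:
  assumes "integrable innov f"
  shows "(\<integral>\<omega>. cexp t f \<omega> \<partial>innov) = (\<integral>\<omega>. f \<omega> \<partial>innov)"
  unfolding cexp_def using innov2.integral_fst[OF integrable_mix(1)[OF assms]] integrable_mix(2)[OF assms]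
  by simp

lemma adapted_cexp:
  assumes "f \<in> borel_measurable innov"
  shows "adapted t (cexp t f)"
proof (rule adaptedI)
  fix \<omega> \<omega>' :: "int \<Rightarrow> real" assume "\<And>i. i \<le> t \<Longrightarrow> \<omega> i = \<omega>' i"
  then have "mix {..t} \<omega> = mix {..t} \<omega>'"
    by (auto simp: mix_def fun_eq_iff)
  then show "cexp t f \<omega> = cexp t f \<omega>'"
    by (simp add: cexp_def)
qed (use assms in measurable)

lemma adapted_mix: "adapted t g \<Longrightarrow> g (mix {..t} \<omega> \<omega>') = g \<omega>"
  by (erule adapted_eq) (simp add: mix_def)

lemma cexp_adapted: "adapted t f \<Longrightarrow> cexp t f = f"
  by (rule ext) (simp add: cexp_def adapted_mix innov.prob_space)

lemma cexp_mult: "adapted t g \<Longrightarrow> cexp t (\<lambda>\<omega>. g \<omega> * f \<omega>) \<omega> = g \<omega> * cexp t f \<omega>"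
  by (simp add: cexp_def adapted_mix)

lemma integral_mult_cexp:
  assumes "adapted t g" "integrable innov (\<lambda>\<omega>. g \<omega> * f \<omega>)"
  shows "integrable innov (\<lambda>\<omega>. g \<omega> * cexp t f \<omega>)"
    "(\<integral>\<omega>. g \<omega> * cexp t f \<omega> \<partial>innov) = (\<integral>\<omega>. g \<omega> * f \<omega> \<partial>innov)"
  using integrable_cexp[OF assms(2), of t] integral_cexp[OF assms(2), of t]
  by (simp_all add: cexp_mult[OF assms(1)] cong: Bochner_Integration.integrable_cong)

lemma cexp_add:
  assumes "integrable innov f" "integrable innov g"
  shows "AE \<omega> in innov. cexp t (\<lambda>\<omega>. f \<omega> + g \<omega>) \<omega> = cexp t f \<omega> + cexp t g \<omega>"
  using AE_integrable_mix[OF assms(1), of "{..t}"] AE_integrable_mix[OF assms(2), of "{..t}"]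
  by eventually_elim (simp add: cexp_def)

lemma cexp_diff:
  assumes "integrable innov f" "integrable innov g"
  shows "AE \<omega> in innov. cexp t (\<lambda>\<omega>. f \<omega> - g \<omega>) \<omega> = cexp t f \<omega> - cexp t g \<omega>"
  using AE_integrable_mix[OF assms(1), of "{..t}"] AE_integrable_mix[OF assms(2), of "{..t}"]
  by eventually_elim (simp add: cexp_def)

lemma cexp_L1:
  assumes "integrable innov f"
  shows "(\<integral>\<omega>. \<bar>cexp t f \<omega>\<bar> \<partial>innov) \<le> (\<integral>\<omega>. \<bar>f \<omega>\<bar> \<partial>innov)"
proof -
  have "(\<integral>\<omega>. \<bar>cexp t f \<omega>\<bar> \<partial>innov) \<le> (\<integral>\<omega>. cexp t (\<lambda>\<omega>. \<bar>f \<omega>\<bar>) \<omega> \<partial>innov)"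
  proof (rule integral_mono)
    show "integrable innov (\<lambda>\<omega>. \<bar>cexp t f \<omega>\<bar>)" "integrable innov (cexp t (\<lambda>\<omega>. \<bar>f \<omega>\<bar>))"
      using assms integrable_cexp[of f] integrable_cexp[of "\<lambda>\<omega>. \<bar>f \<omega>\<bar>"] by auto
    show "\<bar>cexp t f \<omega>\<bar> \<le> cexp t (\<lambda>\<omega>. \<bar>f \<omega>\<bar>) \<omega>" for \<omega>
      by (simp add: cexp_def)
  qed
  then show ?thesis
    using integral_cexp[of "\<lambda>\<omega>. \<bar>f \<omega>\<bar>" t] assms by simp
qed

text \<open>Triviality of the remote past (Kolmogorov's zero-one law) in L1 form: forecasts of
  \<open>f\<close> from ever earlier times tend to its mean.\<close>

definition forgets :: "int \<Rightarrow> ((int \<Rightarrow> real) \<Rightarrow> real) \<Rightarrow> bool" where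
  "forgets t f \<longleftrightarrow> (\<lambda>m :: nat. \<integral>\<omega>. \<bar>cexp (t - int m) f \<omega> - (\<integral>x. f x \<partial>innov)\<bar> \<partial>innov) \<longlonglongrightarrow> 0"

text \<open>\<open>cexp\<close> and the integral are L1 contractions, so replacing \<open>f\<close>
  by \<open>s i\<close> costs at most twice their L1 distance, uniformly in the conditioning
  time.\<close>

lemma forgets_limit:
  assumes f: "integrable innov f" and s: "\<And>i :: nat. integrable innov (s i)" "\<And>i. forgets t (s i)"
    and lim: "(\<lambda>i. \<integral>\<omega>. \<bar>s i \<omega> - f \<omega>\<bar> \<partial>innov) \<longlonglongrightarrow> 0"
  shows "forgets t f"
proof -
  have le: "(\<integral>\<omega>. \<bar>cexp u f \<omega> - (\<integral>x. f x \<partial>innov)\<bar> \<partial>innov)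
      \<le> (\<integral>\<omega>. \<bar>cexp u (s i) \<omega> - (\<integral>x. s i x \<partial>innov)\<bar> \<partial>innov) + 2 * (\<integral>\<omega>. \<bar>s i \<omega> - f \<omega>\<bar> \<partial>innov)" for u i
  proof -
    define h where "h = (\<lambda>\<omega>. s i \<omega> - f \<omega>)"
    have h: "integrable innov h"
      using f s by (simp add: h_def)
    have c: "integrable innov (cexp u f)" "integrable innov (cexp u (s i))" "integrable innov (cexp u h)"
      using integrable_cexp f s h by auto
    have Eh: "(\<integral>x. h x \<partial>innov) = (\<integral>x. s i x \<partial>innov) - (\<integral>x. f x \<partial>innov)"
      using f s by (simp add: h_def)
    have "(\<integral>\<omega>. \<bar>cexp u f \<omega> - (\<integral>x. f x \<partial>innov)\<bar> \<partial>innov)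
        \<le> (\<integral>\<omega>. \<bar>cexp u (s i) \<omega> - (\<integral>x. s i x \<partial>innov)\<bar> + \<bar>cexp u h \<omega>\<bar> + \<bar>\<integral>x. h x \<partial>innov\<bar> \<partial>innov)"
    proof (rule integral_mono_AE)
      show "AE \<omega> in innov. \<bar>cexp u f \<omega> - (\<integral>x. f x \<partial>innov)\<bar>
          \<le> \<bar>cexp u (s i) \<omega> - (\<integral>x. s i x \<partial>innov)\<bar> + \<bar>cexp u h \<omega>\<bar> + \<bar>\<integral>x. h x \<partial>innov\<bar>"
        using cexp_diff[OF s(1)[of i] f, of u]
      proof eventually_elim
        case (elim \<omega>)
        show ?case
          using elim unfolding h_def[symmetric] Eh by linarith
      qed
    qed (use c in auto)
    also have "\<dots> = (\<integral>\<omega>. \<bar>cexp u (s i) \<omega> - (\<integral>x. s i x \<partial>innov)\<bar> \<partial>innov) + (\<integral>\<omega>. \<bar>cexp u h \<omega>\<bar> \<partial>innov)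
        + \<bar>\<integral>x. h x \<partial>innov\<bar>"
      using c by (simp add: innov.prob_space)
    also have "\<dots> \<le> (\<integral>\<omega>. \<bar>cexp u (s i) \<omega> - (\<integral>x. s i x \<partial>innov)\<bar> \<partial>innov) + (\<integral>\<omega>. \<bar>h \<omega>\<bar> \<partial>innov) + (\<integral>\<omega>. \<bar>h \<omega>\<bar> \<partial>innov)"
      using cexp_L1[OF h] integral_abs_bound[of innov h] by (intro add_mono) auto
    finally show ?thesis
      by (simp add: h_def)
  qed
  show ?thesis
    unfolding forgets_def
  proof (rule LIMSEQ_I)
    fix r :: real assume r: "r > 0"
    obtain i where i: "(\<integral>\<omega>. \<bar>s i \<omega> - f \<omega>\<bar> \<partial>innov) < r / 4"
      using LIMSEQ_D[OF lim, of "r / 4"] r by auto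
    obtain N where N: "\<And>m. m \<ge> N \<Longrightarrow> (\<integral>\<omega>. \<bar>cexp (t - int m) (s i) \<omega> - (\<integral>x. s i x \<partial>innov)\<bar> \<partial>innov) < r / 2"
      using LIMSEQ_D[OF s(2)[of i, unfolded forgets_def], of "r / 2"] r by auto
    show "\<exists>N. \<forall>m\<ge>N. norm ((\<integral>\<omega>. \<bar>cexp (t - int m) f \<omega> - (\<integral>x. f x \<partial>innov)\<bar> \<partial>innov) - 0) < r"
    proof (intro exI allI impI)
      fix m assume "m \<ge> N"
      then show "norm ((\<integral>\<omega>. \<bar>cexp (t - int m) f \<omega> - (\<integral>x. f x \<partial>innov)\<bar> \<partial>innov) - 0) < r"
        using le[of "t - int m" i] N[of m] i by simp
    qed
  qed
qed

lemma forgets_add: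
  assumes f: "integrable innov f" "forgets t f" and g: "integrable innov g" "forgets t g"
  shows "forgets t (\<lambda>\<omega>. f \<omega> + g \<omega>)"
proof -
  have c: "integrable innov (cexp u f)" "integrable innov (cexp u g)" for u
    using integrable_cexp f g by auto
  have le: "(\<integral>\<omega>. \<bar>cexp u (\<lambda>\<omega>. f \<omega> + g \<omega>) \<omega> - (\<integral>x. f x + g x \<partial>innov)\<bar> \<partial>innov)
    \<le> (\<integral>\<omega>. \<bar>cexp u f \<omega> - (\<integral>x. f x \<partial>innov)\<bar> \<partial>innov) + (\<integral>\<omega>. \<bar>cexp u g \<omega> - (\<integral>x. g x \<partial>innov)\<bar> \<partial>innov)" for u
  proof -
    have "(\<integral>\<omega>. \<bar>cexp u (\<lambda>\<omega>. f \<omega> + g \<omega>) \<omega> - (\<integral>x. f x + g x \<partial>innov)\<bar> \<partial>innov)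
      \<le> (\<integral>\<omega>. \<bar>cexp u f \<omega> - (\<integral>x. f x \<partial>innov)\<bar> + \<bar>cexp u g \<omega> - (\<integral>x. g x \<partial>innov)\<bar> \<partial>innov)"
    proof (rule integral_mono_AE)
      show "AE \<omega> in innov. \<bar>cexp u (\<lambda>\<omega>. f \<omega> + g \<omega>) \<omega> - (\<integral>x. f x + g x \<partial>innov)\<bar>
          \<le> \<bar>cexp u f \<omega> - (\<integral>x. f x \<partial>innov)\<bar> + \<bar>cexp u g \<omega> - (\<integral>x. g x \<partial>innov)\<bar>"
        using cexp_add[OF f(1) g(1), of u]
      proof eventually_elim
        case (elim \<omega>)
        show ?case
          unfolding elim Bochner_Integration.integral_add[OF f(1) g(1)] by linarith
      qed
    qed (use c integrable_cexp[of "\<lambda>\<omega>. f \<omega> + g \<omega>"] f g in auto)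
    then show ?thesis
      using c by simp
  qed
  show ?thesis
    unfolding forgets_def
  proof (rule Lim_null_comparison)
    show "(\<lambda>m. (\<integral>\<omega>. \<bar>cexp (t - int m) f \<omega> - (\<integral>x. f x \<partial>innov)\<bar> \<partial>innov)
        + (\<integral>\<omega>. \<bar>cexp (t - int m) g \<omega> - (\<integral>x. g x \<partial>innov)\<bar> \<partial>innov)) \<longlonglongrightarrow> 0"
      using tendsto_add[OF f(2)[unfolded forgets_def] g(2)[unfolded forgets_def]] by simp
  qed (use le in simp)
qed

lemma forgets_scale:
  assumes "forgets t f"
  shows "forgets t (\<lambda>\<omega>. f \<omega> * c)"
proof -
  have "(\<lambda>m :: nat. \<bar>c\<bar> * (\<integral>\<omega>. \<bar>cexp (t - int m) f \<omega> - (\<integral>x. f x \<partial>innov)\<bar> \<partial>innov)) \<longlonglongrightarrow> \<bar>c\<bar> * 0"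
    using assms unfolding forgets_def by (intro tendsto_intros)
  moreover have "\<bar>c\<bar> * (\<integral>\<omega>. \<bar>cexp u f \<omega> - (\<integral>x. f x \<partial>innov)\<bar> \<partial>innov) =
      (\<integral>\<omega>. \<bar>cexp u (\<lambda>\<omega>. f \<omega> * c) \<omega> - (\<integral>x. f x * c \<partial>innov)\<bar> \<partial>innov)" for u
    by (simp add: cexp_def abs_mult[symmetric] algebra_simps flip: integral_mult_right_zero)
  ultimately show ?thesis
    by (simp add: forgets_def)
qed

text \<open>A cylinder involves finitely many coordinates; once the conditioning time precedes all
  of them, the forecast is the constant mean. Cylinders are stable under intersection and generate
  the \<sigma>-algebra, and the property passes to complements and to disjoint unions.\<close>

lemma forgets_indicator:
  assumes "A \<in> sets innov"
  shows "forgets t (indicator A)"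
proof -
  let ?G = "prod_algebra (UNIV :: int set) (\<lambda>_. unif)"
  have A: "A \<in> sigma_sets (\<Pi>\<^sub>E i\<in>UNIV. space unif) ?G"
    using assms by (simp add: innov_def sets_PiM)
  have mem: "B \<in> sets innov" if "B \<in> sigma_sets (\<Pi>\<^sub>E i\<in>UNIV. space unif) ?G" for B
    using that by (simp add: innov_def sets_PiM)
  have ii: "integrable innov (indicator B :: _ \<Rightarrow> real)" if "B \<in> sets innov" for B
    using that by (simp add: innov.emeasure_eq_measure)
  show ?thesis
    using Int_stable_prod_algebra prod_algebra_sets_into_space A
  proof (induction rule: sigma_sets_induct_disjoint)
    case (basic B)
    then obtain J E where B: "B = prod_emb UNIV (\<lambda>_. unif) J (Pi\<^sub>E J E)" and J: "finite J"
      by (elim prod_algebraE)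
    have B_iff: "\<omega> \<in> B \<longleftrightarrow> (\<forall>i\<in>J. \<omega> i \<in> E i)" for \<omega>
      by (auto simp: B prod_emb_def PiE_iff)
    \<comment> \<open>Inserting \<open>t\<close> keeps the minimum meaningful for empty
      \<open>J\<close>; from \<open>m = n\<close> on, \<open>t - m\<close> lies below every index in
      \<open>J\<close>.\<close>
    define n where "n = nat (t - Min (insert t J)) + 1"
    have lt: "t - int m < i" if "m \<ge> n" "i \<in> J" for m i
    proof -
      have "Min (insert t J) \<le> i"
        using J that by (intro Min_le) auto
      then show ?thesis
        using that by (simp add: n_def)
    qed
    have "cexp (t - int m) (indicator B) \<omega> = (\<integral>x. indicator B x \<partial>innov)" if "m \<ge> n" for m \<omega>
    proof -
      have "indicator B (mix {..t - int m} \<omega> x) = (indicator B x :: real)" for x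
      proof -
        have "mix {..t - int m} \<omega> x i = x i" if "i \<in> J" for i
          using lt[OF \<open>m \<ge> n\<close> that] by (simp add: mix_def)
        then show ?thesis
          by (simp add: indicator_def B_iff)
      qed
      then show ?thesis
        by (simp add: cexp_def)
    qed
    then have "\<forall>\<^sub>F m in sequentially. (\<integral>\<omega>. \<bar>cexp (t - int m) (indicator B) \<omega> - (\<integral>x. indicator B x \<partial>innov)\<bar> \<partial>innov) = 0"
      by (intro eventually_sequentiallyI[of n]) simp
    then show ?case
      unfolding forgets_def by (rule tendsto_eventually)
  next
    case empty
    show ?case
      by (simp add: forgets_def cexp_def)
  next
    case (compl B)
    have "forgets t (\<lambda>\<omega>. 1 + indicator B \<omega> * (- 1))"
      using compl ii[OF mem[OF compl(1)]]
      by (intro forgets_add forgets_scale) (auto simp: forgets_def cexp_def innov.prob_space)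
    moreover have "(\<lambda>\<omega>. 1 + indicator B \<omega> * (- 1) :: real) = indicator ((\<Pi>\<^sub>E i\<in>UNIV. space unif) - B)"
      by (auto simp: fun_eq_iff indicator_def)
    ultimately show ?case
      by simp
  next
    case (union B)
    have B: "B i \<in> sets innov" for i
      using union(2) by (intro mem) auto
    define s where "s = (\<lambda>n \<omega>. \<Sum>i<n. indicator (B i) \<omega> :: real)"
    have s: "integrable innov (s n) \<and> forgets t (s n)" for n
    proof (induction n)
      case 0
      then show ?case
        by (simp add: s_def forgets_def cexp_def)
    next
      case (Suc n)
      then show ?case
        using forgets_add[of "s n" t "indicator (B n)"] ii[OF B[of n]] union(3)[of n]
        by (simp add: s_def)
    qed
    have sind: "s n \<omega> = indicator (\<Union>i<n. B i) \<omega>" for n \<omega>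
      unfolding s_def using union(1)
      by (subst indicator_UN_disjoint) (auto simp: disjoint_family_on_def)
    have sU: "(\<lambda>n. s n \<omega>) \<longlonglongrightarrow> indicator (\<Union>i. B i) \<omega>" for \<omega>
      unfolding sind by (rule LIMSEQ_indicator_UN)
    have U: "(\<Union>i. B i) \<in> sets innov"
      using B by auto
    show ?case
    proof (rule forgets_limit[OF ii[OF U]])
      have "(\<lambda>n. \<integral>\<omega>. \<bar>s n \<omega> - indicator (\<Union>i. B i) \<omega>\<bar> \<partial>innov) \<longlonglongrightarrow> (\<integral>\<omega>. 0 \<partial>innov)"
      proof (rule integral_dominated_convergence[where w="\<lambda>_. 1"])
        show "AE \<omega> in innov. (\<lambda>n. \<bar>s n \<omega> - indicator (\<Union>i. B i) \<omega>\<bar>) \<longlonglongrightarrow> 0"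
          using sU by (intro AE_I2 tendsto_rabs_zero LIM_zero) auto
        show "AE \<omega> in innov. norm \<bar>s n \<omega> - indicator (\<Union>i. B i) \<omega>\<bar> \<le> 1" for n
          by (auto simp: sind indicator_def)
      qed (use s B U in \<open>auto simp: s_def\<close>)
      then show "(\<lambda>n. \<integral>\<omega>. \<bar>s n \<omega> - indicator (\<Union>i. B i) \<omega>\<bar> \<partial>innov) \<longlonglongrightarrow> 0"
        by simp
    qed (use s in auto)
  qed
qed

text \<open>Guarantees that the projections onto single innovations exhaust \<open>f\<close> minus
  its mean. The indicator case extends by linearity and dominated convergence.\<close>

lemma cexp_tendsto_integral:
  assumes "integrable innov f"
  shows "forgets t f"
  using assms
proof (induct rule: integrable_induct)
  case (base A c)
  then show ?case
    using forgets_scale[OF forgets_indicator, of A t c] by simp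
next
  case (add f g)
  then show ?case
    by (intro forgets_add)
next
  case (lim f s)
  have "(\<lambda>i. \<integral>\<omega>. \<bar>s i \<omega> - f \<omega>\<bar> \<partial>innov) \<longlonglongrightarrow> (\<integral>\<omega>. 0 \<partial>innov)"
  proof (rule integral_dominated_convergence[where w="\<lambda>\<omega>. 3 * \<bar>f \<omega>\<bar>"])
    show "AE \<omega> in innov. (\<lambda>n. \<bar>s n \<omega> - f \<omega>\<bar>) \<longlonglongrightarrow> 0"
      using lim by (intro AE_I2 tendsto_rabs_zero LIM_zero) auto
    show "AE \<omega> in innov. norm \<bar>s n \<omega> - f \<omega>\<bar> \<le> 3 * \<bar>f \<omega>\<bar>" for n
    proof (rule AE_I2)
      fix \<omega> assume "\<omega> \<in> space innov"
      then show "norm \<bar>s n \<omega> - f \<omega>\<bar> \<le> 3 * \<bar>f \<omega>\<bar>"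
        using lim(4)[of \<omega> n] by simp
    qed
  qed (use lim in auto)
  then show ?case
    using forgets_limit[OF lim(5) lim(1) lim(2)] by simp
qed

text \<open>The innovation of index \<open>j\<close> in the second copy is the only one that distinguishes
  \<open>mix {..j} \<omega> \<omega>'\<close> from \<open>mix {..j - 1} \<omega> \<omega>'\<close>, so the projection is an average of coupling
  differences.\<close>

lemma moment_le_projection:
  fixes F :: "(int \<Rightarrow> real) \<Rightarrow> 'i \<Rightarrow> real"
  assumes I: "finite I" and p: "even p" "p > 0" and c: "c \<ge> 0"
    and F: "\<And>i. i \<in> I \<Longrightarrow> integrable innov (\<lambda>\<omega>. F \<omega> i)"
    and dep: "moment_le (innov \<Otimes>\<^sub>M innov) p
      (\<lambda>z. L2_set (\<lambda>i. F (fst z) i - F ((fst z)(j := snd z j)) i) I) c"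
  shows "moment_le innov p (\<lambda>\<omega>. L2_set (\<lambda>i. cexp j (\<lambda>\<omega>. F \<omega> i) \<omega> - cexp (j - 1) (\<lambda>\<omega>. F \<omega> i) \<omega>) I) c"
proof -
  have [measurable]: "(\<lambda>\<omega>. F \<omega> i) \<in> borel_measurable innov" if "i \<in> I" for i
    using F[OF that] by simp
  define h where "h = (\<lambda>z i. F (fst z) i - F ((fst z)(j := snd z j)) i)"
  \<comment> \<open>Both components together have the law of two independent copies, so the coupling
    hypothesis applies to them. At \<open>j\<close> the second one carries
    \<open>\<omega>' j\<close>, the value that turns \<open>mix {..j}\<close> into
    \<open>mix {..j - 1}\<close>.\<close>
  define sw where "sw = (\<lambda>z. (mix {..j} (fst z) (snd z), mix {..j} (snd z) (fst z)))"
  have upd: "(\<lambda>z. (fst z)(j := snd z j)) \<in> measurable (innov \<Otimes>\<^sub>M innov) innov"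
    by (rule measurable_innovI) (simp add: fun_upd_def)
  have h: "(\<lambda>z. h z i) \<in> borel_measurable (innov \<Otimes>\<^sub>M innov)" if "i \<in> I" for i
    unfolding h_def using that measurable_compose[OF upd, where g="\<lambda>\<omega>. F \<omega> i"] by measurable
  have sw: "sw \<in> measurable (innov \<Otimes>\<^sub>M innov) (innov \<Otimes>\<^sub>M innov)"
    unfolding sw_def by (rule measurable_mix_swap)
  have "moment_le (innov \<Otimes>\<^sub>M innov) p (\<lambda>z. L2_set (h (sw z)) I) c"
    using moment_le_distr[OF distr_mix_swap sw[unfolded sw_def], where f="\<lambda>z. L2_set (h z) I" and p=p and c=c] dep h
    by (simp add: h_def sw_def borel_measurable_L2_set)
  then have "moment_le innov p (\<lambda>\<omega>. L2_set (\<lambda>i. \<integral>\<omega>'. h (sw (\<omega>, \<omega>')) i \<partial>innov) I) c"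
    by (intro moment_le_partial_integral[OF prob_space_innov prob_space_innov I p])
      (use measurable_compose[OF sw h] in auto)
  moreover have "AE \<omega> in innov. \<forall>i\<in>I. cexp j (\<lambda>\<omega>. F \<omega> i) \<omega> - cexp (j - 1) (\<lambda>\<omega>. F \<omega> i) \<omega> = (\<integral>\<omega>'. h (sw (\<omega>, \<omega>')) i \<partial>innov)"
  proof (rule AE_finite_allI[OF I])
    fix i assume i: "i \<in> I"
    have mixj: "(mix {..j} \<omega> \<omega>')(j := mix {..j} \<omega>' \<omega> j) = mix {..j - 1} \<omega> \<omega>'" for \<omega> \<omega>' :: "int \<Rightarrow> real"
      by (auto simp: mix_def fun_eq_iff)
    show "AE \<omega> in innov. cexp j (\<lambda>\<omega>. F \<omega> i) \<omega> - cexp (j - 1) (\<lambda>\<omega>. F \<omega> i) \<omega> = (\<integral>\<omega>'. h (sw (\<omega>, \<omega>')) i \<partial>innov)"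
      using AE_integrable_mix[OF F[OF i], of "{..j}"] AE_integrable_mix[OF F[OF i], of "{..j - 1}"]
      by eventually_elim (simp add: cexp_def h_def sw_def mixj)
  qed
  ultimately show ?thesis
    using p c by (elim moment_le_cong) (auto elim!: eventually_mono intro!: L2_set_cong)
qed

text \<open>Only the product of \<open>g\<close> with the projection is known to be integrable.
  Truncating \<open>g\<close> at level \<open>n\<close> keeps it adapted and makes its product with
  \<open>f\<close> integrable, so both conditional expectations integrate to the same value;
  dominated convergence removes the truncation.\<close>

lemma integral_projection_eq_0:
  assumes f: "integrable innov f" and g: "adapted (j - 1) g"
    and i: "integrable innov (\<lambda>\<omega>. g \<omega> * (cexp j f \<omega> - cexp (j - 1) f \<omega>))"
  shows "(\<integral>\<omega>. g \<omega> * (cexp j f \<omega> - cexp (j - 1) f \<omega>) \<partial>innov) = 0"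
proof -
  define \<delta> where "\<delta> = (\<lambda>\<omega>. cexp j f \<omega> - cexp (j - 1) f \<omega>)"
  define g' where "g' = (\<lambda>(n :: nat) \<omega>. if \<bar>g \<omega>\<bar> \<le> real n then g \<omega> else 0)"
  have [measurable]: "g \<in> borel_measurable innov" "f \<in> borel_measurable innov"
    using g f by (auto simp: adapted_def)
  have [measurable]: "g' n \<in> borel_measurable innov" for n
    unfolding g'_def by measurable
  have ad: "adapted (j - 1) (g' n)" for n
  proof (rule adaptedI)
    fix \<omega> \<omega>' :: "int \<Rightarrow> real" assume "\<And>i. i \<le> j - 1 \<Longrightarrow> \<omega> i = \<omega>' i"
    then show "g' n \<omega> = g' n \<omega>'"
      using adapted_eq[OF g, of \<omega> \<omega>'] by (simp add: g'_def)
  qed measurable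
  have zero: "(\<integral>\<omega>. g' n \<omega> * \<delta> \<omega> \<partial>innov) = 0" for n
  proof -
    have gf: "integrable innov (\<lambda>\<omega>. g' n \<omega> * f \<omega>)"
    proof (rule Bochner_Integration.integrable_bound)
      show "integrable innov (\<lambda>\<omega>. real n * f \<omega>)"
        using f by simp
      show "AE \<omega> in innov. norm (g' n \<omega> * f \<omega>) \<le> norm (real n * f \<omega>)"
        by (auto simp: g'_def abs_mult intro!: AE_I2 mult_right_mono)
    qed measurable
    have a: "adapted j (g' n)"
      by (rule adapted_mono[OF ad]) simp
    show ?thesis
      unfolding \<delta>_def right_diff_distrib
      using integral_mult_cexp[OF a gf] integral_mult_cexp[OF ad gf] by simp
  qed
  have "(\<lambda>n. \<integral>\<omega>. g' n \<omega> * \<delta> \<omega> \<partial>innov) \<longlonglongrightarrow> (\<integral>\<omega>. g \<omega> * \<delta> \<omega> \<partial>innov)"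
  proof (rule integral_dominated_convergence[where w="\<lambda>\<omega>. \<bar>g \<omega> * \<delta> \<omega>\<bar>"])
    show "AE \<omega> in innov. (\<lambda>n. g' n \<omega> * \<delta> \<omega>) \<longlonglongrightarrow> g \<omega> * \<delta> \<omega>"
    proof (rule AE_I2, rule tendsto_eventually)
      fix \<omega>
      obtain n where "\<bar>g \<omega>\<bar> \<le> real n"
        using real_arch_simple by blast
      then show "\<forall>\<^sub>F n in sequentially. g' n \<omega> * \<delta> \<omega> = g \<omega> * \<delta> \<omega>"
        by (intro eventually_sequentiallyI[of n]) (auto simp: g'_def)
    qed
    show "integrable innov (\<lambda>\<omega>. \<bar>g \<omega> * \<delta> \<omega>\<bar>)"
      using i by (simp add: \<delta>_def)
    show "AE \<omega> in innov. norm (g' n \<omega> * \<delta> \<omega>) \<le> \<bar>g \<omega> * \<delta> \<omega>\<bar>" for n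
      by (auto simp: g'_def)
  qed (auto simp: \<delta>_def)
  then show ?thesis
    unfolding zero by (simp add: \<delta>_def LIMSEQ_const_iff)
qed

section \<open>Martingale differences\<close>

text \<open>Step \<open>k\<close> lives at time \<open>a + k\<close>. Orthogonality to every
  function of the strict past, whenever the product is integrable, stands in for a vanishing
  conditional expectation; it is the form in which the moment inequalities use it.\<close>

definition mart_diff :: "int \<Rightarrow> nat \<Rightarrow> 'i set \<Rightarrow> (nat \<Rightarrow> (int \<Rightarrow> real) \<Rightarrow> 'i \<Rightarrow> real) \<Rightarrow> bool" where
  "mart_diff a m I D \<longleftrightarrow> (\<forall>k<m. \<forall>i\<in>I. adapted (a + int k) (\<lambda>\<omega>. D k \<omega> i) \<and>
     (\<forall>g. adapted (a + int k - 1) g \<longrightarrow> integrable innov (\<lambda>\<omega>. g \<omega> * D k \<omega> i) \<longrightarrow>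
        (\<integral>\<omega>. g \<omega> * D k \<omega> i \<partial>innov) = 0))"

lemma mart_diff_partial_sum_eq:
  assumes "mart_diff a m I D" "n \<le> m" "i \<in> I" "\<And>j. j \<le> a + int n - 1 \<Longrightarrow> \<omega> j = \<omega>' j"
  shows "(\<Sum>j<n. D j \<omega> i) = (\<Sum>j<n. D j \<omega>' i)"
proof (rule sum.cong[OF refl])
  fix j assume "j \<in> {..<n}"
  then have "adapted (a + int j) (\<lambda>\<omega>. D j \<omega> i)"
    using assms(1-3) by (simp add: mart_diff_def)
  then show "D j \<omega> i = D j \<omega>' i"
    by (rule adapted_eq) (use assms(4) \<open>j \<in> {..<n}\<close> in simp)
qed

lemma mart_diff_measurable:
  assumes "mart_diff a m I D" "k < m" "i \<in> I"
  shows "(\<lambda>\<omega>. D k \<omega> i) \<in> borel_measurable innov"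
  using assms by (auto simp: mart_diff_def dest: adapted_measurable)

lemma mart_diff_integral_eq_0:
  assumes "mart_diff a m I D" "k < m" "i \<in> I" "adapted (a + int k - 1) g"
    "integrable innov (\<lambda>\<omega>. g \<omega> * D k \<omega> i)"
  shows "(\<integral>\<omega>. g \<omega> * D k \<omega> i \<partial>innov) = 0"
  using assms by (auto simp: mart_diff_def)

section \<open>Moment inequalities for vector-valued martingale differences\<close>

lemma abs_le_L2_set: "finite I \<Longrightarrow> i \<in> I \<Longrightarrow> \<bar>f i\<bar> \<le> L2_set f I"
  using member_le_L2_set[of I i "\<lambda>i. \<bar>f i\<bar>"] by (simp add: L2_set_def)

lemma moment_le_component:
  assumes "moment_le N p (\<lambda>\<omega>. L2_set (f \<omega>) I) c" "even p" "c \<ge> 0" "finite I" "i \<in> I"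
    "(\<lambda>\<omega>. f \<omega> i) \<in> borel_measurable N"
  shows "moment_le N p (\<lambda>\<omega>. f \<omega> i) c"
  using assms by (intro moment_le_mono[OF assms(1,2,6)]) (auto simp: abs_le_L2_set)

lemma L2_set_power2: "(L2_set f I)\<^sup>2 = (\<Sum>i\<in>I. (f i)\<^sup>2)"
  by (simp add: L2_set_def sum_nonneg)

lemma L2_set_add_power2:
  "(L2_set (\<lambda>i. f i + g i) I)\<^sup>2 = (L2_set f I)\<^sup>2 + 2 * (\<Sum>i\<in>I. f i * g i) + (L2_set g I)\<^sup>2"
  by (simp add: L2_set_power2 power2_sum sum.distrib sum_distrib_left ac_simps)

lemma abs_inner_le_L2_set: "\<bar>\<Sum>i\<in>I. f i * g i\<bar> \<le> L2_set f I * L2_set g I"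
  using sum_abs[of "\<lambda>i. f i * g i" I] L2_set_mult_ineq[of f g I] by (simp add: abs_mult)

text \<open>Pythagoras: the inner product of a partial sum with the next difference integrates to
  zero.\<close>

lemma mart_diff_moment2:
  assumes D: "mart_diff a m I D" and I: "finite I" and n: "n \<le> m"
    and c: "\<And>k. k < m \<Longrightarrow> moment_le innov 2 (\<lambda>\<omega>. L2_set (D k \<omega>) I) (c k)" "\<And>k. k < m \<Longrightarrow> c k \<ge> 0"
  shows "moment_le innov 2 (\<lambda>\<omega>. L2_set (\<lambda>i. \<Sum>j<n. D j \<omega> i) I) (sqrt (\<Sum>j<n. (c j)\<^sup>2))"
  using n
proof (induction n)
  case 0
  then show ?case
    by (simp add: moment_le_def L2_set_def)
next
  case (Suc n)
  then have n: "n < m"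
    by simp
  define S where "S = (\<lambda>\<omega> i. \<Sum>j<n. D j \<omega> i)"
  define A where "A = sqrt (\<Sum>j<n. (c j)\<^sup>2)"
  have A: "A \<ge> 0" "A\<^sup>2 = (\<Sum>j<n. (c j)\<^sup>2)"
    by (auto simp: A_def sum_nonneg)
  have IH: "moment_le innov 2 (\<lambda>\<omega>. L2_set (S \<omega>) I) A"
    using Suc by (simp add: S_def A_def)
  have [measurable]: "(\<lambda>\<omega>. D j \<omega> i) \<in> borel_measurable innov" if "j < m" "i \<in> I" for j i
    using mart_diff_measurable[OF D that] .
  have Sm: "(\<lambda>\<omega>. S \<omega> i) \<in> borel_measurable innov" if "i \<in> I" for i
    unfolding S_def using that n by (intro borel_measurable_sum) simp
  have Si: "moment_le innov 2 (\<lambda>\<omega>. S \<omega> i) A" if "i \<in> I" for i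
    by (rule moment_le_component[OF IH]) (use A I that Sm in auto)
  have Di: "moment_le innov 2 (\<lambda>\<omega>. D n \<omega> i) (c n)" if "i \<in> I" for i
    by (rule moment_le_component[OF c(1)]) (use I that c(2)[OF n] n in auto)
  have int: "integrable innov (\<lambda>\<omega>. S \<omega> i * D n \<omega> i)" if "i \<in> I" for i
    using Cauchy_Schwarz_integral(1)[OF Si[OF that] Di[OF that] A(1) c(2)[OF n]] .
  have zero: "(\<integral>\<omega>. S \<omega> i * D n \<omega> i \<partial>innov) = 0" if "i \<in> I" for i
  proof (rule mart_diff_integral_eq_0[OF D n that _ int[OF that]])
    show "adapted (a + int n - 1) (\<lambda>\<omega>. S \<omega> i)"
      unfolding S_def
      by (rule adaptedI[OF Sm[OF that, unfolded S_def]])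
        (rule mart_diff_partial_sum_eq[OF D less_imp_le[OF n] that])
  qed
  note IH' = moment_leD[OF IH] and Dn = moment_leD[OF c(1)[OF n]]
  have eq: "(L2_set (\<lambda>i. \<Sum>j<Suc n. D j \<omega> i) I)\<^sup>2 =
      (L2_set (S \<omega>) I)\<^sup>2 + 2 * (\<Sum>i\<in>I. S \<omega> i * D n \<omega> i) + (L2_set (D n \<omega>) I)\<^sup>2" for \<omega>
    using L2_set_add_power2[of "S \<omega>" "D n \<omega>" I] by (simp add: S_def)
  have "integrable innov (\<lambda>\<omega>. (L2_set (\<lambda>i. \<Sum>j<Suc n. D j \<omega> i) I)\<^sup>2)"
    unfolding eq using IH' Dn int by (intro Bochner_Integration.integrable_add integrable_mult_right Bochner_Integration.integrable_sum)
  moreover have "(\<integral>\<omega>. (L2_set (\<lambda>i. \<Sum>j<Suc n. D j \<omega> i) I)\<^sup>2 \<partial>innov) \<le> (sqrt (\<Sum>j<Suc n. (c j)\<^sup>2))\<^sup>2"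
  proof -
    have "(\<integral>\<omega>. (L2_set (\<lambda>i. \<Sum>j<Suc n. D j \<omega> i) I)\<^sup>2 \<partial>innov) =
       (\<integral>\<omega>. (L2_set (S \<omega>) I)\<^sup>2 \<partial>innov) + 2 * (\<Sum>i\<in>I. \<integral>\<omega>. S \<omega> i * D n \<omega> i \<partial>innov) + (\<integral>\<omega>. (L2_set (D n \<omega>) I)\<^sup>2 \<partial>innov)"
      unfolding eq using IH' Dn int by (simp add: Bochner_Integration.integral_sum)
    also have "\<dots> \<le> A\<^sup>2 + (c n)\<^sup>2"
      using zero IH' Dn by simp
    finally show ?thesis
      by (simp add: A sum_nonneg)
  qed
  moreover have "(\<lambda>\<omega>. L2_set (\<lambda>i. \<Sum>j<Suc n. D j \<omega> i) I) \<in> borel_measurable innov"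
    using Suc(2) by (intro borel_measurable_L2_set borel_measurable_sum) simp
  ultimately show ?case
    by (simp add: moment_le_def)
qed

text \<open>Here \<open>a\<close> and \<open>\<delta>\<close> are the norms of the partial sum and
  of the next difference, and \<open>x\<close> is their inner product. The cubic term
  \<open>4 * a * \<delta> ^ 3\<close> is absorbed by
  \<open>2 * \<delta>\<^sup>2 * (a - \<delta>)\<^sup>2 \<ge> 0\<close>; the one term left with
  \<open>x\<close> has the weight \<open>a\<^sup>2\<close>, a function of the past, and integrates
  to zero.\<close>

lemma power4_sum_le:
  fixes a \<delta> x :: real
  assumes "\<bar>x\<bar> \<le> a * \<delta>" "a \<ge> 0" "\<delta> \<ge> 0"
  shows "(a\<^sup>2 + 2 * x + \<delta>\<^sup>2)\<^sup>2 \<le> a ^ 4 + 8 * (a\<^sup>2 * \<delta>\<^sup>2) + 3 * \<delta> ^ 4 + 4 * (a\<^sup>2 * x)"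
proof -
  have "x\<^sup>2 \<le> (a * \<delta>)\<^sup>2"
    using assms by (intro abs_le_square_iff[THEN iffD1]) auto
  moreover have "x * \<delta>\<^sup>2 \<le> (a * \<delta>) * \<delta>\<^sup>2"
    using assms by (intro mult_right_mono) auto
  moreover have "0 \<le> 2 * \<delta>\<^sup>2 * (a - \<delta>)\<^sup>2"
    by simp
  ultimately show ?thesis
    by (simp add: algebra_simps power2_eq_square power4_eq_xxxx)
qed

text \<open>A Burkholder-type inequality by induction. If \<open>A\<^sup>2\<close> is 4 times the
  sum of squares so far, one step gives at most
  \<open>A ^ 4 + 8 * A\<^sup>2 * c\<^sup>2 + 3 * c ^ 4\<close>, which is below
  \<open>(A\<^sup>2 + 4 * c\<^sup>2)\<^sup>2\<close>; the factor 4 matches the 8, whence the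
  constant 2.\<close>

lemma mart_diff_moment4:
  assumes D: "mart_diff a m I D" and I: "finite I" and n: "n \<le> m"
    and c: "\<And>k. k < m \<Longrightarrow> moment_le innov 4 (\<lambda>\<omega>. L2_set (D k \<omega>) I) (c k)" "\<And>k. k < m \<Longrightarrow> c k \<ge> 0"
  shows "moment_le innov 4 (\<lambda>\<omega>. L2_set (\<lambda>i. \<Sum>j<n. D j \<omega> i) I) (2 * sqrt (\<Sum>j<n. (c j)\<^sup>2))"
  using n
proof (induction n)
  case 0
  then show ?case
    by (simp add: moment_le_def L2_set_def)
next
  case (Suc n)
  then have n: "n < m"
    by simp
  define S where "S = (\<lambda>\<omega> i. \<Sum>j<n. D j \<omega> i)"
  define A where "A = 2 * sqrt (\<Sum>j<n. (c j)\<^sup>2)"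
  have A: "A \<ge> 0" "A\<^sup>2 = 4 * (\<Sum>j<n. (c j)\<^sup>2)"
    by (auto simp: A_def sum_nonneg power_mult_distrib)
  have IH: "moment_le innov 4 (\<lambda>\<omega>. L2_set (S \<omega>) I) A"
    using Suc by (simp add: S_def A_def)
  have [measurable]: "(\<lambda>\<omega>. D j \<omega> i) \<in> borel_measurable innov" if "j < m" "i \<in> I" for j i
    using mart_diff_measurable[OF D that] .
  have Sm[measurable]: "(\<lambda>\<omega>. S \<omega> i) \<in> borel_measurable innov" if "i \<in> I" for i
    unfolding S_def using that n by (intro borel_measurable_sum) simp
  note IH' = moment_leD[OF IH] and Dn = moment_leD[OF c(1)[OF n]]
  note [measurable] = IH'(1) Dn(1)
  define s where "s = (\<lambda>\<omega>. L2_set (S \<omega>) I)"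
  define \<delta> where "\<delta> = (\<lambda>\<omega>. L2_set (D n \<omega>) I)"
  have s0: "s \<omega> \<ge> 0" "\<delta> \<omega> \<ge> 0" for \<omega>
    by (auto simp: s_def \<delta>_def)
  have [measurable]: "s \<in> borel_measurable innov" "\<delta> \<in> borel_measurable innov"
    by (auto simp: s_def[abs_def] \<delta>_def[abs_def])
  have sd: "integrable innov (\<lambda>\<omega>. (s \<omega>)\<^sup>2 * (\<delta> \<omega>)\<^sup>2)" "(\<integral>\<omega>. (s \<omega>)\<^sup>2 * (\<delta> \<omega>)\<^sup>2 \<partial>innov) \<le> A\<^sup>2 * (c n)\<^sup>2"
    using Cauchy_Schwarz_integral[OF moment_le_square[OF IH] moment_le_square[OF c(1)[OF n]]]
    by (auto simp: s_def \<delta>_def)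
  have s3d: "s \<omega> ^ 3 * \<delta> \<omega> \<le> s \<omega> ^ 4 + \<delta> \<omega> ^ 4" for \<omega>
  proof (cases "s \<omega> \<le> \<delta> \<omega>")
    case True
    then have "s \<omega> ^ 3 * \<delta> \<omega> \<le> \<delta> \<omega> ^ 3 * \<delta> \<omega>"
      using s0 by (intro mult_right_mono power_mono)
    then show ?thesis
      using s0(1)[of \<omega>] by (simp add: power4_eq_xxxx power3_eq_cube mult.assoc add_increasing)
  next
    case False
    then have "s \<omega> ^ 3 * \<delta> \<omega> \<le> s \<omega> ^ 3 * s \<omega>"
      using s0 by (intro mult_left_mono) auto
    then show ?thesis
      using s0(2)[of \<omega>] by (simp add: power4_eq_xxxx power3_eq_cube mult.assoc add_increasing2)
  qed
  have int: "integrable innov (\<lambda>\<omega>. ((s \<omega>)\<^sup>2 * S \<omega> i) * D n \<omega> i)" if i: "i \<in> I" for i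
  proof (rule Bochner_Integration.integrable_bound)
    show "integrable innov (\<lambda>\<omega>. s \<omega> ^ 4 + \<delta> \<omega> ^ 4)"
      using IH' Dn by (auto simp: s_def \<delta>_def)
    have "\<bar>((s \<omega>)\<^sup>2 * S \<omega> i) * D n \<omega> i\<bar> \<le> s \<omega> ^ 4 + \<delta> \<omega> ^ 4" for \<omega>
    proof -
      have "\<bar>((s \<omega>)\<^sup>2 * S \<omega> i) * D n \<omega> i\<bar> = (s \<omega>)\<^sup>2 * (\<bar>S \<omega> i\<bar> * \<bar>D n \<omega> i\<bar>)"
        by (simp add: abs_mult)
      also have "\<dots> \<le> (s \<omega>)\<^sup>2 * (s \<omega> * \<delta> \<omega>)"
        using s0 I i by (intro mult_left_mono mult_mono) (auto simp: s_def \<delta>_def abs_le_L2_set)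
      also have "\<dots> \<le> s \<omega> ^ 4 + \<delta> \<omega> ^ 4"
        using s3d[of \<omega>] by (simp add: power2_eq_square power3_eq_cube mult.assoc)
      finally show ?thesis .
    qed
    then show "AE \<omega> in innov. norm (((s \<omega>)\<^sup>2 * S \<omega> i) * D n \<omega> i) \<le> norm (s \<omega> ^ 4 + \<delta> \<omega> ^ 4)"
      by (auto intro: order_trans[OF _ abs_ge_self])
  qed (use i n in measurable)
  have Seq: "S \<omega> i = S \<omega>' i" if "\<And>j. j \<le> a + int n - 1 \<Longrightarrow> \<omega> j = \<omega>' j" "i \<in> I" for \<omega> \<omega>' i
    using mart_diff_partial_sum_eq[OF D _ that(2), of n \<omega> \<omega>'] that(1) n unfolding S_def by simp
  have zero: "(\<integral>\<omega>. ((s \<omega>)\<^sup>2 * S \<omega> i) * D n \<omega> i \<partial>innov) = 0" if "i \<in> I" for i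
  proof (rule mart_diff_integral_eq_0[OF D n that _ int[OF that]])
    show "adapted (a + int n - 1) (\<lambda>\<omega>. (s \<omega>)\<^sup>2 * S \<omega> i)"
    proof (rule adaptedI)
      fix \<omega> \<omega>' :: "int \<Rightarrow> real" assume *: "\<And>i. i \<le> a + int n - 1 \<Longrightarrow> \<omega> i = \<omega>' i"
      have "s \<omega> = s \<omega>'"
        unfolding s_def using Seq[OF *] by (intro L2_set_cong) auto
      then show "(s \<omega>)\<^sup>2 * S \<omega> i = (s \<omega>')\<^sup>2 * S \<omega>' i"
        using Seq[OF * that] by simp
    qed (use that in measurable)
  qed
  define x where "x = (\<lambda>\<omega>. \<Sum>i\<in>I. S \<omega> i * D n \<omega> i)"
  have sx: "(s \<omega>)\<^sup>2 * x \<omega> = (\<Sum>i\<in>I. ((s \<omega>)\<^sup>2 * S \<omega> i) * D n \<omega> i)" for \<omega>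
    by (simp add: x_def sum_distrib_left mult.assoc)
  have isx: "integrable innov (\<lambda>\<omega>. (s \<omega>)\<^sup>2 * x \<omega>)" "(\<integral>\<omega>. (s \<omega>)\<^sup>2 * x \<omega> \<partial>innov) = 0"
    unfolding sx using int zero by (auto simp: Bochner_Integration.integral_sum)
  define f where "f = (\<lambda>\<omega>. L2_set (\<lambda>i. \<Sum>j<Suc n. D j \<omega> i) I)"
  define u where "u = (\<lambda>\<omega>. s \<omega> ^ 4 + 8 * ((s \<omega>)\<^sup>2 * (\<delta> \<omega>)\<^sup>2) + 3 * \<delta> \<omega> ^ 4 + 4 * ((s \<omega>)\<^sup>2 * x \<omega>))"
  have fu: "f \<omega> ^ 4 \<le> u \<omega>" for \<omega>
  proof -
    have "(f \<omega>)\<^sup>2 = (s \<omega>)\<^sup>2 + 2 * x \<omega> + (\<delta> \<omega>)\<^sup>2"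
      using L2_set_add_power2[of "S \<omega>" "D n \<omega>" I] by (simp add: S_def f_def s_def \<delta>_def x_def)
    moreover have "f \<omega> ^ 4 = ((f \<omega>)\<^sup>2)\<^sup>2"
      by simp
    ultimately show ?thesis
      unfolding u_def using power4_sum_le[OF _ s0, of "x \<omega>" \<omega> \<omega>] abs_inner_le_L2_set[of "S \<omega>" "D n \<omega>" I]
      by (simp add: x_def s_def \<delta>_def)
  qed
  have fm[measurable]: "f \<in> borel_measurable innov"
    unfolding f_def[abs_def] using Suc(2) by (intro borel_measurable_L2_set borel_measurable_sum) simp
  have iu: "integrable innov u"
    unfolding u_def[abs_def] using isx sd IH' Dn by (auto simp: s_def \<delta>_def)
  have iff4: "integrable innov (\<lambda>\<omega>. f \<omega> ^ 4)"
    by (rule Bochner_Integration.integrable_bound[OF iu])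
      (auto simp: zero_le_even_power intro!: AE_I2 order_trans[OF fu])
  have "(\<integral>\<omega>. f \<omega> ^ 4 \<partial>innov) \<le> (\<integral>\<omega>. u \<omega> \<partial>innov)"
    by (intro integral_mono iff4 iu fu)
  also have "\<dots> = (\<integral>\<omega>. s \<omega> ^ 4 \<partial>innov) + 8 * (\<integral>\<omega>. (s \<omega>)\<^sup>2 * (\<delta> \<omega>)\<^sup>2 \<partial>innov) + 3 * (\<integral>\<omega>. \<delta> \<omega> ^ 4 \<partial>innov)"
    unfolding u_def using isx sd(1) IH'(2) Dn(2) by (simp add: s_def \<delta>_def)
  also have "\<dots> \<le> A ^ 4 + 8 * (A\<^sup>2 * (c n)\<^sup>2) + 3 * (c n) ^ 4"
    using sd(2) IH'(3) Dn(3) by (intro add_mono mult_left_mono) (auto simp: s_def \<delta>_def)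
  also have "\<dots> \<le> (A\<^sup>2 + 4 * (c n)\<^sup>2)\<^sup>2"
    by (simp add: power2_sum power_mult_distrib flip: power_mult)
  also have "\<dots> = (2 * sqrt (\<Sum>j<Suc n. (c j)\<^sup>2)) ^ 4"
  proof -
    have "(2 * sqrt (\<Sum>j<Suc n. (c j)\<^sup>2)) ^ 4 = ((2 * sqrt (\<Sum>j<Suc n. (c j)\<^sup>2))\<^sup>2)\<^sup>2"
      by (simp only: power_mult[symmetric]) simp
    also have "(2 * sqrt (\<Sum>j<Suc n. (c j)\<^sup>2))\<^sup>2 = A\<^sup>2 + 4 * (c n)\<^sup>2"
      by (simp add: power_mult_distrib A sum_nonneg add_nonneg_nonneg)
    finally show ?thesis ..
  qed
  finally show ?case
    using fm iff4 by (simp add: moment_le_def f_def)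
qed

text \<open>The deterministic core of Doob's L2 inequality: the left side is a transform of
  \<open>s\<close> with its running maximum as integrand. When the maximum is renewed, the inductive
  step is the nonnegativity of a square.\<close>

lemma Doob_pathwise:
  fixes s :: "nat \<Rightarrow> real"
  assumes "\<And>k. s k \<ge> 0"
  shows "2 * (\<Sum>i<n. Max (s ` {..i}) * (s (Suc i) - s i)) \<le> 2 * Max (s ` {..n}) * s n - (Max (s ` {..n}))\<^sup>2"
proof (induction n)
  case 0
  then show ?case
    by (simp add: power2_eq_square)
next
  case (Suc n)
  define M where "M = Max (s ` {..n})"
  have M': "Max (s ` {..Suc n}) = max (s (Suc n)) M"
    unfolding M_def by (simp add: atMost_Suc)
  have "2 * M * s (Suc n) - M\<^sup>2 \<le> 2 * max (s (Suc n)) M * s (Suc n) - (max (s (Suc n)) M)\<^sup>2"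
  proof (cases "s (Suc n) \<le> M")
    case False
    have "0 \<le> (s (Suc n) - M)\<^sup>2"
      by simp
    then show ?thesis
      using False by (simp add: max_def power2_eq_square algebra_simps)
  qed (simp add: max_def)
  then show ?case
    using Suc by (simp add: M' M_def[symmetric] algebra_simps)
qed

text \<open>The norm of a martingale is a submartingale: an increment of the norm is at least the
  inner product of the difference with the unit vector \<open>u\<close> of the current sum, which is
  known beforehand. Each term of the transform in \<open>Doob_pathwise\<close> therefore has
  nonnegative integral.\<close>

lemma mart_diff_Doob:
  assumes D: "mart_diff a m I D" and I: "finite I"
    and c: "\<And>k. k < m \<Longrightarrow> moment_le innov 2 (\<lambda>\<omega>. L2_set (D k \<omega>) I) (c k)" "\<And>k. k < m \<Longrightarrow> c k \<ge> 0"
  shows "moment_le innov 2 (\<lambda>\<omega>. Max ((\<lambda>n. L2_set (\<lambda>i. \<Sum>j<n. D j \<omega> i) I) ` {..m})) (2 * sqrt (\<Sum>j<m. (c j)\<^sup>2))"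
proof -
  define s where "s = (\<lambda>n \<omega>. L2_set (\<lambda>i. \<Sum>j<n. D j \<omega> i) I)"
  define M where "M = (\<lambda>n \<omega>. Max ((\<lambda>k. s k \<omega>) ` {..n}))"
  define A where "A = (\<lambda>n. sqrt (\<Sum>j<n. (c j)\<^sup>2))"
  have A: "A n \<ge> 0" for n
    by (auto simp: A_def sum_nonneg)
  have s0: "s n \<omega> \<ge> 0" for n \<omega>
    by (simp add: s_def)
  have sA: "moment_le innov 2 (s n) (A n)" if "n \<le> m" for n
    using mart_diff_moment2[OF D I that c] by (simp add: s_def[abs_def] A_def)
  have Dm[measurable]: "(\<lambda>\<omega>. D j \<omega> i) \<in> borel_measurable innov" if "j < m" "i \<in> I" for j i
    using mart_diff_measurable[OF D that] .
  have sm: "s n \<in> borel_measurable innov" if "n \<le> m" for n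
    using sA[OF that] by (simp add: moment_le_def)
  have Mm: "M n \<in> borel_measurable innov" if "n \<le> m" for n
    unfolding M_def[abs_def] using that sm by (intro borel_measurable_Max) auto
  have M0: "0 \<le> M n \<omega>" for n \<omega>
    using s0[of 0 \<omega>] unfolding M_def by (intro order_trans[OF s0 Max_ge]) auto
  have Mle: "M n \<omega> \<le> (\<Sum>k\<le>n. s k \<omega>)" for n \<omega>
    unfolding M_def using s0 by (intro Max.boundedI) (auto intro!: member_le_sum)
  have MA: "moment_le innov 2 (M n) (\<Sum>k\<le>n. A k)" if "n \<le> m" for n
  proof (rule moment_le_mono[OF moment_le_sum[of "{..n}" 2 innov s A]])
    show "AE \<omega> in innov. \<bar>M n \<omega>\<bar> \<le> \<bar>\<Sum>k\<le>n. s k \<omega>\<bar>"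
      using M0 by (intro AE_I2) (auto intro: order_trans[OF Mle abs_ge_self])
  qed (use that sA A Mm in \<open>auto intro: sum_nonneg\<close>)
  have step: "integrable innov (\<lambda>\<omega>. M n \<omega> * (s (Suc n) \<omega> - s n \<omega>))"
    "0 \<le> (\<integral>\<omega>. M n \<omega> * (s (Suc n) \<omega> - s n \<omega>) \<partial>innov)" if n: "n < m" for n
  proof -
    have i1: "integrable innov (\<lambda>\<omega>. M n \<omega> * s k \<omega>)" if "k \<le> m" for k
      using Cauchy_Schwarz_integral(1)[OF MA[of n] sA[OF that]] n A by (auto intro: sum_nonneg)
    show i: "integrable innov (\<lambda>\<omega>. M n \<omega> * (s (Suc n) \<omega> - s n \<omega>))"
      unfolding right_diff_distrib using i1 n by auto
    define S where "S = (\<lambda>\<omega> i. \<Sum>j<n. D j \<omega> i)"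
    \<comment> \<open>Where the sum vanishes, division by zero makes \<open>u\<close> the zero
      vector, so its length is at most 1 and its inner product with \<open>S\<close> is still the
      norm of \<open>S\<close>.\<close>
    define u where "u = (\<lambda>\<omega> i. S \<omega> i / s n \<omega>)"
    have Seq: "S \<omega> i = S \<omega>' i" if "\<And>j. j \<le> a + int n - 1 \<Longrightarrow> \<omega> j = \<omega>' j" "i \<in> I" for \<omega> \<omega>' i
      using mart_diff_partial_sum_eq[OF D _ that(2), of n \<omega> \<omega>'] that(1) n by (simp add: S_def)
    have seq: "s k \<omega> = s k \<omega>'" if "\<And>j. j \<le> a + int n - 1 \<Longrightarrow> \<omega> j = \<omega>' j" "k \<le> n" for \<omega> \<omega>' k
      unfolding s_def using mart_diff_partial_sum_eq[OF D, of k _ \<omega> \<omega>'] that n by (intro L2_set_cong refl) auto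
    have um[measurable]: "(\<lambda>\<omega>. u \<omega> i) \<in> borel_measurable innov" if "i \<in> I" for i
      unfolding u_def S_def using that n sm[of n] by (intro borel_measurable_divide borel_measurable_sum) auto
    have ad: "adapted (a + int n - 1) (\<lambda>\<omega>. M n \<omega> * u \<omega> i)" if "i \<in> I" for i
    proof (rule adaptedI)
      fix \<omega> \<omega>' :: "int \<Rightarrow> real" assume *: "\<And>i. i \<le> a + int n - 1 \<Longrightarrow> \<omega> i = \<omega>' i"
      have "M n \<omega> = M n \<omega>'"
        unfolding M_def using seq[of \<omega> \<omega>', OF *] by (intro arg_cong[of _ _ Max] image_cong) auto
      then show "M n \<omega> * u \<omega> i = M n \<omega>' * u \<omega>' i"
        using Seq[OF * that] seq[of \<omega> \<omega>' n, OF *] by (simp add: u_def)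
    qed (use um[OF that] Mm[of n] n in \<open>auto intro: borel_measurable_times\<close>)
    have u1: "L2_set (u \<omega>) I \<le> 1" for \<omega>
    proof -
      have "L2_set (u \<omega>) I = L2_set (S \<omega>) I / s n \<omega>"
        unfolding u_def divide_inverse using s0 by (subst L2_set_left_distrib) auto
      then show ?thesis
        by (simp add: s_def S_def)
    qed
    have Mu: "moment_le innov 2 (\<lambda>\<omega>. M n \<omega> * u \<omega> i) (\<Sum>k\<le>n. A k)" if i: "i \<in> I" for i
    proof (rule moment_le_mono[OF MA[of n]])
      have "\<bar>M n \<omega> * u \<omega> i\<bar> \<le> \<bar>M n \<omega>\<bar> * 1" for \<omega>
        unfolding abs_mult using abs_le_L2_set[OF I i, of "u \<omega>"] u1[of \<omega>] by (intro mult_left_mono) auto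
      then show "AE \<omega> in innov. \<bar>M n \<omega> * u \<omega> i\<bar> \<le> \<bar>M n \<omega>\<bar>"
        by simp
    qed (use n A ad[OF i] in \<open>auto intro: sum_nonneg adapted_measurable\<close>)
    have Di: "moment_le innov 2 (\<lambda>\<omega>. D n \<omega> i) (c n)" if "i \<in> I" for i
      by (rule moment_le_component[OF c(1)]) (use I that c(2)[OF n] n in auto)
    have iMuD: "integrable innov (\<lambda>\<omega>. (M n \<omega> * u \<omega> i) * D n \<omega> i)" if "i \<in> I" for i
      using Cauchy_Schwarz_integral(1)[OF Mu[OF that] Di[OF that]] c(2)[OF n] A by (auto intro: sum_nonneg)
    have "0 = (\<integral>\<omega>. (\<Sum>i\<in>I. (M n \<omega> * u \<omega> i) * D n \<omega> i) \<partial>innov)"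
      using iMuD mart_diff_integral_eq_0[OF D n _ ad] by (simp add: Bochner_Integration.integral_sum)
    also have "\<dots> \<le> (\<integral>\<omega>. M n \<omega> * (s (Suc n) \<omega> - s n \<omega>) \<partial>innov)"
    proof (intro integral_mono i Bochner_Integration.integrable_sum iMuD)
      fix \<omega>
      have "(\<Sum>i\<in>I. u \<omega> i * S \<omega> i) = s n \<omega>"
      proof -
        have "s n \<omega> = L2_set (S \<omega>) I"
          by (simp add: s_def S_def)
        then have "(s n \<omega>)\<^sup>2 = (\<Sum>i\<in>I. S \<omega> i * S \<omega> i)"
          by (simp only: L2_set_power2) (simp only: power2_eq_square)
        then have "(\<Sum>i\<in>I. u \<omega> i * S \<omega> i) = (s n \<omega>)\<^sup>2 / s n \<omega>"
          by (simp add: u_def sum_divide_distrib)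
        then show ?thesis
          by (simp add: power2_eq_square)
      qed
      moreover have "(\<Sum>i\<in>I. u \<omega> i * (S \<omega> i + D n \<omega> i)) \<le> s (Suc n) \<omega>"
      proof -
        have "(\<Sum>i\<in>I. u \<omega> i * (S \<omega> i + D n \<omega> i)) \<le> L2_set (u \<omega>) I * s (Suc n) \<omega>"
          using abs_inner_le_L2_set[of "u \<omega>" "\<lambda>i. S \<omega> i + D n \<omega> i" I] by (simp add: s_def S_def)
        also have "\<dots> \<le> 1 * s (Suc n) \<omega>"
          using u1 s0 by (intro mult_right_mono)
        finally show ?thesis
          by simp
      qed
      ultimately have "(\<Sum>i\<in>I. u \<omega> i * D n \<omega> i) \<le> s (Suc n) \<omega> - s n \<omega>"
        by (simp add: distrib_left sum.distrib)
      then have "M n \<omega> * (\<Sum>i\<in>I. u \<omega> i * D n \<omega> i) \<le> M n \<omega> * (s (Suc n) \<omega> - s n \<omega>)"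
        using M0 by (intro mult_left_mono)
      then show "(\<Sum>i\<in>I. (M n \<omega> * u \<omega> i) * D n \<omega> i) \<le> M n \<omega> * (s (Suc n) \<omega> - s n \<omega>)"
        by (simp add: sum_distrib_left mult.assoc)
    qed
    finally show "0 \<le> (\<integral>\<omega>. M n \<omega> * (s (Suc n) \<omega> - s n \<omega>) \<partial>innov)" .
  qed
  \<comment> \<open>The square \<open>(M - 2 * s)\<^sup>2\<close> bounds \<open>2 * M * s\<close> by
    \<open>M\<^sup>2 / 2 + 2 * s\<^sup>2\<close>; this is where Doob's factor 2 arises.\<close>
  have path: "2 * (\<Sum>i<m. M i \<omega> * (s (Suc i) \<omega> - s i \<omega>)) + (M m \<omega>)\<^sup>2 / 2 \<le> 2 * (s m \<omega>)\<^sup>2" for \<omega>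
  proof -
    have "0 \<le> (M m \<omega> - 2 * s m \<omega>)\<^sup>2"
      by simp
    then show ?thesis
      using Doob_pathwise[of "\<lambda>k. s k \<omega>" m, OF s0] by (simp add: M_def power2_eq_square algebra_simps)
  qed
  note MM = moment_leD[OF MA[OF order_refl]] and ss = moment_leD[OF sA[OF order_refl]]
  have "(\<integral>\<omega>. (M m \<omega>)\<^sup>2 / 2 \<partial>innov) \<le> (\<integral>\<omega>. 2 * (\<Sum>i<m. M i \<omega> * (s (Suc i) \<omega> - s i \<omega>)) \<partial>innov) + (\<integral>\<omega>. (M m \<omega>)\<^sup>2 / 2 \<partial>innov)"
    using step(1) step(2) by (auto simp: Bochner_Integration.integral_sum intro!: sum_nonneg)
  also have "\<dots> = (\<integral>\<omega>. 2 * (\<Sum>i<m. M i \<omega> * (s (Suc i) \<omega> - s i \<omega>)) + (M m \<omega>)\<^sup>2 / 2 \<partial>innov)"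
    using step(1) MM(2) by (intro Bochner_Integration.integral_add[symmetric]) auto
  also have "\<dots> \<le> (\<integral>\<omega>. 2 * (s m \<omega>)\<^sup>2 \<partial>innov)"
    using step(1) MM(2) ss(2) path
    by (intro integral_mono Bochner_Integration.integrable_add integrable_mult_right
        Bochner_Integration.integrable_sum integrable_divide) auto
  finally have "(\<integral>\<omega>. (M m \<omega>)\<^sup>2 \<partial>innov) \<le> 4 * (\<integral>\<omega>. (s m \<omega>)\<^sup>2 \<partial>innov)"
    by simp
  also have "\<dots> \<le> (2 * A m)\<^sup>2"
    using ss(3) by (simp add: power_mult_distrib)
  finally show ?thesis
    using MM Mm[of m] by (simp add: moment_le_def M_def[abs_def] s_def A_def)
qed

section \<open>Sums under physical dependence\<close>

lemma cexp_telescope: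
  "(\<Sum>l<L. cexp (t - int l) f \<omega> - cexp (t - int l - 1) f \<omega>) = cexp t f \<omega> - cexp (t - int L) f \<omega>"
  by (induction L) (auto simp: algebra_simps)

lemma cexp_L1_tendsto_0:
  assumes "integrable innov f" "(\<integral>\<omega>. f \<omega> \<partial>innov) = 0"
  shows "(\<lambda>L. \<integral>\<omega>. \<bar>cexp (t - int L) f \<omega>\<bar> \<partial>innov) \<longlonglongrightarrow> 0"
  using cexp_tendsto_integral[OF assms(1), of t] assms(2) by (simp add: forgets_def)

lemma mart_diff_projection:
  assumes "\<And>k i. k < m \<Longrightarrow> i \<in> I \<Longrightarrow> integrable innov (\<lambda>\<omega>. F k \<omega> i)"
  shows "mart_diff a m I (\<lambda>k \<omega> i. cexp (a + int k) (\<lambda>\<omega>. F k \<omega> i) \<omega> - cexp (a + int k - 1) (\<lambda>\<omega>. F k \<omega> i) \<omega>)"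
  unfolding mart_diff_def
proof (intro allI impI ballI conjI)
  fix k i assume k: "k < m" "i \<in> I"
  have [measurable]: "(\<lambda>\<omega>. F k \<omega> i) \<in> borel_measurable innov"
    using assms[OF k] by simp
  show "adapted (a + int k) (\<lambda>\<omega>. cexp (a + int k) (\<lambda>\<omega>. F k \<omega> i) \<omega> - cexp (a + int k - 1) (\<lambda>\<omega>. F k \<omega> i) \<omega>)"
  proof (rule adaptedI)
    fix \<omega> \<omega>' :: "int \<Rightarrow> real" assume *: "\<And>j. j \<le> a + int k \<Longrightarrow> \<omega> j = \<omega>' j"
    have "cexp (a + int k) (\<lambda>\<omega>. F k \<omega> i) \<omega> = cexp (a + int k) (\<lambda>\<omega>. F k \<omega> i) \<omega>'"
      by (rule adapted_eq[OF adapted_cexp]) (use * in auto)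
    moreover have "cexp (a + int k - 1) (\<lambda>\<omega>. F k \<omega> i) \<omega> = cexp (a + int k - 1) (\<lambda>\<omega>. F k \<omega> i) \<omega>'"
      by (rule adapted_eq[OF adapted_cexp]) (use * in auto)
    ultimately show "cexp (a + int k) (\<lambda>\<omega>. F k \<omega> i) \<omega> - cexp (a + int k - 1) (\<lambda>\<omega>. F k \<omega> i) \<omega> =
        cexp (a + int k) (\<lambda>\<omega>. F k \<omega> i) \<omega>' - cexp (a + int k - 1) (\<lambda>\<omega>. F k \<omega> i) \<omega>'"
      by simp
  qed measurable
next
  fix k i g assume "k < m" "i \<in> I" "adapted (a + int k - 1) g"
    "integrable innov (\<lambda>\<omega>. g \<omega> * (cexp (a + int k) (\<lambda>\<omega>. F k \<omega> i) \<omega> - cexp (a + int k - 1) (\<lambda>\<omega>. F k \<omega> i) \<omega>))"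
  then show "(\<integral>\<omega>. g \<omega> * (cexp (a + int k) (\<lambda>\<omega>. F k \<omega> i) \<omega> - cexp (a + int k - 1) (\<lambda>\<omega>. F k \<omega> i) \<omega>) \<partial>innov) = 0"
    using integral_projection_eq_0[OF assms] by blast
qed

text \<open>The physical dependence measure: how far \<open>F\<close> moves when innovation
  \<open>j\<close> alone is replaced by an independent copy.\<close>

definition coupling_le :: "nat \<Rightarrow> 'i set \<Rightarrow> ((int \<Rightarrow> real) \<Rightarrow> 'i \<Rightarrow> real) \<Rightarrow> int \<Rightarrow> real \<Rightarrow> bool" where
  "coupling_le p I F j c \<longleftrightarrow> moment_le (innov \<Otimes>\<^sub>M innov) p
      (\<lambda>z. L2_set (\<lambda>i. F (fst z) i - F ((fst z)(j := snd z j)) i) I) c"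

text \<open>\<open>X\<close> is the sum over the lags \<open>l\<close> of its projections onto the innovation \<open>l\<close> steps back; for
  each fixed lag these form a martingale difference sequence. The seminorm \<open>N\<close> is the norm of the
  sum for fourth moments and the maximum over the partial sums for second moments.\<close>

lemma dependent_seminorm_moment:
  fixes X :: "nat \<Rightarrow> (int \<Rightarrow> real) \<Rightarrow> 'i \<Rightarrow> real" and N :: "(nat \<Rightarrow> 'i \<Rightarrow> real) \<Rightarrow> real"
  assumes I: "finite I" and p: "even p" "p > 0" and B: "B \<ge> 0"
    and X: "\<And>k i. k < m \<Longrightarrow> i \<in> I \<Longrightarrow> adapted (\<tau> + int k) (\<lambda>\<omega>. X k \<omega> i)"
      "\<And>k i. k < m \<Longrightarrow> i \<in> I \<Longrightarrow> integrable innov (\<lambda>\<omega>. X k \<omega> i)"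
      "\<And>k i. k < m \<Longrightarrow> i \<in> I \<Longrightarrow> (\<integral>\<omega>. X k \<omega> i \<partial>innov) = 0"
    and dep: "\<And>k l. k < m \<Longrightarrow> coupling_le p I (X k) (\<tau> + int k - int l) (\<theta> l)"
    and \<theta>: "\<And>l. \<theta> l \<ge> 0" "\<And>L. (\<Sum>l<L. \<theta> l) \<le> S"
    and N_meas: "\<And>Y. (\<And>k i. k < m \<Longrightarrow> i \<in> I \<Longrightarrow> (\<lambda>\<omega>. Y k \<omega> i) \<in> borel_measurable innov) \<Longrightarrow>
        (\<lambda>\<omega>. N (\<lambda>k. Y k \<omega>)) \<in> borel_measurable innov"
    and N_add: "\<And>x y. N (\<lambda>k i. x k i + y k i) \<le> N x + N y"
    and N_nonneg: "\<And>x. N x \<ge> 0"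
    and N_le: "\<And>x. N x \<le> (\<Sum>k<m. \<Sum>i\<in>I. \<bar>x k i\<bar>)"
    and N_mart: "\<And>D a c. mart_diff a m I D \<Longrightarrow>
        (\<And>k. k < m \<Longrightarrow> moment_le innov p (\<lambda>\<omega>. L2_set (D k \<omega>) I) c) \<Longrightarrow> c \<ge> 0 \<Longrightarrow>
        moment_le innov p (\<lambda>\<omega>. N (\<lambda>k. D k \<omega>)) (B * c)"
  shows "moment_le innov p (\<lambda>\<omega>. N (\<lambda>k. X k \<omega>)) (B * S)"
proof -
  have [measurable]: "(\<lambda>\<omega>. X k \<omega> i) \<in> borel_measurable innov" if "k < m" "i \<in> I" for k i
    using X(2)[OF that] by simp
  define D where "D = (\<lambda>l k \<omega> i. cexp (\<tau> + int k - int l) (\<lambda>\<omega>. X k \<omega> i) \<omega> - cexp (\<tau> + int k - int l - 1) (\<lambda>\<omega>. X k \<omega> i) \<omega>)"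
  have S: "S \<ge> 0"
    using \<theta>(2)[of 0] by simp
  have Dm[measurable]: "(\<lambda>\<omega>. D l k \<omega> i) \<in> borel_measurable innov" if "k < m" "i \<in> I" for l k i
    unfolding D_def using that by measurable
  have DN: "moment_le innov p (\<lambda>\<omega>. N (\<lambda>k. D l k \<omega>)) (B * \<theta> l)" for l
  proof (rule N_mart[OF _ _ \<theta>(1)])
    have e: "\<tau> - int l + int k = \<tau> + int k - int l" for k
      by simp
    show "mart_diff (\<tau> - int l) m I (D l)"
      using mart_diff_projection[of m I X "\<tau> - int l"] X(2) by (simp add: D_def e)
    show "moment_le innov p (\<lambda>\<omega>. L2_set (D l k \<omega>) I) (\<theta> l)" if "k < m" for k
      unfolding D_def using X(2) that dep[OF that, of l] \<theta>(1)
      by (intro moment_le_projection[OF I p]) (auto simp: coupling_le_def)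
  qed
  define f where "f = (\<lambda>L \<omega>. N (\<lambda>k i. \<Sum>l<L. D l k \<omega> i))"
  have N0: "N (\<lambda>k i. 0) = 0"
    using N_le[of "\<lambda>k i. 0"] N_nonneg[of "\<lambda>k i. 0"] by simp
  have N_sum: "N (\<lambda>k i. \<Sum>l<L. x l k i) \<le> (\<Sum>l<L. N (x l))" for x and L :: nat
  proof (induction L)
    case (Suc L)
    then show ?case
      using N_add[of "\<lambda>k i. \<Sum>l<L. x l k i" "x L"] by simp
  qed (simp add: N0)
  have fm: "f L \<in> borel_measurable innov" for L
    unfolding f_def[abs_def] by (intro N_meas borel_measurable_sum) measurable
  have NXm: "(\<lambda>\<omega>. N (\<lambda>k. X k \<omega>)) \<in> borel_measurable innov"
    by (intro N_meas) measurable
  have fL: "moment_le innov p (f L) (B * S)" for L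
  proof (rule moment_le_mono[OF moment_le_sum[of "{..<L}" p innov "\<lambda>l \<omega>. N (\<lambda>k. D l k \<omega>)" "\<lambda>l. B * \<theta> l"]])
    show "AE \<omega> in innov. \<bar>f L \<omega>\<bar> \<le> \<bar>\<Sum>l<L. N (\<lambda>k. D l k \<omega>)\<bar>"
      unfolding f_def using N_sum N_nonneg by (intro AE_I2) (simp add: sum_nonneg)
    show "(\<Sum>l<L. B * \<theta> l) \<le> B * S"
      unfolding sum_distrib_left[symmetric] using B \<theta>(2) by (intro mult_left_mono)
  qed (use p fm B \<theta> DN in \<open>auto intro!: sum_nonneg\<close>)
  \<comment> \<open>What the first \<open>L\<close> lags leave of \<open>X\<close>: its forecast
    from times at least \<open>L\<close> steps back. It tends to 0 in L1 because the means
    vanish.\<close>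
  define r where "r = (\<lambda>L \<omega>. \<Sum>k<m. \<Sum>i\<in>I. \<bar>cexp (\<tau> + int k - int L) (\<lambda>\<omega>. X k \<omega> i) \<omega>\<bar>)"
  have fX: "\<bar>f L \<omega> - N (\<lambda>k. X k \<omega>)\<bar> \<le> r L \<omega>" for L \<omega>
  proof -
    define x where "x = (\<lambda>k i. \<Sum>l<L. D l k \<omega> i)"
    have diff: "(\<Sum>k<m. \<Sum>i\<in>I. \<bar>x k i - X k \<omega> i\<bar>) = r L \<omega>"
      unfolding r_def x_def D_def cexp_telescope
      using cexp_adapted[OF X(1)] by (intro sum.cong refl) simp
    have "N x \<le> N (\<lambda>k. X k \<omega>) + N (\<lambda>k i. x k i - X k \<omega> i)"
      using N_add[of "\<lambda>k. X k \<omega>" "\<lambda>k i. x k i - X k \<omega> i"] by simp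
    moreover have "N (\<lambda>k. X k \<omega>) \<le> N x + N (\<lambda>k i. X k \<omega> i - x k i)"
      using N_add[of x "\<lambda>k i. X k \<omega> i - x k i"] by simp
    moreover have "N (\<lambda>k i. x k i - X k \<omega> i) \<le> r L \<omega>" "N (\<lambda>k i. X k \<omega> i - x k i) \<le> r L \<omega>"
      using N_le[of "\<lambda>k i. x k i - X k \<omega> i"] N_le[of "\<lambda>k i. X k \<omega> i - x k i"]
      by (simp_all add: diff abs_minus_commute)
    ultimately have "N x \<le> N (\<lambda>k. X k \<omega>) + r L \<omega>" "N (\<lambda>k. X k \<omega>) \<le> N x + r L \<omega>"
      by linarith+
    then show ?thesis
      by (simp add: f_def x_def[symmetric] abs_le_iff)
  qed
  have ir: "integrable innov (r L)" for L
    unfolding r_def[abs_def] using X(2) integrable_cexp by (intro Bochner_Integration.integrable_sum integrable_abs) auto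
  have i: "integrable innov (\<lambda>\<omega>. f L \<omega> - N (\<lambda>k. X k \<omega>))" for L
    using fm NXm order_trans[OF fX abs_ge_self]
    by (intro Bochner_Integration.integrable_bound[OF ir[of L]] borel_measurable_diff AE_I2) simp_all
  have "(\<lambda>L. \<integral>\<omega>. r L \<omega> \<partial>innov) = (\<lambda>L. \<Sum>k<m. \<Sum>i\<in>I. \<integral>\<omega>. \<bar>cexp (\<tau> + int k - int L) (\<lambda>\<omega>. X k \<omega> i) \<omega>\<bar> \<partial>innov)"
    unfolding r_def using X(2) integrable_cexp by (simp add: Bochner_Integration.integral_sum)
  moreover have "\<dots> \<longlonglongrightarrow> (\<Sum>k<m. \<Sum>i\<in>I. 0)"
    using X(2,3) by (intro tendsto_sum cexp_L1_tendsto_0) auto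
  ultimately have r0: "(\<lambda>L. \<integral>\<omega>. r L \<omega> \<partial>innov) \<longlonglongrightarrow> 0"
    by simp
  have "(\<lambda>L. \<integral>\<omega>. \<bar>f L \<omega> - N (\<lambda>k. X k \<omega>)\<bar> \<partial>innov) \<longlonglongrightarrow> 0"
  proof (rule Lim_null_comparison[OF _ r0])
    show "\<forall>\<^sub>F L in sequentially. norm (\<integral>\<omega>. \<bar>f L \<omega> - N (\<lambda>k. X k \<omega>)\<bar> \<partial>innov) \<le> (\<integral>\<omega>. r L \<omega> \<partial>innov)"
      using i ir fX by (intro always_eventually allI) (simp, intro integral_mono, auto)
  qed
  then show ?thesis
    by (intro moment_le_limit[OF fL p(1) NXm i])
qed

lemma L2_set_sum_abs_le:
  "L2_set (\<lambda>i. \<Sum>j<n. x j i) I \<le> (\<Sum>k<m. \<Sum>i\<in>I. \<bar>x k i\<bar>)" if "n \<le> m" for x :: "nat \<Rightarrow> 'i \<Rightarrow> real"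
proof -
  have "L2_set (\<lambda>i. \<Sum>j<n. x j i) I \<le> (\<Sum>i\<in>I. \<bar>\<Sum>j<n. x j i\<bar>)"
    by (rule L2_set_le_sum_abs)
  also have "\<dots> \<le> (\<Sum>i\<in>I. \<Sum>j<m. \<bar>x j i\<bar>)"
    using that by (intro sum_mono order_trans[OF sum_abs] sum_mono2) auto
  also have "\<dots> = (\<Sum>k<m. \<Sum>i\<in>I. \<bar>x k i\<bar>)"
    by (rule sum.swap)
  finally show ?thesis .
qed

lemma L2_set_sum_add_le:
  "L2_set (\<lambda>i. \<Sum>j<n. x j i + y j i) I \<le> L2_set (\<lambda>i. \<Sum>j<n. x j i) I + L2_set (\<lambda>i. \<Sum>j<n. y j i) I"
  using L2_set_triangle_ineq[of "\<lambda>i. \<Sum>j<n. x j i" "\<lambda>i. \<Sum>j<n. y j i" I] by (simp add: sum.distrib)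

lemma dependent_sum_moment4:
  fixes X :: "nat \<Rightarrow> (int \<Rightarrow> real) \<Rightarrow> 'i \<Rightarrow> real"
  assumes I: "finite I"
    and X: "\<And>k i. k < m \<Longrightarrow> i \<in> I \<Longrightarrow> adapted (\<tau> + int k) (\<lambda>\<omega>. X k \<omega> i)"
      "\<And>k i. k < m \<Longrightarrow> i \<in> I \<Longrightarrow> integrable innov (\<lambda>\<omega>. X k \<omega> i)"
      "\<And>k i. k < m \<Longrightarrow> i \<in> I \<Longrightarrow> (\<integral>\<omega>. X k \<omega> i \<partial>innov) = 0"
    and dep: "\<And>k l. k < m \<Longrightarrow> coupling_le 4 I (X k) (\<tau> + int k - int l) (\<theta> l)"
    and \<theta>: "\<And>l. \<theta> l \<ge> 0" "\<And>L. (\<Sum>l<L. \<theta> l) \<le> S"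
  shows "moment_le innov 4 (\<lambda>\<omega>. L2_set (\<lambda>i. \<Sum>k<m. X k \<omega> i) I) (2 * sqrt m * S)"
proof (rule dependent_seminorm_moment[OF I _ _ _ X dep \<theta>, where N="\<lambda>x. L2_set (\<lambda>i. \<Sum>k<m. x k i) I"])
  fix D :: "nat \<Rightarrow> (int \<Rightarrow> real) \<Rightarrow> 'i \<Rightarrow> real" and a c
  assume "mart_diff a m I D" "\<And>k. k < m \<Longrightarrow> moment_le innov 4 (\<lambda>\<omega>. L2_set (D k \<omega>) I) c" "c \<ge> 0"
  then show "moment_le innov 4 (\<lambda>\<omega>. L2_set (\<lambda>i. \<Sum>k<m. D k \<omega> i) I) (2 * sqrt m * c)"
    using mart_diff_moment4[OF _ I order_refl, of a m D "\<lambda>_. c"] by (simp add: real_sqrt_mult mult.assoc)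
qed (auto intro: L2_set_sum_add_le L2_set_sum_abs_le intro!: borel_measurable_L2_set borel_measurable_sum)

lemma dependent_max_moment2:
  fixes X :: "nat \<Rightarrow> (int \<Rightarrow> real) \<Rightarrow> 'i \<Rightarrow> real"
  assumes I: "finite I"
    and X: "\<And>k i. k < m \<Longrightarrow> i \<in> I \<Longrightarrow> adapted (\<tau> + int k) (\<lambda>\<omega>. X k \<omega> i)"
      "\<And>k i. k < m \<Longrightarrow> i \<in> I \<Longrightarrow> integrable innov (\<lambda>\<omega>. X k \<omega> i)"
      "\<And>k i. k < m \<Longrightarrow> i \<in> I \<Longrightarrow> (\<integral>\<omega>. X k \<omega> i \<partial>innov) = 0"
    and dep: "\<And>k l. k < m \<Longrightarrow> coupling_le 2 I (X k) (\<tau> + int k - int l) (\<theta> l)"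
    and \<theta>: "\<And>l. \<theta> l \<ge> 0" "\<And>L. (\<Sum>l<L. \<theta> l) \<le> S"
  shows "moment_le innov 2 (\<lambda>\<omega>. Max ((\<lambda>n. L2_set (\<lambda>i. \<Sum>k<n. X k \<omega> i) I) ` {..m})) (2 * sqrt m * S)"
proof (rule dependent_seminorm_moment[OF I _ _ _ X dep \<theta>, where N="\<lambda>x. Max ((\<lambda>n. L2_set (\<lambda>i. \<Sum>k<n. x k i) I) ` {..m})"])
  fix D :: "nat \<Rightarrow> (int \<Rightarrow> real) \<Rightarrow> 'i \<Rightarrow> real" and a c
  assume "mart_diff a m I D" "\<And>k. k < m \<Longrightarrow> moment_le innov 2 (\<lambda>\<omega>. L2_set (D k \<omega>) I) c" "c \<ge> 0"
  then show "moment_le innov 2 (\<lambda>\<omega>. Max ((\<lambda>n. L2_set (\<lambda>i. \<Sum>k<n. D k \<omega> i) I) ` {..m})) (2 * sqrt m * c)"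
    using mart_diff_Doob[OF _ I, of a m D "\<lambda>_. c"] by (simp add: real_sqrt_mult mult.assoc)
next
  fix Y :: "nat \<Rightarrow> (int \<Rightarrow> real) \<Rightarrow> 'i \<Rightarrow> real"
  assume "\<And>k i. k < m \<Longrightarrow> i \<in> I \<Longrightarrow> (\<lambda>\<omega>. Y k \<omega> i) \<in> borel_measurable innov"
  then show "(\<lambda>\<omega>. Max ((\<lambda>n. L2_set (\<lambda>i. \<Sum>k<n. Y k \<omega> i) I) ` {..m})) \<in> borel_measurable innov"
    by (intro borel_measurable_Max borel_measurable_L2_set borel_measurable_sum) auto
next
  fix x y :: "nat \<Rightarrow> 'i \<Rightarrow> real"
  show "Max ((\<lambda>n. L2_set (\<lambda>i. \<Sum>k<n. x k i + y k i) I) ` {..m})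
    \<le> Max ((\<lambda>n. L2_set (\<lambda>i. \<Sum>k<n. x k i) I) ` {..m}) + Max ((\<lambda>n. L2_set (\<lambda>i. \<Sum>k<n. y k i) I) ` {..m})"
    by (intro Max.boundedI) (auto intro!: order_trans[OF L2_set_sum_add_le] add_mono Max_ge)
  show "0 \<le> Max ((\<lambda>n. L2_set (\<lambda>i. \<Sum>k<n. x k i) I) ` {..m})"
  proof (rule order_trans[OF L2_set_nonneg Max_ge])
    show "L2_set (\<lambda>i. \<Sum>k<m. x k i) I \<in> (\<lambda>n. L2_set (\<lambda>i. \<Sum>k<n. x k i) I) ` {..m}"
      by auto
  qed auto
  show "Max ((\<lambda>n. L2_set (\<lambda>i. \<Sum>k<n. x k i) I) ` {..m}) \<le> (\<Sum>k<m. \<Sum>i\<in>I. \<bar>x k i\<bar>)"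
    by (intro Max.boundedI) (auto intro!: L2_set_sum_abs_le)
qed auto

text \<open>The forecast at time \<open>s\<close> is the sum of the projections onto the innovations
  up to \<open>s\<close>. They are orthogonal, so squares of the coupling bounds add up, a half
  power better than adding the bounds.\<close>

lemma cexp_decay:
  fixes F :: "(int \<Rightarrow> real) \<Rightarrow> 'i \<Rightarrow> real"
  assumes I: "finite I"
    and F: "\<And>i. i \<in> I \<Longrightarrow> integrable innov (\<lambda>\<omega>. F \<omega> i)" "\<And>i. i \<in> I \<Longrightarrow> (\<integral>\<omega>. F \<omega> i \<partial>innov) = 0"
    and dep: "\<And>l. coupling_le 2 I F (s - int l) (\<gamma> l)"
    and \<gamma>: "\<And>l. \<gamma> l \<ge> 0" "\<And>L. (\<Sum>l<L. (\<gamma> l)\<^sup>2) \<le> R\<^sup>2" and R: "R \<ge> 0"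
  shows "moment_le innov 2 (\<lambda>\<omega>. L2_set (\<lambda>i. cexp s (\<lambda>\<omega>. F \<omega> i) \<omega>) I) R"
proof -
  have [measurable]: "(\<lambda>\<omega>. F \<omega> i) \<in> borel_measurable innov" if "i \<in> I" for i
    using F(1)[OF that] by simp
  define f where "f = (\<lambda>L \<omega>. L2_set (\<lambda>i. cexp s (\<lambda>\<omega>. F \<omega> i) \<omega> - cexp (s - int L) (\<lambda>\<omega>. F \<omega> i) \<omega>) I)"
  have fm: "f L \<in> borel_measurable innov" for L
    unfolding f_def[abs_def] by (intro borel_measurable_L2_set) measurable
  have gm: "(\<lambda>\<omega>. L2_set (\<lambda>i. cexp s (\<lambda>\<omega>. F \<omega> i) \<omega>) I) \<in> borel_measurable innov"
    by (intro borel_measurable_L2_set) measurable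
  have fL: "moment_le innov 2 (f L) R" for L
  proof -
    \<comment> \<open>The differences run forward in time and end at \<open>s\<close>, so step
      \<open>k\<close> corresponds to lag \<open>L - 1 - k\<close>.\<close>
    define a where "a = s - int L + 1"
    define D where "D = (\<lambda>(k::nat) \<omega> i. cexp (a + int k) (\<lambda>\<omega>. F \<omega> i) \<omega> - cexp (a + int k - 1) (\<lambda>\<omega>. F \<omega> i) \<omega>)"
    have D: "mart_diff a L I D"
      unfolding D_def using F(1) by (intro mart_diff_projection[of L I "\<lambda>_. F"])
    have "moment_le innov 2 (\<lambda>\<omega>. L2_set (D k \<omega>) I) (\<gamma> (L - 1 - k))" if k: "k < L" for k
    proof -
      have "a + int k = s - int (L - 1 - k)"
        using k by (simp add: a_def of_nat_diff)
      then show ?thesis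
        unfolding D_def using F(1) dep[of "L - 1 - k"] \<gamma>(1)
        by (intro moment_le_projection[OF I]) (auto simp: coupling_le_def)
    qed
    then have "moment_le innov 2 (\<lambda>\<omega>. L2_set (\<lambda>i. \<Sum>k<L. D k \<omega> i) I) (sqrt (\<Sum>k<L. (\<gamma> (L - 1 - k))\<^sup>2))"
      using mart_diff_moment2[OF D I order_refl, of "\<lambda>k. \<gamma> (L - 1 - k)"] \<gamma>(1) by simp
    moreover have "(\<Sum>k<L. D k \<omega> i) = cexp s (\<lambda>\<omega>. F \<omega> i) \<omega> - cexp (s - int L) (\<lambda>\<omega>. F \<omega> i) \<omega>" for \<omega> i
    proof -
      have "(\<Sum>k<L. D k \<omega> i) = (\<Sum>l<L. D (L - Suc l) \<omega> i)"
        by (rule sum.nat_diff_reindex[symmetric])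
      also have "\<dots> = (\<Sum>l<L. cexp (s - int l) (\<lambda>\<omega>. F \<omega> i) \<omega> - cexp (s - int l - 1) (\<lambda>\<omega>. F \<omega> i) \<omega>)"
        by (intro sum.cong refl) (auto simp: D_def a_def of_nat_diff algebra_simps)
      finally show ?thesis
        by (simp add: cexp_telescope)
    qed
    ultimately have "moment_le innov 2 (f L) (sqrt (\<Sum>k<L. (\<gamma> (L - 1 - k))\<^sup>2))"
      by (simp add: f_def)
    moreover have "(\<Sum>k<L. (\<gamma> (L - 1 - k))\<^sup>2) = (\<Sum>k<L. (\<gamma> k)\<^sup>2)"
      using sum.nat_diff_reindex[of "\<lambda>k. (\<gamma> k)\<^sup>2" L] by simp
    ultimately show ?thesis
      using fm[of L] \<gamma>(2)[of L] R
      by (elim moment_le_mono) (auto simp: sum_nonneg real_le_rsqrt intro!: real_le_lsqrt)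
  qed
  define r where "r = (\<lambda>L \<omega>. \<Sum>i\<in>I. \<bar>cexp (s - int L) (\<lambda>\<omega>. F \<omega> i) \<omega>\<bar>)"
  have fX: "\<bar>f L \<omega> - L2_set (\<lambda>i. cexp s (\<lambda>\<omega>. F \<omega> i) \<omega>) I\<bar> \<le> r L \<omega>" for L \<omega>
  proof -
    define x where "x = (\<lambda>i. cexp s (\<lambda>\<omega>. F \<omega> i) \<omega>)"
    define y where "y = (\<lambda>i. cexp (s - int L) (\<lambda>\<omega>. F \<omega> i) \<omega>)"
    have "L2_set (\<lambda>i. x i - y i) I \<le> L2_set x I + L2_set y I"
      using L2_set_triangle_ineq[of x "\<lambda>i. - y i" I] by (simp add: L2_set_def)
    moreover have "L2_set x I \<le> L2_set (\<lambda>i. x i - y i) I + L2_set y I"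
      using L2_set_triangle_ineq[of "\<lambda>i. x i - y i" y I] by simp
    moreover have "L2_set y I \<le> r L \<omega>"
      unfolding y_def r_def by (rule L2_set_le_sum_abs)
    ultimately show ?thesis
      by (simp add: f_def x_def y_def abs_le_iff)
  qed
  have ir: "integrable innov (r L)" for L
    unfolding r_def[abs_def] using F(1) integrable_cexp by (intro Bochner_Integration.integrable_sum integrable_abs) auto
  have i: "integrable innov (\<lambda>\<omega>. f L \<omega> - L2_set (\<lambda>i. cexp s (\<lambda>\<omega>. F \<omega> i) \<omega>) I)" for L
    using fm gm order_trans[OF fX abs_ge_self]
    by (intro Bochner_Integration.integrable_bound[OF ir[of L]] borel_measurable_diff AE_I2) simp_all
  have "(\<lambda>L. \<integral>\<omega>. r L \<omega> \<partial>innov) = (\<lambda>L. \<Sum>i\<in>I. \<integral>\<omega>. \<bar>cexp (s - int L) (\<lambda>\<omega>. F \<omega> i) \<omega>\<bar> \<partial>innov)"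
    unfolding r_def using F(1) integrable_cexp by (simp add: Bochner_Integration.integral_sum)
  moreover have "\<dots> \<longlonglongrightarrow> (\<Sum>i\<in>I. 0)"
    using F by (intro tendsto_sum cexp_L1_tendsto_0) auto
  ultimately have r0: "(\<lambda>L. \<integral>\<omega>. r L \<omega> \<partial>innov) \<longlonglongrightarrow> 0"
    by simp
  have "(\<lambda>L. \<integral>\<omega>. \<bar>f L \<omega> - L2_set (\<lambda>i. cexp s (\<lambda>\<omega>. F \<omega> i) \<omega>) I\<bar> \<partial>innov) \<longlonglongrightarrow> 0"
  proof (rule Lim_null_comparison[OF _ r0])
    show "\<forall>\<^sub>F L in sequentially. norm (\<integral>\<omega>. \<bar>f L \<omega> - L2_set (\<lambda>i. cexp s (\<lambda>\<omega>. F \<omega> i) \<omega>) I\<bar> \<partial>innov) \<le> (\<integral>\<omega>. r L \<omega> \<partial>innov)"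
      using i ir fX by (intro always_eventually allI) (simp, intro integral_mono, auto)
  qed
  then show ?thesis
    by (intro moment_le_limit[OF fL _ gm i]) auto
qed

section \<open>Elementary sums\<close>

lemma sqrt_2_le: "sqrt 2 \<le> 3 / 2"
  by (intro real_le_lsqrt) (auto simp: power2_eq_square)

text \<open>Telescoping: \<open>1 / x\<^sup>2 \<le> 2 / x - 2 / (x + 1)\<close> for
  \<open>x \<ge> 1\<close>.\<close>

lemma sum_inverse_squares_le:
  assumes "h \<ge> 1"
  shows "(\<Sum>l<L. 1 / (real (h + l))\<^sup>2) \<le> 2 / real h"
proof -
  have "(\<Sum>l<L. 1 / (real (h + l))\<^sup>2) \<le> 2 / real h - 2 / real (h + L)"
  proof (induction L)
    case (Suc L)
    define x where "x = real (h + L)"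
    have x: "x \<ge> 1"
      using assms by (simp add: x_def)
    have "1 / x\<^sup>2 \<le> 2 / x - 2 / (x + 1)"
    proof -
      have "1 / x\<^sup>2 = 2 / (2 * x\<^sup>2)"
        by simp
      also have "\<dots> \<le> 2 / (x * (x + 1))"
        using x mult_left_mono[of 1 x x] by (intro divide_left_mono mult_pos_pos) (auto simp: power2_eq_square algebra_simps)
      also have "\<dots> = 2 / x - 2 / (x + 1)"
        using x by (simp add: field_simps)
      finally show ?thesis .
    qed
    then show ?case
      using Suc by (simp add: x_def add.commute add.left_commute)
  qed simp
  then show ?thesis
    using divide_nonneg_nonneg[of 2 "real (h + L)"] by linarith
qed

section \<open>Reordering the estimator by time and lag\<close>

lemma sum_swap4:
  "(\<Sum>i\<in>A. \<Sum>j\<in>B. \<Sum>s\<in>C. \<Sum>r\<in>D. f i j s r) = (\<Sum>s\<in>C. \<Sum>r\<in>D. \<Sum>i\<in>A. \<Sum>j\<in>B. f i j s r)"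
proof -
  have "(\<Sum>i\<in>A. \<Sum>j\<in>B. \<Sum>s\<in>C. \<Sum>r\<in>D. f i j s r) = (\<Sum>i\<in>A. \<Sum>s\<in>C. \<Sum>j\<in>B. \<Sum>r\<in>D. f i j s r)"
    by (rule sum.cong[OF refl], rule sum.swap)
  also have "\<dots> = (\<Sum>s\<in>C. \<Sum>i\<in>A. \<Sum>j\<in>B. \<Sum>r\<in>D. f i j s r)"
    by (rule sum.swap)
  also have "\<dots> = (\<Sum>s\<in>C. \<Sum>i\<in>A. \<Sum>r\<in>D. \<Sum>j\<in>B. f i j s r)"
    by (rule sum.cong[OF refl], rule sum.cong[OF refl], rule sum.swap)
  also have "\<dots> = (\<Sum>s\<in>C. \<Sum>r\<in>D. \<Sum>i\<in>A. \<Sum>j\<in>B. f i j s r)"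
    by (rule sum.cong[OF refl], rule sum.swap)
  finally show ?thesis .
qed

text \<open>Each off-diagonal pair is charged to its larger index \<open>r\<close> and its lag
  \<open>h\<close>; both orders are kept because \<open>g\<close> need not be symmetric.\<close>

lemma sum_symmetric_square:
  fixes g :: "nat \<Rightarrow> nat \<Rightarrow> real"
  shows "(\<Sum>s=1..k. \<Sum>r=1..k. g s r) =
    (\<Sum>r=1..k. \<Sum>h<r. if h = 0 then g r r else g (r - h) r + g r (r - h))"
proof (induction k)
  case (Suc k)
  have "(\<Sum>h<Suc k. if h = 0 then g (Suc k) (Suc k) else g (Suc k - h) (Suc k) + g (Suc k) (Suc k - h)) =
      g (Suc k) (Suc k) + (\<Sum>h<k. g (k - h) (Suc k) + g (Suc k) (k - h))"
    by (subst sum.lessThan_Suc_shift) simp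
  also have "(\<Sum>h<k. g (k - h) (Suc k) + g (Suc k) (k - h)) = (\<Sum>s=1..k. g s (Suc k) + g (Suc k) s)"
    by (rule sum.reindex_bij_witness[of _ "\<lambda>s. k - s" "\<lambda>h. k - h"]) auto
  finally show ?case
    using Suc by (simp add: sum.distrib)
qed simp

text \<open>For \<open>h < r\<close>, the number of windows, ending at a time in
  \<open>{b..k}\<close>, that contain both \<open>r - h\<close> and \<open>r\<close>.\<close>

definition overlap :: "nat \<Rightarrow> nat \<Rightarrow> nat \<Rightarrow> nat \<Rightarrow> nat" where
  "overlap b k r h = card {t \<in> {b..k}. r \<le> t \<and> t < r - h + b}"

lemma window_sum_eq:
  fixes f :: "nat \<Rightarrow> nat \<Rightarrow> real"
  assumes "b \<ge> 1"
  shows "(\<Sum>t=b..k. \<Sum>s=t-b+1..t. \<Sum>r=t-b+1..t. f s r) =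
    (\<Sum>r=1..k. \<Sum>h<r. real (overlap b k r h) * (if h = 0 then f r r else f (r - h) r + f r (r - h)))"
proof -
  define c where "c = (\<lambda>s r. card {t \<in> {b..k}. s \<in> {t-b+1..t} \<and> r \<in> {t-b+1..t}})"
  have "(\<Sum>t=b..k. \<Sum>s=t-b+1..t. \<Sum>r=t-b+1..t. f s r) =
    (\<Sum>t=b..k. \<Sum>s=1..k. \<Sum>r=1..k. if s \<in> {t-b+1..t} \<and> r \<in> {t-b+1..t} then f s r else 0)"
  proof (rule sum.cong[OF refl])
    fix t assume t: "t \<in> {b..k}"
    have sub: "{t-b+1..t} \<inter> {1..k} = {t-b+1..t}"
      using t by auto
    have "(\<Sum>s=1..k. \<Sum>r=1..k. if s \<in> {t-b+1..t} \<and> r \<in> {t-b+1..t} then f s r else 0) =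
      (\<Sum>s=1..k. if s \<in> {t-b+1..t} then (\<Sum>r=1..k. if r \<in> {t-b+1..t} then f s r else 0) else 0)"
      by (intro sum.cong refl) auto
    also have "\<dots> = (\<Sum>s=t-b+1..t. \<Sum>r=t-b+1..t. f s r)"
      using sub by (simp only: sum.inter_restrict[symmetric] finite_atLeastAtMost Int_commute)
    finally show "(\<Sum>s=t-b+1..t. \<Sum>r=t-b+1..t. f s r) =
      (\<Sum>s=1..k. \<Sum>r=1..k. if s \<in> {t-b+1..t} \<and> r \<in> {t-b+1..t} then f s r else 0)" ..
  qed
  also have "\<dots> = (\<Sum>s=1..k. \<Sum>r=1..k. \<Sum>t=b..k. if s \<in> {t-b+1..t} \<and> r \<in> {t-b+1..t} then f s r else 0)"
    by (subst sum.swap, rule sum.cong[OF refl], rule sum.swap)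
  also have "\<dots> = (\<Sum>s=1..k. \<Sum>r=1..k. real (c s r) * f s r)"
    by (intro sum.cong refl) (simp add: c_def flip: sum.inter_filter)
  also have "\<dots> = (\<Sum>r=1..k. \<Sum>h<r. if h = 0 then real (c r r) * f r r
      else real (c (r - h) r) * f (r - h) r + real (c r (r - h)) * f r (r - h))"
    by (rule sum_symmetric_square)
  also have "\<dots> = (\<Sum>r=1..k. \<Sum>h<r. real (overlap b k r h) * (if h = 0 then f r r else f (r - h) r + f r (r - h)))"
  proof (intro sum.cong refl)
    fix r h assume "r \<in> {1..k}" "h \<in> {..<r}"
    then have "c (r - h) r = overlap b k r h"
      unfolding c_def overlap_def using assms by (intro arg_cong[of _ _ card]) auto
    moreover have "c r (r - h) = c (r - h) r"
      unfolding c_def by (intro arg_cong[of _ _ card]) auto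
    ultimately show "(if h = 0 then real (c r r) * f r r
      else real (c (r - h) r) * f (r - h) r + real (c r (r - h)) * f r (r - h)) =
      real (overlap b k r h) * (if h = 0 then f r r else f (r - h) r + f r (r - h))"
      by (auto simp: distrib_left)
  qed
  finally show ?thesis .
qed


lemma overlap_le:
  assumes "h < r"
  shows "overlap b k r h \<le> b - h"
proof -
  have "overlap b k r h \<le> card {r..<r - h + b}"
    unfolding overlap_def by (intro card_mono) auto
  also have "\<dots> = b - h"
    using assms by simp
  finally show ?thesis .
qed

lemma overlap_eq:
  assumes "h < r" "b \<le> r" "r + b \<le> k + 1"
  shows "overlap b k r h = b - h"
proof -
  have "{t \<in> {b..k}. r \<le> t \<and> t < r - h + b} = {r..<r - h + b}"
    using assms by auto
  then show ?thesis
    using assms by (simp add: overlap_def)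
qed

text \<open>The weight of lag \<open>h\<close> at time \<open>r\<close> in \<open>Qhat\<close>, against its weight \<open>1\<close> in the long-run
  covariance.\<close>

definition lag_weight :: "nat \<Rightarrow> nat \<Rightarrow> nat \<Rightarrow> nat \<Rightarrow> real" where
  "lag_weight b k r h = (if h < r then real (overlap b k r h) / real b else 0)"

text \<open>The exponent 5/4 lies strictly between 1, for summability, and 3/2, the decay guaranteed
  by \<beta> > 2. The power left over absorbs what would be a logarithm at critical values of
  \<beta>.\<close>

definition decay :: "nat \<Rightarrow> real" where
  "decay h = (if h = 0 then 1 else real h powr (- 5 / 4))"

lemma decay_nonneg: "decay h \<ge> 0"
  by (simp add: decay_def)

lemma summable_decay: "summable decay"
proof -
  have "summable (\<lambda>h. real h powr (- 5 / 4))"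
    by (simp add: summable_real_powr_iff)
  moreover have "decay h = real h powr (- 5 / 4)" if "h \<ge> 1" for h
    using that by (simp add: decay_def)
  ultimately show ?thesis
    by (subst summable_cong[OF eventually_sequentiallyI[of 1]])
qed

text \<open>An absolute number, as \<open>decay\<close> does not involve \<beta>; the final constant
  \<open>72 + 6 * decay_sum\<close> is uniform in \<beta> and q.\<close>

definition decay_sum :: real where
  "decay_sum = (\<Sum>h. decay h)"

lemma decay_sum_ge_1: "decay_sum \<ge> 1"
proof -
  have "decay 0 \<le> suminf decay"
    using sum_le_suminf[OF summable_decay, of "{0}"] decay_nonneg by simp
  moreover have "decay 0 = 1"
    by (simp add: decay_def)
  ultimately show ?thesis
    by (simp add: decay_sum_def)
qed

lemma lag_weight_bounds: "0 \<le> lag_weight b k r h" "lag_weight b k r h \<le> 1"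
proof -
  show "0 \<le> lag_weight b k r h"
    by (simp add: lag_weight_def)
  show "lag_weight b k r h \<le> 1"
    using overlap_le[of h r b k, THEN le_trans, OF _ diff_le_self]
    by (auto simp: lag_weight_def divide_le_eq_1)
qed

lemma lag_weight_eq_0: "h \<ge> b \<Longrightarrow> lag_weight b k r h = 0"
  using overlap_le[of h r b k] by (simp add: lag_weight_def)

text \<open>Away from the boundary the weight is \<open>1 - h / b\<close> for \<open>h < b\<close>
  and 0 beyond. In the first range \<open>h powr (3/2 - \<beta>)\<close> is
  \<open>h powr (-5/4)\<close> times a factor at most \<open>1 + b powr (3 - \<beta>)\<close>, and
  dividing by \<open>b\<close> gives both rates. In the second,
  \<open>h powr (7/4 - \<beta>)\<close> is at most its value at \<open>b\<close>. At the boundary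
  the defect is bounded by 1.\<close>

lemma lag_weight_defect:
  assumes b: "b \<ge> 1" and \<beta>: "\<beta> > 2"
  shows "\<bar>lag_weight b k r h - 1\<bar> * (if h = 0 then 1 else real h powr (1 / 2 - \<beta>)) \<le>
    decay h * ((1 / real b + real b powr (2 - \<beta>)) + (if r < b \<or> k + 1 < r + b then 1 else 0))"
proof -
  define \<kappa> where "\<kappa> = 1 / real b + real b powr (2 - \<beta>)"
  have \<kappa>: "\<kappa> \<ge> 0"
    by (simp add: \<kappa>_def)
  have le1: "\<bar>lag_weight b k r h - 1\<bar> \<le> 1"
    using lag_weight_bounds[of b k r h] by simp
  have dec: "(if h = 0 then 1 else real h powr (1 / 2 - \<beta>)) \<le> decay h"
    using \<beta> by (auto simp: decay_def intro!: powr_mono)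
  have pos: "(if h = 0 then 1 else real h powr (1 / 2 - \<beta>)) \<ge> 0"
    by simp
  show ?thesis
  proof (cases "r < b \<or> k + 1 < r + b")
    case True
    have "\<bar>lag_weight b k r h - 1\<bar> * (if h = 0 then 1 else real h powr (1 / 2 - \<beta>)) \<le> 1 * decay h"
      using le1 dec pos by (intro mult_mono) auto
    also have "\<dots> \<le> decay h * (\<kappa> + 1)"
      using \<kappa> decay_nonneg[of h] by (simp add: distrib_left)
    finally show ?thesis
      using True by (simp add: \<kappa>_def)
  next
    case False
    then have r: "b \<le> r" "r + b \<le> k + 1"
      by auto
    show ?thesis
    proof (cases "h < b")
      case h: True
      then have "lag_weight b k r h = real (b - h) / real b"
        using overlap_eq[of h r b k] r by (simp add: lag_weight_def)
      also have "\<dots> = 1 - real h / real b"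
        using h by (simp add: of_nat_diff field_simps)
      finally have lw: "\<bar>lag_weight b k r h - 1\<bar> = real h / real b"
        by simp
      show ?thesis
      proof (cases "h = 0")
        case True
        then show ?thesis
          using lw \<kappa> decay_nonneg[of h] False by (simp add: \<kappa>_def)
      next
        case False
        then have h1: "real h \<ge> 1" "real h \<le> real b"
          using h by auto
        have "real h * real h powr (1 / 2 - \<beta>) = real h powr (3 / 2 - \<beta>)"
          using h1 by (simp add: powr_mult_base)
        also have "\<dots> = real h powr (- 5 / 4) * real h powr (11 / 4 - \<beta>)"
          by (simp add: powr_add[symmetric])
        also have "\<dots> \<le> real h powr (- 5 / 4) * (1 + real b powr (3 - \<beta>))"
        proof (intro mult_left_mono)
          show "real h powr (11 / 4 - \<beta>) \<le> 1 + real b powr (3 - \<beta>)"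
          proof (cases "\<beta> \<ge> 11 / 4")
            case True
            then have "real h powr (11 / 4 - \<beta>) \<le> real h powr 0"
              using h1 by (intro powr_mono) auto
            then show ?thesis
              using h1 by (intro add_increasing2) auto
          next
            case False
            then have "real h powr (11 / 4 - \<beta>) \<le> real b powr (11 / 4 - \<beta>)"
              using h1 by (intro powr_mono2) auto
            also have "\<dots> \<le> real b powr (3 - \<beta>)"
              using h1 by (intro powr_mono) auto
            finally show ?thesis
              by simp
          qed
        qed simp
        finally have *: "real h * real h powr (1 / 2 - \<beta>) \<le> decay h * (1 + real b powr (3 - \<beta>))"
          using False by (simp add: decay_def)
        have "real b powr (3 - \<beta>) = real b * real b powr (2 - \<beta>)"
          using b by (simp add: powr_mult_base)
        then have \<kappa>b: "(1 + real b powr (3 - \<beta>)) / real b = \<kappa>"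
          using b by (simp add: \<kappa>_def field_simps)
        have "\<bar>lag_weight b k r h - 1\<bar> * real h powr (1 / 2 - \<beta>) = (real h * real h powr (1 / 2 - \<beta>)) / real b"
          by (simp add: lw)
        also have "\<dots> \<le> (decay h * (1 + real b powr (3 - \<beta>))) / real b"
          using * by (intro divide_right_mono) auto
        also have "\<dots> = decay h * \<kappa>"
          by (simp only: times_divide_eq_right[symmetric] \<kappa>b)
        finally show ?thesis
          using False \<open>\<not> (r < b \<or> k + 1 < r + b)\<close> by (simp add: \<kappa>_def)
      qed
    next
      case h: False
      then have h1: "real h \<ge> real b" "real b \<ge> 1" "h \<noteq> 0"
        using b by auto
      have lw: "\<bar>lag_weight b k r h - 1\<bar> = 1"
        using h lag_weight_eq_0[of b h k r] by simp
      have "real h powr (1 / 2 - \<beta>) = real h powr (- 5 / 4) * real h powr (7 / 4 - \<beta>)"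
        by (simp add: powr_add[symmetric])
      also have "\<dots> \<le> real h powr (- 5 / 4) * real b powr (7 / 4 - \<beta>)"
        using h1 \<beta> by (intro mult_left_mono powr_mono2') auto
      also have "\<dots> \<le> real h powr (- 5 / 4) * real b powr (2 - \<beta>)"
        using h1 by (intro mult_left_mono powr_mono) auto
      also have "\<dots> \<le> decay h * \<kappa>"
        using h1 by (simp add: decay_def \<kappa>_def mult_left_mono)
      finally show ?thesis
        using False h1 lw by (simp add: \<kappa>_def)
    qed
  qed
qed

text \<open>Telescoping: \<open>1 / x \<le> 2 * x - 2 * y\<close> when
  \<open>x\<^sup>2 = y\<^sup>2 + 1\<close>.\<close>

lemma sum_powr_half_le: "(\<Sum>h=1..<m. real h powr (- 1 / 2)) \<le> 2 * sqrt (real m)"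
proof -
  have "(\<Sum>h=1..<Suc m. real h powr (- 1 / 2)) \<le> 2 * sqrt (real m)" for m
  proof (induction m)
    case (Suc m)
    define x where "x = sqrt (real (Suc m))"
    define y where "y = sqrt (real m)"
    have x: "x > 0" "y \<ge> 0" "x\<^sup>2 = y\<^sup>2 + 1"
      by (auto simp: x_def y_def)
    have "real (Suc m) powr (- 1 / 2) = 1 / x"
      using powr_half_sqrt[of "real (Suc m)"] powr_minus_divide[of "real (Suc m)" "1 / 2"] by (simp add: x_def)
    also have "1 / x \<le> 2 * x - 2 * y"
    proof -
      have "0 \<le> (x - y)\<^sup>2"
        by simp
      then have "1 \<le> (2 * x - 2 * y) * x"
        using x(3) by (simp add: power2_eq_square algebra_simps)
      then show ?thesis
        using x by (simp add: divide_le_eq)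
    qed
    finally show ?case
      using Suc by (simp add: x_def y_def)
  qed simp
  from this[of "m - 1"] have "(\<Sum>h=1..<m. real h powr (- 1 / 2)) \<le> 2 * sqrt (real (m - 1))"
    by (cases m) auto
  also have "\<dots> \<le> 2 * sqrt (real m)"
    by simp
  finally show ?thesis .
qed

lemma L2_set_outer: "L2_set (\<lambda>(i, j). u i * v j) (A \<times> B) = L2_set u A * L2_set v B"
proof -
  have "(\<Sum>p\<in>A \<times> B. (case p of (i, j) \<Rightarrow> u i * v j)\<^sup>2) = (\<Sum>i\<in>A. (u i)\<^sup>2) * (\<Sum>j\<in>B. (v j)\<^sup>2)"
    by (simp add: sum_product sum.cartesian_product power_mult_distrib case_prod_unfold)
  then show ?thesis
    by (simp add: L2_set_def real_sqrt_mult)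
qed

section \<open>The window estimator on the space of innovations\<close>

lemma distr_coupling: "distr (innov \<Otimes>\<^sub>M innov) innov (\<lambda>z. (fst z)(j := snd z j)) = innov"
proof -
  have "(\<lambda>z. (fst z)(j := snd z j)) = (\<lambda>z. mix (- {j}) (fst z) (snd z :: int \<Rightarrow> real))"
    by (auto simp: mix_def fun_eq_iff)
  then show ?thesis
    by (simp add: distr_mix)
qed

lemma measurable_coupling: "(\<lambda>z. (fst z)(j := snd z j)) \<in> measurable (innov \<Otimes>\<^sub>M innov) innov"
  by (rule measurable_innovI) (simp add: fun_upd_def)

lemma prob_space_innov2: "prob_space (innov \<Otimes>\<^sub>M innov)"
  by (rule innov2.prob_space_axioms)

text \<open>Bilinear forms of operator norm at most 1. Orthogonal matrices and matrix units are both
  of this kind, so one set of estimates covers the trace norm and the convergence of single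
  entries.\<close>

definition contractive :: "nat \<Rightarrow> (nat \<Rightarrow> nat \<Rightarrow> real) \<Rightarrow> bool" where
  "contractive d w \<longleftrightarrow> (\<forall>u v. \<bar>\<Sum>i<d. \<Sum>j<d. w i j * (u i * v j)\<bar> \<le> eucl_norm d u * eucl_norm d v)"

text \<open>The inner product of \<open>w\<close> with the matrix of mixed second moments of
  \<open>A\<close> and \<open>B\<close>.\<close>

definition cross :: "nat \<Rightarrow> (nat \<Rightarrow> nat \<Rightarrow> real) \<Rightarrow> ((int \<Rightarrow> real) \<Rightarrow> nat \<Rightarrow> real) \<Rightarrow>
    ((int \<Rightarrow> real) \<Rightarrow> nat \<Rightarrow> real) \<Rightarrow> real" where
  "cross d w A B = (\<integral>\<eta>. (\<Sum>i<d. \<Sum>j<d. w i j * (A \<eta> i * B \<eta> j)) \<partial>innov)"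

lemma contractive_transpose:
  assumes "contractive d w"
  shows "contractive d (\<lambda>i j. w j i)"
  unfolding contractive_def
proof (intro allI)
  fix u v :: "nat \<Rightarrow> real"
  have "(\<Sum>i<d. \<Sum>j<d. w j i * (u i * v j)) = (\<Sum>j<d. \<Sum>i<d. w j i * (v j * u i))"
    by (subst sum.swap, intro sum.cong refl) simp
  then show "\<bar>\<Sum>i<d. \<Sum>j<d. w j i * (u i * v j)\<bar> \<le> eucl_norm d u * eucl_norm d v"
    using assms by (simp only: contractive_def mult.commute[of "eucl_norm d u"])
qed

lemma bilinear_unit:
  fixes u v :: "nat \<Rightarrow> real"
  assumes "i < d" "j < d"
  shows "(\<Sum>a<d. \<Sum>b<d. (if a = i \<and> b = j then 1 else 0) * (u a * v b)) = u i * v j"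
proof -
  have "(\<Sum>a<d. \<Sum>b<d. (if a = i \<and> b = j then 1 else 0) * (u a * v b)) = (\<Sum>a<d. if a = i then u i * v j else 0)"
    using assms by (intro sum.cong refl) (auto simp: if_distrib[of "\<lambda>x. x * _"] cong: if_cong)
  then show ?thesis
    using assms by simp
qed

lemma contractive_unit:
  assumes "i < d" "j < d"
  shows "contractive d (\<lambda>a b. if a = i \<and> b = j then 1 else 0)"
  unfolding contractive_def bilinear_unit[OF assms]
  using assms by (auto simp: abs_mult intro!: mult_mono abs_le_L2_set)

lemma contractive_orth: "orth_mat d W \<Longrightarrow> contractive d (\<lambda>i j. W $$ (i, j))"
  using orth_mat_bilinear_le by (simp add: contractive_def)

lemma cross_transpose: "cross d w A B = cross d (\<lambda>i j. w j i) B A"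
  unfolding cross_def by (subst sum.swap) (simp add: mult.commute)

context
  fixes d :: nat and A B :: "(int \<Rightarrow> real) \<Rightarrow> nat \<Rightarrow> real" and a c :: real
  assumes meas: "\<And>i. i < d \<Longrightarrow> (\<lambda>\<eta>. A \<eta> i) \<in> borel_measurable innov"
      "\<And>i. i < d \<Longrightarrow> (\<lambda>\<eta>. B \<eta> i) \<in> borel_measurable innov"
    and A: "moment_le innov 2 (\<lambda>\<eta>. eucl_norm d (A \<eta>)) a" "a \<ge> 0"
    and B: "moment_le innov 2 (\<lambda>\<eta>. eucl_norm d (B \<eta>)) c" "c \<ge> 0"
begin

lemma integrable_cross_component: "i < d \<Longrightarrow> j < d \<Longrightarrow> integrable innov (\<lambda>\<eta>. A \<eta> i * B \<eta> j)"
  by (rule Cauchy_Schwarz_integral(1)[OF moment_le_component[OF A(1)] moment_le_component[OF B(1)] A(2) B(2)])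
    (simp_all add: meas A(2) B(2))

lemma cross_eq_sum: "cross d w A B = (\<Sum>i<d. \<Sum>j<d. w i j * (\<integral>\<eta>. A \<eta> i * B \<eta> j \<partial>innov))"
proof -
  have i: "integrable innov (\<lambda>\<eta>. w i j * (A \<eta> i * B \<eta> j))" if "i < d" "j < d" for i j
    using integrable_cross_component[OF that] by (rule integrable_mult_right)
  have "cross d w A B = (\<Sum>i<d. \<integral>\<eta>. (\<Sum>j<d. w i j * (A \<eta> i * B \<eta> j)) \<partial>innov)"
    unfolding cross_def using i by (intro Bochner_Integration.integral_sum Bochner_Integration.integrable_sum) auto
  also have "\<dots> = (\<Sum>i<d. \<Sum>j<d. \<integral>\<eta>. w i j * (A \<eta> i * B \<eta> j) \<partial>innov)"
    using i by (intro sum.cong refl Bochner_Integration.integral_sum) auto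
  finally show ?thesis
    by simp
qed

lemma integrable_cross: "integrable innov (\<lambda>\<eta>. \<Sum>i<d. \<Sum>j<d. w i j * (A \<eta> i * B \<eta> j))"
  using integrable_cross_component by (intro Bochner_Integration.integrable_sum integrable_mult_right) auto

lemma abs_cross_le:
  assumes w: "contractive d w"
  shows "\<bar>cross d w A B\<bar> \<le> a * c"
proof -
  have i: "integrable innov (\<lambda>\<eta>. eucl_norm d (A \<eta>) * eucl_norm d (B \<eta>))"
    by (rule Cauchy_Schwarz_integral(1)[OF A(1) B(1) A(2) B(2)])
  have "\<bar>cross d w A B\<bar> \<le> (\<integral>\<eta>. \<bar>\<Sum>i<d. \<Sum>j<d. w i j * (A \<eta> i * B \<eta> j)\<bar> \<partial>innov)"
    unfolding cross_def by (rule integral_abs_bound)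
  also have "\<dots> \<le> (\<integral>\<eta>. eucl_norm d (A \<eta>) * eucl_norm d (B \<eta>) \<partial>innov)"
    using w integrable_cross i by (intro integral_mono) (auto simp: contractive_def)
  also have "\<dots> \<le> a * c"
    using Cauchy_Schwarz_integral(2)[OF A(1) B(1) A(2) B(2)] by simp
  finally show ?thesis .
qed

end

text \<open>The map \<open>G t\<close> run on the past of another time \<open>s\<close>. For fixed
  \<open>t\<close> this is stationary in \<open>s\<close>; at \<open>s = t\<close> it is the
  observation.\<close>

definition frozen :: "(nat \<Rightarrow> (nat \<Rightarrow> real) \<Rightarrow> (nat \<Rightarrow> real)) \<Rightarrow> nat \<Rightarrow> int \<Rightarrow> (int \<Rightarrow> real) \<Rightarrow> nat \<Rightarrow> real" where
  "frozen G t s \<eta> = G t (history (\<lambda>i \<eta>. \<eta> i) s \<eta>)"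

text \<open>The hypotheses on the canonical space, with fourth moments in place of the q-th. The
  bounds \<open>\<delta> t\<close> on single changes of \<open>G\<close> are kept separate because
  changes over \<open>h\<close> steps are summed later.\<close>

locale window_model =
  fixes n d b :: nat and G :: "nat \<Rightarrow> (nat \<Rightarrow> real) \<Rightarrow> (nat \<Rightarrow> real)" and \<Theta> \<Gamma> \<beta> :: real and \<delta> :: "nat \<Rightarrow> real"
  assumes \<beta>: "\<beta> > 2" and d: "d \<ge> 1" and \<Theta>: "\<Theta> > 0" and \<Gamma>: "\<Gamma> \<ge> 1" and b: "b \<ge> 1" "b \<le> n"
    and G_meas: "\<And>t i. t \<in> {1..n} \<Longrightarrow> i < d \<Longrightarrow> (\<lambda>x. G t x i) \<in> borel_measurable (PiM UNIV (\<lambda>_. borel))"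
    and G_mean: "\<And>t i. t \<in> {1..n} \<Longrightarrow> i < d \<Longrightarrow> (\<integral>\<eta>. frozen G t (int t) \<eta> i \<partial>innov) = 0"
    and G_coupling: "\<And>t j. t \<in> {1..n} \<Longrightarrow>
      coupling_le 4 {..<d} (frozen G t (int t)) (int t - int j) (\<Theta> * real (max j 1) powr (- \<beta>))"
    and G_moment: "\<And>t. t \<in> {1..n} \<Longrightarrow> moment_le innov 4 (\<lambda>\<eta>. eucl_norm d (frozen G t 0 \<eta>)) \<Theta>"
    and \<delta>: "\<And>t. \<delta> t \<ge> 0" "(\<Sum>t=2..n. \<delta> t) \<le> \<Gamma> * \<Theta>"
    and G_diff: "\<And>t. t \<in> {2..n} \<Longrightarrow> moment_le innov 2 (\<lambda>\<eta>. eucl_norm d (\<lambda>i. frozen G t 0 \<eta> i - frozen G (t - 1) 0 \<eta> i)) (\<delta> t)"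
begin

abbreviation Z :: "nat \<Rightarrow> int \<Rightarrow> (int \<Rightarrow> real) \<Rightarrow> nat \<Rightarrow> real" where
  "Z \<equiv> frozen G"

abbreviation X :: "nat \<Rightarrow> (int \<Rightarrow> real) \<Rightarrow> nat \<Rightarrow> real" where
  "X t \<equiv> Z t (int t)"

definition \<theta> :: "nat \<Rightarrow> real" where
  "\<theta> l = \<Theta> * real (max l 1) powr (- \<beta>)"

lemma measurable_Z [measurable]:
  assumes "t \<in> {1..n}" "i < d"
  shows "(\<lambda>\<eta>. Z t s \<eta> i) \<in> borel_measurable innov"
proof -
  have "(\<lambda>\<eta>. history (\<lambda>i \<eta>. \<eta> i) s \<eta>) \<in> measurable innov (PiM UNIV (\<lambda>_. borel))"
    unfolding history_def by (rule measurable_PiM_single') auto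
  from measurable_compose[OF this G_meas[OF assms]] show ?thesis
    by (simp add: frozen_def)
qed

lemma adapted_Z:
  assumes "t \<in> {1..n}" "i < d"
  shows "adapted s (\<lambda>\<eta>. Z t s \<eta> i)"
proof (rule adaptedI[OF measurable_Z[OF assms]])
  fix \<eta> \<eta>' :: "int \<Rightarrow> real" assume "\<And>i. i \<le> s \<Longrightarrow> \<eta> i = \<eta>' i"
  then have "history (\<lambda>i \<eta>. \<eta> i) s \<eta> = history (\<lambda>i \<eta>. \<eta> i) s \<eta>'"
    by (simp add: history_def)
  then show "Z t s \<eta> i = Z t s \<eta>' i"
    by (simp add: frozen_def)
qed

lemma Z_shift: "Z t s (\<lambda>i. \<eta> (i + c)) = Z t (s + c) \<eta>"
  by (simp add: frozen_def history_def algebra_simps)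

lemma moment_le_Z_shift:
  assumes "moment_le innov p (\<lambda>\<eta>. f (\<lambda>t. Z t 0 \<eta>)) a"
  shows "moment_le innov p (\<lambda>\<eta>. f (\<lambda>t. Z t s \<eta>)) a"
  using moment_le_distr[OF distr_shift[of s] measurable_shift moment_leD(1)[OF assms], of p a] assms
  by (simp add: Z_shift)

lemma integral_Z_shift:
  fixes f :: "(int \<Rightarrow> nat \<Rightarrow> real) \<Rightarrow> real"
  assumes "(\<lambda>\<eta>. f (\<lambda>r. Z t r \<eta>)) \<in> borel_measurable innov"
  shows "(\<integral>\<eta>. f (\<lambda>r. Z t (r + s) \<eta>) \<partial>innov) = (\<integral>\<eta>. f (\<lambda>r. Z t r \<eta>) \<partial>innov)"
proof -
  have "(\<integral>\<eta>. f (\<lambda>r. Z t r \<eta>) \<partial>distr innov innov (\<lambda>\<eta> i. \<eta> (i + s))) = (\<integral>\<eta>. f (\<lambda>r. Z t r (\<lambda>i. \<eta> (i + s))) \<partial>innov)"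
    by (rule integral_distr[OF measurable_shift assms])
  then show ?thesis
    by (simp only: Z_shift distr_shift)
qed

lemma Z_moment4: "t \<in> {1..n} \<Longrightarrow> moment_le innov 4 (\<lambda>\<eta>. eucl_norm d (Z t s \<eta>)) \<Theta>"
  using moment_le_Z_shift[of 4 "\<lambda>z. eucl_norm d (z t)"] G_moment by simp

lemma Z_moment2: "t \<in> {1..n} \<Longrightarrow> moment_le innov 2 (\<lambda>\<eta>. eucl_norm d (Z t s \<eta>)) \<Theta>"
  using moment_le_4_2[OF prob_space_innov Z_moment4] \<Theta> by simp

lemma integrable_Z:
  assumes "t \<in> {1..n}" "i < d"
  shows "integrable innov (\<lambda>\<eta>. Z t s \<eta> i)"
  using assms \<Theta> by (intro moment_le_2_integrable(1)[OF prob_space_innov, of _ \<Theta>]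
    moment_le_component[OF Z_moment2]) auto

lemma integral_Z:
  assumes "t \<in> {1..n}" "i < d"
  shows "(\<integral>\<eta>. Z t s \<eta> i \<partial>innov) = 0"
  using integral_Z_shift[of "\<lambda>z. z (int t) i" t "s - int t"] measurable_Z[OF assms] G_mean[OF assms] by simp

lemma \<theta>_nonneg: "\<theta> l \<ge> 0"
  using \<Theta> by (simp add: \<theta>_def)

lemma powr_split: "real m powr x = real m powr y / (real m)\<^sup>2" if "m \<ge> 1" "x = y - 2" for m x y
  using that powr_diff[of "real m" y 2] by simp

text \<open>Lag 0 contributes \<Theta>; since \<beta> > 2, the other lags contribute at most
  \<Theta> times a sum of inverse squares, hence \<open>2 * \<Theta>\<close>.\<close>

lemma sum_\<theta>_le: "(\<Sum>l<L. \<theta> l) \<le> 3 * \<Theta>"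
proof (cases L)
  case (Suc L')
  have "(\<Sum>l<L. \<theta> l) = \<theta> 0 + (\<Sum>l<L'. \<theta> (Suc l))"
    by (simp only: Suc sum.lessThan_Suc_shift)
  also have "\<dots> \<le> \<Theta> + (\<Sum>l<L'. \<Theta> * (1 / (real (1 + l))\<^sup>2))"
  proof (intro add_mono sum_mono)
    fix l
    have "real (Suc l) powr (- \<beta>) \<le> real (Suc l) powr (- 2)"
      using \<beta> by (intro powr_mono) auto
    also have "\<dots> = 1 / (real (1 + l))\<^sup>2"
      using powr_split[of "Suc l" "- 2" 0] by simp
    finally have "\<Theta> * real (Suc l) powr (- \<beta>) \<le> \<Theta> * (1 / (real (1 + l))\<^sup>2)"
      using \<Theta> by (intro mult_left_mono) auto
    then show "\<theta> (Suc l) \<le> \<Theta> * (1 / (real (1 + l))\<^sup>2)"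
      by (simp add: \<theta>_def)
  qed (simp add: \<theta>_def)
  also have "\<dots> \<le> \<Theta> + \<Theta> * 2"
    unfolding sum_distrib_left[symmetric]
    using sum_inverse_squares_le[of 1 L'] \<Theta> by (intro add_left_mono mult_left_mono) auto
  finally show ?thesis
    by simp
qed (use \<Theta> in simp)

text \<open>Bounds the L2 norm of the forecast of \<open>X r\<close> from the innovations up to
  \<open>r - h\<close>: the root of the tail of the squared coupling bounds.\<close>

definition \<rho> :: "nat \<Rightarrow> real" where
  "\<rho> h = sqrt 2 * \<Theta> * real h powr (1 / 2 - \<beta>)"

lemma \<rho>_nonneg: "\<rho> h \<ge> 0"
  using \<Theta> by (simp add: \<rho>_def)

text \<open>From the power \<open>- 2 * \<beta>\<close> of \<open>h + l\<close> an inverse square is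
  kept for the summation, costing \<open>2 / h\<close>; the rest has a negative exponent and is at
  most its value at \<open>l = 0\<close>.\<close>

lemma sum_\<theta>2_le:
  assumes h: "h \<ge> 1"
  shows "(\<Sum>l<L. (\<theta> (h + l))\<^sup>2) \<le> (\<rho> h)\<^sup>2"
proof -
  have "(\<Sum>l<L. (\<theta> (h + l))\<^sup>2) \<le> (\<Sum>l<L. \<Theta>\<^sup>2 * real h powr (2 - 2 * \<beta>) * (1 / (real (h + l))\<^sup>2))"
  proof (rule sum_mono)
    fix l
    have "(real (h + l) powr (- \<beta>))\<^sup>2 = real (h + l) powr (- 2 * \<beta>)"
      using h by (simp add: powr_power)
    also have "\<dots> = real (h + l) powr (2 - 2 * \<beta>) / (real (h + l))\<^sup>2"
      using h by (intro powr_split) auto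
    also have "\<dots> \<le> real h powr (2 - 2 * \<beta>) / (real (h + l))\<^sup>2"
      using h \<beta> by (intro divide_right_mono powr_mono2') auto
    finally have "\<Theta>\<^sup>2 * (real (h + l) powr (- \<beta>))\<^sup>2 \<le> \<Theta>\<^sup>2 * (real h powr (2 - 2 * \<beta>) / (real (h + l))\<^sup>2)"
      by (intro mult_left_mono) auto
    moreover have "(\<theta> (h + l))\<^sup>2 = \<Theta>\<^sup>2 * (real (h + l) powr (- \<beta>))\<^sup>2"
      using h by (simp add: \<theta>_def power_mult_distrib max_absorb1)
    ultimately show "(\<theta> (h + l))\<^sup>2 \<le> \<Theta>\<^sup>2 * real h powr (2 - 2 * \<beta>) * (1 / (real (h + l))\<^sup>2)"
      by simp
  qed
  also have "\<dots> \<le> \<Theta>\<^sup>2 * real h powr (2 - 2 * \<beta>) * (2 / real h)"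
    unfolding sum_distrib_left[symmetric] using sum_inverse_squares_le[OF h] by (intro mult_left_mono) auto
  also have "\<dots> = (\<rho> h)\<^sup>2"
  proof -
    have "(real h powr (1 / 2 - \<beta>))\<^sup>2 = real h powr (1 - 2 * \<beta>)"
      using h by (simp add: powr_power algebra_simps)
    also have "\<dots> = real h powr (2 - 2 * \<beta>) / real h"
      using h powr_diff[of "real h" "2 - 2 * \<beta>" 1] by simp
    finally show ?thesis
      by (simp add: \<rho>_def power_mult_distrib)
  qed
  finally show ?thesis .
qed

lemma X_coupling: "t \<in> {1..n} \<Longrightarrow> coupling_le 4 {..<d} (X t) (int t - int l) (\<theta> l)"
  using G_coupling by (simp add: \<theta>_def)

subsection \<open>Fluctuations\<close>

definition S :: "nat \<Rightarrow> (int \<Rightarrow> real) \<Rightarrow> nat \<Rightarrow> real" where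
  "S t \<eta> i = (\<Sum>s=t-b+1..t. X s \<eta> i)"

text \<open>Counting forward in time suits the martingale sums, counting backward from
  \<open>t\<close> suits couplings indexed by lag.\<close>

lemma window_reindex:
  fixes f :: "nat \<Rightarrow> real"
  assumes "t \<in> {b..n}"
  shows "(\<Sum>s=t-b+1..t. f s) = (\<Sum>k<b. f (t - b + 1 + k))"
    "(\<Sum>s=t-b+1..t. f s) = (\<Sum>k<b. f (t - k))"
proof -
  show "(\<Sum>s=t-b+1..t. f s) = (\<Sum>k<b. f (t - b + 1 + k))"
    using assms b by (intro sum.reindex_bij_witness[of _ "\<lambda>k. t - b + 1 + k" "\<lambda>s. s - (t - b + 1)"]) auto
  show "(\<Sum>s=t-b+1..t. f s) = (\<Sum>k<b. f (t - k))"
    using assms b by (intro sum.reindex_bij_witness[of _ "\<lambda>k. t - k" "\<lambda>s. t - s"]) auto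
qed

lemma adapted_S:
  assumes "t \<in> {b..n}" "i < d"
  shows "adapted (int t) (\<lambda>\<eta>. S t \<eta> i)"
proof (rule adaptedI)
  show "(\<lambda>\<eta>. S t \<eta> i) \<in> borel_measurable innov"
    unfolding S_def using assms by (intro borel_measurable_sum measurable_Z) auto
  fix \<eta> \<eta>' :: "int \<Rightarrow> real" assume *: "\<And>i. i \<le> int t \<Longrightarrow> \<eta> i = \<eta>' i"
  show "S t \<eta> i = S t \<eta>' i"
    unfolding S_def
  proof (rule sum.cong[OF refl])
    fix s assume "s \<in> {t-b+1..t}"
    then show "X s \<eta> i = X s \<eta>' i"
      using assms * by (intro adapted_eq[OF adapted_Z]) auto
  qed
qed

text \<open>The 6 is the constant 2 of the fourth-moment inequality times the bound
  \<open>3 * \<Theta>\<close> on the summed coupling distances.\<close>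

lemma S_moment:
  assumes t: "t \<in> {b..n}"
  shows "moment_le innov 4 (\<lambda>\<eta>. eucl_norm d (S t \<eta>)) (6 * sqrt b * \<Theta>)"
proof -
  let ?s = "\<lambda>k. t - b + 1 + k"
  have s: "?s k \<in> {1..n}" if "k < b" for k
    using t that by auto
  have "moment_le innov 4 (\<lambda>\<eta>. L2_set (\<lambda>i. \<Sum>k<b. X (?s k) \<eta> i) {..<d}) (2 * sqrt b * (3 * \<Theta>))"
  proof (rule dependent_sum_moment4[where \<tau>="int (t - b + 1)" and \<theta>=\<theta>])
    show "coupling_le 4 {..<d} (X (?s k)) (int (t - b + 1) + int k - int l) (\<theta> l)" if "k < b" for k l
      using X_coupling[OF s[OF that], of l] by (simp only: of_nat_add)
    show "adapted (int (t - b + 1) + int k) (\<lambda>\<eta>. X (?s k) \<eta> i)" if "k < b" "i \<in> {..<d}" for k i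
      using adapted_Z[OF s[OF that(1)], of i "int (?s k)"] that(2) by (simp only: of_nat_add lessThan_iff)
  qed (use integrable_Z[OF s] integral_Z[OF s] \<theta>_nonneg sum_\<theta>_le in auto)
  then show ?thesis
    unfolding S_def window_reindex(1)[OF t] by (simp only: mult.assoc) simp
qed

text \<open>The innovation at lag \<open>l\<close> of the window has lag \<open>l - i\<close> for
  the summand \<open>X (t - i)\<close>, and does not reach it when \<open>i > l\<close>.\<close>

definition window_coupling :: "nat \<Rightarrow> real" where
  "window_coupling l = (\<Sum>i<b. if i \<le> l then \<theta> (l - i) else 0)"

lemma window_coupling_nonneg: "window_coupling l \<ge> 0"
  unfolding window_coupling_def by (intro sum_nonneg) (auto simp: \<theta>_nonneg)

lemma sum_window_coupling_le: "(\<Sum>l<L. window_coupling l) \<le> real b * (3 * \<Theta>)"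
proof -
  have "(\<Sum>l<L. window_coupling l) = (\<Sum>i<b. \<Sum>l<L. if i \<le> l then \<theta> (l - i) else 0)"
    unfolding window_coupling_def by (rule sum.swap)
  also have "\<dots> \<le> (\<Sum>i<b. 3 * \<Theta>)"
  proof (rule sum_mono)
    fix i
    have "(\<Sum>l<L. if i \<le> l then \<theta> (l - i) else 0) = (\<Sum>l\<in>{l. l < L \<and> i \<le> l}. \<theta> (l - i))"
      by (subst sum.inter_filter[symmetric]) (auto intro!: sum.cong)
    also have "\<dots> = (\<Sum>l<L - i. \<theta> l)"
      by (rule sum.reindex_bij_witness[of _ "\<lambda>l. l + i" "\<lambda>l. l - i"]) auto
    finally show "(\<Sum>l<L. if i \<le> l then \<theta> (l - i) else 0) \<le> 3 * \<Theta>"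
      using sum_\<theta>_le by simp
  qed
  finally show ?thesis
    by simp
qed

lemma L2_set_sum_le:
  fixes x :: "'k \<Rightarrow> 'i \<Rightarrow> real"
  shows "L2_set (\<lambda>i. \<Sum>k\<in>K. x k i) I \<le> (\<Sum>k\<in>K. L2_set (x k) I)"
proof (induction K rule: infinite_finite_induct)
  case (insert k K)
  then show ?case
    using L2_set_triangle_ineq[of "x k" "\<lambda>i. \<Sum>k\<in>K. x k i" I] by simp
qed (auto simp: L2_set_def)

lemma S_coupling:
  assumes t: "t \<in> {b..n}"
  shows "moment_le (innov \<Otimes>\<^sub>M innov) 4
    (\<lambda>z. eucl_norm d (\<lambda>i. S t (fst z) i - S t ((fst z)(int t - int l := snd z (int t - int l))) i)) (window_coupling l)"
proof -
  define j where "j = int t - int l"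
  define D where "D = (\<lambda>k z. eucl_norm d (\<lambda>i. X (t - k) (fst z) i - X (t - k) ((fst z)(j := snd z j)) i))"
  have tk: "t - k \<in> {1..n}" if "k < b" for k
    using t that b by auto
  have mX: "(\<lambda>z. X (t - k) ((fst z)(j := snd z j)) i) \<in> borel_measurable (innov \<Otimes>\<^sub>M innov)" if "k < b" "i < d" for k i
    using measurable_compose[OF measurable_coupling measurable_Z[OF tk[OF that(1)] that(2)]] .
  have mX': "(\<lambda>z. X (t - k) (fst z) i) \<in> borel_measurable (innov \<Otimes>\<^sub>M innov)" if "k < b" "i < d" for k i
    using measurable_compose[OF measurable_fst measurable_Z[OF tk[OF that(1)] that(2)]] .
  have D: "moment_le (innov \<Otimes>\<^sub>M innov) 4 (D k) (if k \<le> l then \<theta> (l - k) else 0)" if k: "k < b" for k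
  proof (cases "k \<le> l")
    case True
    have "int (t - k) - int (l - k) = j"
      using True k t by (simp add: j_def of_nat_diff)
    then show ?thesis
      using X_coupling[OF tk[OF k], of "l - k"] True by (simp add: coupling_le_def D_def[abs_def])
  next
    case False
    have "X (t - k) (fst z) i = X (t - k) ((fst z)(j := snd z j)) i" if "i < d" for i and z :: "(int \<Rightarrow> real) \<times> (int \<Rightarrow> real)"
      by (rule adapted_eq[OF adapted_Z[OF tk[OF k] that]]) (use False k t in \<open>auto simp: j_def of_nat_diff\<close>)
    then have "D k = (\<lambda>z. 0)"
      unfolding D_def by (auto simp: L2_set_def)
    then show ?thesis
      using False by (simp add: moment_le_def)
  qed
  have "moment_le (innov \<Otimes>\<^sub>M innov) 4 (\<lambda>z. \<Sum>k<b. D k z) (window_coupling l)"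
    unfolding window_coupling_def using D \<theta>_nonneg by (intro moment_le_sum) auto
  then show ?thesis
    unfolding j_def[symmetric]
  proof (rule moment_le_mono)
    show "(\<lambda>z. eucl_norm d (\<lambda>i. S t (fst z) i - S t ((fst z)(j := snd z j)) i)) \<in> borel_measurable (innov \<Otimes>\<^sub>M innov)"
      unfolding S_def window_reindex(2)[OF t] using mX mX'
      by (intro borel_measurable_L2_set borel_measurable_diff borel_measurable_sum) auto
    have le: "eucl_norm d (\<lambda>i. S t (fst z) i - S t ((fst z)(j := snd z j)) i) \<le> (\<Sum>k<b. D k z)" for z
      unfolding S_def window_reindex(2)[OF t] sum_subtractf[symmetric] D_def by (rule L2_set_sum_le)
    show "AE z in innov \<Otimes>\<^sub>M innov. \<bar>eucl_norm d (\<lambda>i. S t (fst z) i - S t ((fst z)(j := snd z j)) i)\<bar> \<le> \<bar>\<Sum>k<b. D k z\<bar>"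
      using order_trans[OF le abs_ge_self] by (intro AE_I2) simp
  qed (auto simp: window_coupling_nonneg)
qed

definition Y :: "nat \<Rightarrow> (int \<Rightarrow> real) \<Rightarrow> nat \<times> nat \<Rightarrow> real" where
  "Y t \<eta> = (\<lambda>(i, j). 1 / real b * (S t \<eta> i * S t \<eta> j))"

definition Yc :: "nat \<Rightarrow> (int \<Rightarrow> real) \<Rightarrow> nat \<times> nat \<Rightarrow> real" where
  "Yc t \<eta> p = Y t \<eta> p - (\<integral>\<eta>. Y t \<eta> p \<partial>innov)"

lemma integrable_SS:
  assumes "t \<in> {b..n}" "i < d" "j < d"
  shows "integrable innov (\<lambda>\<eta>. S t \<eta> i * S t \<eta> j)"
proof -
  have "moment_le innov 2 (\<lambda>\<eta>. S t \<eta> i) (6 * sqrt b * \<Theta>)" if "i < d" for i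
    using that \<Theta> by (intro moment_le_component[OF moment_le_4_2[OF prob_space_innov S_moment[OF assms(1)]]]
        adapted_measurable[OF adapted_S[OF assms(1)]]) auto
  from Cauchy_Schwarz_integral(1)[OF this[OF assms(2)] this[OF assms(3)]] show ?thesis
    using \<Theta> by simp
qed

lemma integrable_Y: "t \<in> {b..n} \<Longrightarrow> p \<in> {..<d} \<times> {..<d} \<Longrightarrow> integrable innov (\<lambda>\<eta>. Y t \<eta> p)"
  using integrable_SS by (auto simp: Y_def)

lemma L2_set_outer_diff_le:
  fixes x y :: "nat \<Rightarrow> real"
  shows "L2_set (\<lambda>(i, j). x i * x j - y i * y j) ({..<d} \<times> {..<d}) \<le>
    eucl_norm d (\<lambda>i. x i - y i) * (eucl_norm d x + eucl_norm d y)"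
proof -
  have eq: "(\<lambda>(i, j). x i * x j - y i * y j) = (\<lambda>p. (case p of (i, j) \<Rightarrow> (x i - y i) * x j) + (case p of (i, j) \<Rightarrow> y i * (x j - y j)))"
    by (rule ext) (simp add: case_prod_unfold algebra_simps)
  have "L2_set (\<lambda>(i, j). x i * x j - y i * y j) ({..<d} \<times> {..<d}) \<le>
      L2_set (\<lambda>(i, j). (x i - y i) * x j) ({..<d} \<times> {..<d}) + L2_set (\<lambda>(i, j). y i * (x j - y j)) ({..<d} \<times> {..<d})"
    unfolding eq by (rule L2_set_triangle_ineq)
  then show ?thesis
    using L2_set_outer[of "\<lambda>i. x i - y i" x "{..<d}" "{..<d}"] L2_set_outer[of y "\<lambda>i. x i - y i" "{..<d}" "{..<d}"]
    by (simp add: algebra_simps)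
qed

text \<open>A difference of outer products is the difference of the vectors times the sum of their
  norms. The 12 collects the bounds 6 for \<open>S t\<close> and for its coupled copy, the factor
  \<open>1 / b\<close> turns \<open>sqrt b\<close> into its inverse, and the centring
  cancels.\<close>

lemma Y_coupling:
  assumes t: "t \<in> {b..n}"
  shows "coupling_le 2 ({..<d} \<times> {..<d}) (Yc t) (int t - int l) (12 * \<Theta> / sqrt b * window_coupling l)"
proof -
  define j where "j = int t - int l"
  define S' where "S' = (\<lambda>z i. S t ((fst z)(j := snd z j)) i)"
  define \<Delta> where "\<Delta> = (\<lambda>z. eucl_norm d (\<lambda>i. S t (fst z) i - S' z i))"
  have Sm: "(\<lambda>\<eta>. S t \<eta> i) \<in> borel_measurable innov" if "i < d" for i
    using adapted_measurable[OF adapted_S[OF t that]] .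
  have S1: "moment_le (innov \<Otimes>\<^sub>M innov) 4 (\<lambda>z. eucl_norm d (S t (fst z))) (6 * sqrt b * \<Theta>)"
    using moment_le_distr[OF distr_fst_innov measurable_fst moment_leD(1)[OF S_moment[OF t]]] S_moment[OF t] by blast
  have S2: "moment_le (innov \<Otimes>\<^sub>M innov) 4 (\<lambda>z. eucl_norm d (S' z)) (6 * sqrt b * \<Theta>)"
    unfolding S'_def
    using moment_le_distr[OF distr_coupling measurable_coupling moment_leD(1)[OF S_moment[OF t]]] S_moment[OF t] by blast
  have "moment_le (innov \<Otimes>\<^sub>M innov) 4 (\<lambda>z. eucl_norm d (S t (fst z)) + eucl_norm d (S' z)) (12 * sqrt b * \<Theta>)"
    using moment_le_add[OF _ _ S1 S2] \<Theta> by (simp add: mult_ac)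
  then have "moment_le (innov \<Otimes>\<^sub>M innov) 2 (\<lambda>z. \<Delta> z * (eucl_norm d (S t (fst z)) + eucl_norm d (S' z)))
      (window_coupling l * (12 * sqrt b * \<Theta>))"
    using S_coupling[OF t, of l] \<Theta> window_coupling_nonneg
    by (intro moment_le_mult) (auto simp: \<Delta>_def S'_def j_def)
  then have m: "moment_le (innov \<Otimes>\<^sub>M innov) 2 (\<lambda>z. 1 / real b * (\<Delta> z * (eucl_norm d (S t (fst z)) + eucl_norm d (S' z))))
      (1 / real b * (window_coupling l * (12 * sqrt b * \<Theta>)))"
    by (rule moment_le_scale) simp
  have c: "1 / real b * (window_coupling l * (12 * sqrt b * \<Theta>)) = 12 * \<Theta> / sqrt b * window_coupling l"
  proof -
    have "sqrt (real b) / real b = 1 / sqrt (real b)"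
      by (simp add: sqrt_divide_self_eq inverse_eq_divide)
    then show ?thesis
      by (simp add: divide_inverse mult_ac)
  qed
  have le: "L2_set (\<lambda>p. Yc t (fst z) p - Yc t ((fst z)(j := snd z j)) p) ({..<d} \<times> {..<d})
      \<le> 1 / real b * (\<Delta> z * (eucl_norm d (S t (fst z)) + eucl_norm d (S' z)))" for z
  proof -
    have eq: "(\<lambda>p. Yc t (fst z) p - Yc t ((fst z)(j := snd z j)) p) =
        (\<lambda>p. 1 / real b * (case p of (i, k) \<Rightarrow> S t (fst z) i * S t (fst z) k - S' z i * S' z k))"
      by (rule ext) (simp add: Yc_def Y_def S'_def case_prod_unfold right_diff_distrib diff_divide_distrib)
    have "L2_set (\<lambda>p. Yc t (fst z) p - Yc t ((fst z)(j := snd z j)) p) ({..<d} \<times> {..<d}) =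
        1 / real b * L2_set (\<lambda>(i, k). S t (fst z) i * S t (fst z) k - S' z i * S' z k) ({..<d} \<times> {..<d})"
      unfolding eq by (rule L2_set_right_distrib[symmetric]) simp
    also have "\<dots> \<le> 1 / real b * (\<Delta> z * (eucl_norm d (S t (fst z)) + eucl_norm d (S' z)))"
      unfolding \<Delta>_def by (intro mult_left_mono L2_set_outer_diff_le) simp
    finally show ?thesis .
  qed
  have meas: "(\<lambda>z. L2_set (\<lambda>p. Yc t (fst z) p - Yc t ((fst z)(j := snd z j)) p) ({..<d} \<times> {..<d})) \<in> borel_measurable (innov \<Otimes>\<^sub>M innov)"
  proof (intro borel_measurable_L2_set borel_measurable_diff)
    fix p assume p: "p \<in> {..<d} \<times> {..<d}"
    have Ym: "(\<lambda>\<eta>. Yc t \<eta> p) \<in> borel_measurable innov"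
      using integrable_Y[OF t p] by (auto simp: Yc_def[abs_def])
    show "(\<lambda>z. Yc t (fst z) p) \<in> borel_measurable (innov \<Otimes>\<^sub>M innov)"
      using measurable_compose[OF measurable_fst Ym] .
    show "(\<lambda>z. Yc t ((fst z)(j := snd z j)) p) \<in> borel_measurable (innov \<Otimes>\<^sub>M innov)"
      using measurable_compose[OF measurable_coupling Ym] .
  qed
  show ?thesis
    unfolding coupling_le_def j_def[symmetric]
    by (rule moment_le_mono[OF m[unfolded c]])
      (use meas le order_trans[OF le abs_ge_self] window_coupling_nonneg \<Theta> in auto)
qed

text \<open>Summing the coupling bounds over the lags gives \<open>12 * \<Theta> / sqrt b\<close>
  times \<open>3 * b * \<Theta>\<close>, that is \<open>36 * \<Theta>\<^sup>2 * sqrt b\<close>;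
  Doob's factor 2 makes this 72, and there are \<open>n + 1 - b \<le> n\<close> windows.\<close>

lemma fluctuation_moment:
  "moment_le innov 2 (\<lambda>\<eta>. Max ((\<lambda>m. L2_set (\<lambda>p. \<Sum>k<m. Yc (b + k) \<eta> p) ({..<d} \<times> {..<d})) ` {..n + 1 - b}))
    (72 * \<Theta>\<^sup>2 * sqrt (real n * real b))"
proof -
  define m where "m = n + 1 - b"
  have t: "b + k \<in> {b..n}" if "k < m" for k
    using that by (auto simp: m_def)
  have ad: "adapted (int b + int k) (\<lambda>\<eta>. Yc (b + k) \<eta> p)" if "k < m" "p \<in> {..<d} \<times> {..<d}" for k p
  proof (rule adaptedI)
    show "(\<lambda>\<eta>. Yc (b + k) \<eta> p) \<in> borel_measurable innov"
      using integrable_Y[OF t[OF that(1)] that(2)] by (auto simp: Yc_def[abs_def])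
    fix \<eta> \<eta>' :: "int \<Rightarrow> real" assume *: "\<And>i. i \<le> int b + int k \<Longrightarrow> \<eta> i = \<eta>' i"
    have "S (b + k) \<eta> i = S (b + k) \<eta>' i" if "i < d" for i
      by (rule adapted_eq[OF adapted_S[OF t[OF \<open>k < m\<close>] that]]) (use * in simp)
    then show "Yc (b + k) \<eta> p = Yc (b + k) \<eta>' p"
      using that by (auto simp: Yc_def Y_def)
  qed
  have "moment_le innov 2 (\<lambda>\<eta>. Max ((\<lambda>m. L2_set (\<lambda>p. \<Sum>k<m. Yc (b + k) \<eta> p) ({..<d} \<times> {..<d})) ` {..m}))
      (2 * sqrt m * (36 * \<Theta>\<^sup>2 * sqrt b))"
  proof (rule dependent_max_moment2[where \<tau>="int b" and \<theta>="\<lambda>l. 12 * \<Theta> / sqrt b * window_coupling l"])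
    show "coupling_le 2 ({..<d} \<times> {..<d}) (Yc (b + k)) (int b + int k - int l) (12 * \<Theta> / sqrt b * window_coupling l)"
      if "k < m" for k l
      using Y_coupling[OF t[OF that], of l] by simp
    show "(\<Sum>l<L. 12 * \<Theta> / sqrt b * window_coupling l) \<le> 36 * \<Theta>\<^sup>2 * sqrt b" for L
    proof -
      have "(\<Sum>l<L. 12 * \<Theta> / sqrt b * window_coupling l) \<le> 12 * \<Theta> / sqrt b * (real b * (3 * \<Theta>))"
        unfolding sum_distrib_left[symmetric] using sum_window_coupling_le \<Theta> by (intro mult_left_mono) auto
      also have "\<dots> = 36 * \<Theta>\<^sup>2 * (real b / sqrt b)"
        by (simp add: power2_eq_square)
      also have "real b / sqrt b = sqrt b"
        by (simp add: real_div_sqrt)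
      finally show ?thesis .
    qed
    show "0 \<le> 12 * \<Theta> / sqrt b * window_coupling l" for l
      using \<Theta> window_coupling_nonneg by simp
    show "integrable innov (\<lambda>\<eta>. Yc (b + k) \<eta> p)" "(\<integral>\<eta>. Yc (b + k) \<eta> p \<partial>innov) = 0"
      if "k < m" "p \<in> {..<d} \<times> {..<d}" for k p
      using integrable_Y[OF t[OF that(1)] that(2)] by (auto simp: Yc_def)
  qed (use ad in auto)
  note * = this
  have "2 * sqrt m * (36 * \<Theta>\<^sup>2 * sqrt b) \<le> 72 * \<Theta>\<^sup>2 * sqrt (real n * real b)"
  proof -
    have "sqrt m * sqrt b \<le> sqrt n * sqrt b"
      using b by (intro mult_right_mono) (auto simp: m_def)
    then show ?thesis
      using mult_left_mono[of "sqrt m * sqrt b" "sqrt n * sqrt b" "72 * \<Theta>\<^sup>2"] by (simp add: real_sqrt_mult mult_ac)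
  qed
  then show ?thesis
    unfolding m_def[symmetric] using \<Theta>
    by (intro moment_le_mono[OF * _ moment_leD(1)[OF *]]) auto
qed

subsection \<open>Bias\<close>

text \<open>\<open>A\<close> is known at time \<open>s\<close>, so under the integral
  \<open>X r\<close> may be replaced by its forecast from time \<open>s\<close>, which has size
  \<open>\<rho> h\<close>.\<close>

lemma cross_cexp:
  assumes r: "r \<in> {1..n}" and A: "\<And>i. i < d \<Longrightarrow> adapted s (\<lambda>\<eta>. A \<eta> i)"
    "moment_le innov 2 (\<lambda>\<eta>. eucl_norm d (A \<eta>)) a" "a \<ge> 0"
    and w: "contractive d w" and h: "h \<ge> 1" "s = int r - int h"
  shows "\<bar>cross d w A (X r)\<bar> \<le> a * \<rho> h" "\<bar>cross d w (X r) A\<bar> \<le> a * \<rho> h"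
proof -
  have Am: "(\<lambda>\<eta>. A \<eta> i) \<in> borel_measurable innov" if "i < d" for i
    using adapted_measurable[OF A(1)[OF that]] .
  define F where "F = (\<lambda>\<eta> i. cexp s (\<lambda>\<eta>. X r \<eta> i) \<eta>)"
  have Fm: "(\<lambda>\<eta>. F \<eta> i) \<in> borel_measurable innov" if "i < d" for i
    unfolding F_def using measurable_Z[OF r that] by measurable
  have F: "moment_le innov 2 (\<lambda>\<eta>. eucl_norm d (F \<eta>)) (\<rho> h)"
    unfolding F_def
  proof (rule cexp_decay[where \<gamma>="\<lambda>l. \<theta> (h + l)"])
    show "coupling_le 2 {..<d} (X r) (s - int l) (\<theta> (h + l))" for l
    proof -
      have "coupling_le 4 {..<d} (X r) (int r - int (h + l)) (\<theta> (h + l))"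
        by (rule X_coupling[OF r])
      then show ?thesis
        unfolding coupling_le_def h(2) using \<theta>_nonneg
        by (intro moment_le_4_2[OF prob_space_innov2]) (auto simp: algebra_simps)
    qed
  qed (use integrable_Z[OF r] integral_Z[OF r] \<theta>_nonneg sum_\<theta>2_le[OF h(1)] \<rho>_nonneg in auto)
  have Xm: "(\<lambda>\<eta>. X r \<eta> i) \<in> borel_measurable innov" if "i < d" for i
    using measurable_Z[OF r that] .
  have eq: "cross d w A (X r) = cross d w A F" for w
  proof -
    have "cross d w A (X r) = (\<Sum>i<d. \<Sum>j<d. w i j * (\<integral>\<eta>. A \<eta> i * X r \<eta> j \<partial>innov))"
      using \<Theta> by (intro cross_eq_sum[OF Am Xm A(2,3) Z_moment2[OF r]]) auto
    also have "\<dots> = (\<Sum>i<d. \<Sum>j<d. w i j * (\<integral>\<eta>. A \<eta> i * F \<eta> j \<partial>innov))"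
    proof (intro sum.cong refl)
      fix i j assume ij: "i \<in> {..<d}" "j \<in> {..<d}"
      have "integrable innov (\<lambda>\<eta>. A \<eta> i * X r \<eta> j)"
        using \<Theta> ij by (intro integrable_cross_component[OF Am Xm A(2,3) Z_moment2[OF r]]) auto
      then show "w i j * (\<integral>\<eta>. A \<eta> i * X r \<eta> j \<partial>innov) = w i j * (\<integral>\<eta>. A \<eta> i * F \<eta> j \<partial>innov)"
        using integral_mult_cexp(2)[OF A(1), of i "\<lambda>\<eta>. X r \<eta> j"] ij by (simp add: F_def)
    qed
    also have "\<dots> = cross d w A F"
      by (rule cross_eq_sum[OF Am Fm A(2,3) F \<rho>_nonneg, symmetric])
    finally show ?thesis .
  qed
  have le: "\<bar>cross d w A (X r)\<bar> \<le> a * \<rho> h" if "contractive d w" for w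
    unfolding eq by (rule abs_cross_le[OF Am Fm A(2,3) F \<rho>_nonneg that])
  show "\<bar>cross d w A (X r)\<bar> \<le> a * \<rho> h"
    by (rule le[OF w])
  show "\<bar>cross d w (X r) A\<bar> \<le> a * \<rho> h"
    unfolding cross_transpose[of d w "X r"] by (rule le[OF contractive_transpose[OF w]])
qed

lemma cross_shift:
  assumes r: "r \<in> {1..n}"
  shows "cross d w (Z r (s + c)) (Z r (s' + c)) = cross d w (Z r s) (Z r s')"
  unfolding cross_def
  using integral_Z_shift[of "\<lambda>z. \<Sum>i<d. \<Sum>j<d. w i j * (z s i * z s' j)" r c] measurable_Z[OF r]
  by (simp add: borel_measurable_sum)

text \<open>The contributions of lags \<open>h\<close> and \<open>- h\<close> taken together, with
  \<open>G r\<close> frozen at both times; a series over the integers thereby becomes one over the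
  naturals.\<close>

definition lag_cov :: "(nat \<Rightarrow> nat \<Rightarrow> real) \<Rightarrow> nat \<Rightarrow> nat \<Rightarrow> real" where
  "lag_cov w r h = (if h = 0 then cross d w (X r) (X r)
     else cross d w (Z r (int r - int h)) (X r) + cross d w (X r) (Z r (int r - int h)))"

lemma abs_lag_cov_le:
  assumes r: "r \<in> {1..n}" and w: "contractive d w"
  shows "\<bar>lag_cov w r h\<bar> \<le> 3 * \<Theta>\<^sup>2 * (if h = 0 then 1 else real h powr (1 / 2 - \<beta>))"
proof (cases "h = 0")
  case True
  have "\<bar>cross d w (X r) (X r)\<bar> \<le> \<Theta> * \<Theta>"
    using \<Theta> by (intro abs_cross_le[OF _ _ Z_moment2[OF r] _ Z_moment2[OF r] _ w] measurable_Z[OF r]) auto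
  then show ?thesis
    using True \<Theta> mult_pos_pos[OF \<Theta> \<Theta>] unfolding lag_cov_def by (simp add: power2_eq_square)
next
  case False
  then have h: "h \<ge> 1"
    by simp
  have "\<bar>cross d w (Z r (int r - int h)) (X r)\<bar> \<le> \<Theta> * \<rho> h" "\<bar>cross d w (X r) (Z r (int r - int h))\<bar> \<le> \<Theta> * \<rho> h"
    using \<Theta> by (intro cross_cexp[OF r adapted_Z[OF r] Z_moment2[OF r] _ w h refl]; simp)+
  then have "\<bar>lag_cov w r h\<bar> \<le> 2 * \<Theta> * \<rho> h"
    using False by (simp add: lag_cov_def)
  also have "\<dots> = (2 * sqrt 2) * (\<Theta>\<^sup>2 * real h powr (1 / 2 - \<beta>))"
    by (simp add: \<rho>_def power2_eq_square)
  also have "\<dots> \<le> 3 * (\<Theta>\<^sup>2 * real h powr (1 / 2 - \<beta>))"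
  proof (rule mult_right_mono)
    show "2 * sqrt 2 \<le> (3 :: real)"
      using sqrt_2_le by simp
  qed simp
  finally show ?thesis
    using False by simp
qed

section \<open>The long-run covariance as a series over lags\<close>

lemma powr_half_le_decay: "(if h = 0 then 1 else real h powr (1 / 2 - \<beta>)) \<le> decay h"
  using \<beta> by (auto simp: decay_def intro!: powr_mono)

text \<open>Stationarity moves the pair at times 0 and \<open>h\<close> so that its later time is
  \<open>r\<close>, where the forecast bound makes both half-lines absolutely summable. The
  unordered sum over the integers then agrees with the series of paired lags.\<close>

lemma long_run_sums:
  assumes r: "r \<in> {1..n}" and w: "contractive d w"
  shows "((\<lambda>h. cross d w (Z r 0) (Z r h)) has_sum (\<Sum>h. lag_cov w r h)) UNIV" "lag_cov w r sums (\<Sum>h. lag_cov w r h)"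
proof -
  define C where "C = (\<lambda>h. cross d w (Z r 0) (Z r h))"
  have Cp: "C (int h) = cross d w (Z r (int r - int h)) (X r)" for h
    using cross_shift[OF r, of w 0 "int r - int h" "int h"] by (simp add: C_def)
  have Cn: "C (- int h) = cross d w (X r) (Z r (int r - int h))" for h
    using cross_shift[OF r, of w 0 "int r" "- int h"] by (simp add: C_def)
  have bound: "\<bar>C (int (Suc h))\<bar> \<le> \<Theta> * \<rho> (Suc h)" "\<bar>C (- int (Suc h))\<bar> \<le> \<Theta> * \<rho> (Suc h)" for h
    unfolding Cp Cn using \<Theta> by (intro cross_cexp[OF r adapted_Z[OF r] Z_moment2[OF r] _ w _ refl]; simp)+
  have "summable (\<lambda>h. \<Theta> * (sqrt 2 * \<Theta> * decay (Suc h)))"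
    using summable_decay by (intro summable_mult) (simp add: summable_Suc_iff)
  moreover have "\<Theta> * \<rho> (Suc h) \<le> \<Theta> * (sqrt 2 * \<Theta> * decay (Suc h))" for h
    unfolding \<rho>_def using \<Theta> powr_half_le_decay[of "Suc h"] by (intro mult_left_mono) auto
  ultimately have "\<exists>g. summable g \<and> (\<forall>h. \<Theta> * \<rho> (Suc h) \<le> g h)"
    by blast
  then obtain g where g: "summable g" "\<And>h. \<Theta> * \<rho> (Suc h) \<le> g h"
    by blast
  have sp: "summable (\<lambda>h. norm (C (int (Suc h))))"
    by (rule summable_comparison_test'[OF g(1), where N=0]) (use order_trans[OF bound(1) g(2)] in simp)
  have sn: "summable (\<lambda>h. norm (C (- int (Suc h))))"
    by (rule summable_comparison_test'[OF g(1), where N=0]) (use order_trans[OF bound(2) g(2)] in simp)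
  have sp': "summable (\<lambda>h. norm (C (int h)))"
    by (rule summable_Suc_iff[of "\<lambda>h. norm (C (int h))", THEN iffD1, OF sp])
  define a where "a = (\<Sum>h. C (int h))"
  define c where "c = (\<Sum>h. C (- int (Suc h)))"
  have sa: "(\<lambda>h. C (int h)) sums a"
    unfolding a_def by (rule summable_sums[OF summable_norm_cancel[OF sp']])
  have sc: "(\<lambda>h. C (- int (Suc h))) sums c"
    unfolding c_def by (rule summable_sums[OF summable_norm_cancel[OF sn]])
  have "(C has_sum a) (range int)"
    using norm_summable_imp_has_sum[OF sp' sa] has_sum_reindex[of int UNIV C a] by (simp add: comp_def)
  moreover have "(C has_sum c) (range (\<lambda>h. - int (Suc h)))"
    using norm_summable_imp_has_sum[OF sn sc] has_sum_reindex[of "\<lambda>h. - int (Suc h)" UNIV C c]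
    by (simp add: comp_def inj_def)
  moreover have "range int \<inter> range (\<lambda>h. - int (Suc h)) = {}"
    by auto
  ultimately have "(C has_sum (a + c)) (range int \<union> range (\<lambda>h. - int (Suc h)))"
    by (rule has_sum_Un_disjoint)
  moreover have "range int \<union> range (\<lambda>h. - int (Suc h)) = UNIV"
  proof -
    have "x \<in> range int \<union> range (\<lambda>h. - int (Suc h))" for x
      by (cases x) auto
    then show ?thesis
      by blast
  qed
  ultimately have hs: "(C has_sum (a + c)) UNIV"
    by simp
  have "(\<lambda>h. if h = 0 then 0 else C (- int h)) sums c"
    using sums_Suc_iff[of "\<lambda>h. if h = 0 then 0 else C (- int h)" c] sc by simp
  from sums_add[OF sa this] have "(\<lambda>h. C (int h) + (if h = 0 then 0 else C (- int h))) sums (a + c)" .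
  moreover have "(\<lambda>h. C (int h) + (if h = 0 then 0 else C (- int h))) = lag_cov w r"
    by (rule ext) (auto simp: lag_cov_def Cp Cn simp flip: of_nat_Suc)
  ultimately have s: "lag_cov w r sums (a + c)"
    by simp
  show "lag_cov w r sums (\<Sum>h. lag_cov w r h)"
    using s sums_unique[OF s] by simp
  show "((\<lambda>h. cross d w (Z r 0) (Z r h)) has_sum (\<Sum>h. lag_cov w r h)) UNIV"
    using hs sums_unique[OF s] by (simp add: C_def[abs_def])
qed

lemma cross_unit:
  assumes "i < d" "j < d"
  shows "cross d (\<lambda>a b. if a = i \<and> b = j then 1 else 0) A B = (\<integral>\<eta>. A \<eta> i * B \<eta> j \<partial>innov)"
  unfolding cross_def bilinear_unit[OF assms] ..

lemma cross_Z_eq_sum: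
  assumes r: "r \<in> {1..n}" "r' \<in> {1..n}"
  shows "cross d w (Z r s) (Z r' s') =
    (\<Sum>i<d. \<Sum>j<d. w i j * cross d (\<lambda>a b. if a = i \<and> b = j then 1 else 0) (Z r s) (Z r' s'))"
proof -
  have "cross d w (Z r s) (Z r' s') = (\<Sum>i<d. \<Sum>j<d. w i j * (\<integral>\<eta>. Z r s \<eta> i * Z r' s' \<eta> j \<partial>innov))"
    using \<Theta> measurable_Z r by (intro cross_eq_sum[OF _ _ Z_moment2[OF r(1)] _ Z_moment2[OF r(2)]]) auto
  also have "\<dots> = (\<Sum>i<d. \<Sum>j<d. w i j * cross d (\<lambda>a b. if a = i \<and> b = j then 1 else 0) (Z r s) (Z r' s'))"
    by (intro sum.cong refl) (simp add: cross_unit)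
  finally show ?thesis .
qed

text \<open>\<open>long_run_cov\<close> is summed entry by entry, so each entry is treated as the
  form of a matrix unit, and the convergent series are recombined linearly. The covariances are
  plain product moments because the means vanish.\<close>

lemma long_run_cov_inner:
  assumes r: "r \<in> {1..n}" and W: "orth_mat d W"
  shows "(\<Sum>i<d. \<Sum>j<d. W $$ (i, j) * long_run_cov innov (\<lambda>i \<eta>. \<eta> i) d (G r) $$ (i, j)) =
    (\<Sum>h. lag_cov (\<lambda>i j. W $$ (i, j)) r h)"
proof -
  let ?u = "\<lambda>i j a b. if a = i \<and> b = j then 1 else 0 :: real"
  let ?w = "\<lambda>i j. W $$ (i, j)"
  have L: "long_run_cov innov (\<lambda>i \<eta>. \<eta> i) d (G r) $$ (i, j) = (\<Sum>h. lag_cov (?u i j) r h)" if "i < d" "j < d" for i j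
  proof -
    have "Cov innov d (\<lambda>\<omega>. G r (history (\<lambda>i \<eta>. \<eta> i) 0 \<omega>)) (\<lambda>\<omega>. G r (history (\<lambda>i \<eta>. \<eta> i) h \<omega>)) $$ (i, j) =
        cross d (?u i j) (Z r 0) (Z r h)" for h
      using that integral_Z[OF r that(1), of 0] integral_Z[OF r that(2), of h]
      unfolding cross_unit[OF that] by (simp add: Cov_def frozen_def)
    then show ?thesis
      using that infsumI[OF long_run_sums(1)[OF r contractive_unit[OF that]]] by (simp add: long_run_cov_def)
  qed
  have lin: "lag_cov ?w r h = (\<Sum>i<d. \<Sum>j<d. W $$ (i, j) * lag_cov (?u i j) r h)" for h
    unfolding lag_cov_def
    using cross_Z_eq_sum[OF r r, of ?w] by (simp add: sum.distrib distrib_left)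
  have "(\<lambda>h. \<Sum>i<d. \<Sum>j<d. W $$ (i, j) * lag_cov (?u i j) r h) sums
      (\<Sum>i<d. \<Sum>j<d. W $$ (i, j) * (\<Sum>h. lag_cov (?u i j) r h))"
    using long_run_sums(2)[OF r contractive_unit] by (intro sums_sum sums_mult) auto
  then have "(\<Sum>i<d. \<Sum>j<d. W $$ (i, j) * (\<Sum>h. lag_cov (?u i j) r h)) = (\<Sum>h. lag_cov ?w r h)"
    unfolding lin[symmetric] by (rule sums_unique)
  then show ?thesis
    by (simp add: L)
qed

text \<open>The nonstationary counterpart of \<open>lag_cov\<close>: the earlier variable uses its
  own map \<open>G (r - h)\<close>.\<close>

definition cross_cov :: "(nat \<Rightarrow> nat \<Rightarrow> real) \<Rightarrow> nat \<Rightarrow> nat \<Rightarrow> real" where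
  "cross_cov w r h = (if h = 0 then cross d w (X r) (X r)
     else cross d w (X (r - h)) (X r) + cross d w (X r) (X (r - h)))"

text \<open>Telescoping in the index of the map, with the time \<open>s\<close> of the innovations
  held fixed.\<close>

lemma Z_diff_moment:
  assumes "1 \<le> r'" "r' \<le> r" "r \<le> n"
  shows "moment_le innov 2 (\<lambda>\<eta>. eucl_norm d (\<lambda>i. Z r' s \<eta> i - Z r s \<eta> i)) (\<Sum>u=r'+1..r. \<delta> u)"
proof -
  have step: "moment_le innov 2 (\<lambda>\<eta>. eucl_norm d (\<lambda>i. Z u s \<eta> i - Z (u - 1) s \<eta> i)) (\<delta> u)" if "u \<in> {r'+1..r}" for u
  proof -
    have "moment_le innov 2 (\<lambda>\<eta>. eucl_norm d (\<lambda>i. Z u 0 \<eta> i - Z (u - 1) 0 \<eta> i)) (\<delta> u)"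
      using that assms by (intro G_diff) auto
    then show ?thesis
      using moment_le_Z_shift[of 2 "\<lambda>z. eucl_norm d (\<lambda>i. z u i - z (u - 1) i)"] by blast
  qed
  have m: "moment_le innov 2 (\<lambda>\<eta>. \<Sum>u=r'+1..r. eucl_norm d (\<lambda>i. Z u s \<eta> i - Z (u - 1) s \<eta> i)) (\<Sum>u=r'+1..r. \<delta> u)"
    using step \<delta> by (intro moment_le_sum) auto
  have le: "eucl_norm d (\<lambda>i. Z r' s \<eta> i - Z r s \<eta> i) \<le> (\<Sum>u=r'+1..r. eucl_norm d (\<lambda>i. Z u s \<eta> i - Z (u - 1) s \<eta> i))" for \<eta>
  proof -
    have tel: "(\<Sum>u=r'+1..r. Z u s \<eta> i - Z (u - 1) s \<eta> i) = Z r s \<eta> i - Z r' s \<eta> i" for i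
      using assms(2) by (induction r rule: dec_induct) auto
    have "eucl_norm d (\<lambda>i. Z r' s \<eta> i - Z r s \<eta> i) = eucl_norm d (\<lambda>i. \<Sum>u=r'+1..r. Z u s \<eta> i - Z (u - 1) s \<eta> i)"
      unfolding tel by (simp add: L2_set_def power2_commute)
    then show ?thesis
      using L2_set_sum_le[of "\<lambda>u i. Z u s \<eta> i - Z (u - 1) s \<eta> i" "{r'+1..r}" "{..<d}"] by simp
  qed
  show ?thesis
  proof (rule moment_le_mono[OF m])
    show "(\<lambda>\<eta>. eucl_norm d (\<lambda>i. Z r' s \<eta> i - Z r s \<eta> i)) \<in> borel_measurable innov"
      using assms by (intro borel_measurable_L2_set borel_measurable_diff measurable_Z) auto
    show "AE \<eta> in innov. \<bar>eucl_norm d (\<lambda>i. Z r' s \<eta> i - Z r s \<eta> i)\<bar> \<le>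
        \<bar>\<Sum>u=r'+1..r. eucl_norm d (\<lambda>i. Z u s \<eta> i - Z (u - 1) s \<eta> i)\<bar>"
      using order_trans[OF le abs_ge_self] by (intro AE_I2) simp
  qed (auto intro!: sum_nonneg \<delta>)
qed

lemma cross_diff:
  assumes r: "r1 \<in> {1..n}" "r2 \<in> {1..n}" "r \<in> {1..n}"
  shows "cross d w (\<lambda>\<eta> i. Z r1 s \<eta> i - Z r2 s \<eta> i) (Z r s') = cross d w (Z r1 s) (Z r s') - cross d w (Z r2 s) (Z r s')"
proof -
  have i: "integrable innov (\<lambda>\<eta>. \<Sum>i<d. \<Sum>j<d. w i j * (Z q s \<eta> i * Z r s' \<eta> j))" if "q \<in> {1..n}" for q
    using \<Theta> measurable_Z r that by (intro integrable_cross[OF _ _ Z_moment2[OF that] _ Z_moment2[OF r(3)]]) auto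
  show ?thesis
    unfolding cross_def Bochner_Integration.integral_diff[OF i[OF r(1)] i[OF r(2)], symmetric]
    by (simp add: left_diff_distrib right_diff_distrib sum_subtractf)
qed

text \<open>The covariance of \<open>X (r - h)\<close> and \<open>X r\<close> is compared with the one where the earlier variable
  also uses \<open>G r\<close>: freezing at the later time leaves the difference adapted to time \<open>r - h\<close>, so
  the full decay in \<open>h\<close> of the prediction of \<open>X r\<close> is available.\<close>

lemma cross_cov_diff_le:
  assumes r: "r \<in> {1..n}" "h < r" and w: "contractive d w" and h: "h \<ge> 1"
  shows "\<bar>cross_cov w r h - lag_cov w r h\<bar> \<le> 2 * (\<Sum>u=r-h+1..r. \<delta> u) * \<rho> h"
proof -
  define s where "s = int r - int h"
  define \<Delta> where "\<Delta> = (\<Sum>u=r-h+1..r. \<delta> u)"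
  have s: "int (r - h) = s"
    using r by (simp add: s_def of_nat_diff)
  have rh: "r - h \<in> {1..n}"
    using r by auto
  define A where "A = (\<lambda>\<eta> i. Z (r - h) s \<eta> i - Z r s \<eta> i)"
  have ad: "adapted s (\<lambda>\<eta>. A \<eta> i)" if "i < d" for i
  proof (rule adaptedI)
    show "(\<lambda>\<eta>. A \<eta> i) \<in> borel_measurable innov"
      unfolding A_def using measurable_Z[OF rh that] measurable_Z[OF r(1) that] by measurable
    fix \<eta> \<eta>' :: "int \<Rightarrow> real" assume *: "\<And>i. i \<le> s \<Longrightarrow> \<eta> i = \<eta>' i"
    show "A \<eta> i = A \<eta>' i"
      unfolding A_def using adapted_eq[OF adapted_Z[OF rh that] *] adapted_eq[OF adapted_Z[OF r(1) that] *] by simp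
  qed
  have m: "moment_le innov 2 (\<lambda>\<eta>. eucl_norm d (A \<eta>)) \<Delta>"
    unfolding A_def \<Delta>_def using r by (intro Z_diff_moment) auto
  have \<Delta>0: "\<Delta> \<ge> 0"
    unfolding \<Delta>_def by (intro sum_nonneg \<delta>)
  have le: "\<bar>cross d w A (X r)\<bar> \<le> \<Delta> * \<rho> h" "\<bar>cross d w (X r) A\<bar> \<le> \<Delta> * \<rho> h"
    by (rule cross_cexp[OF r(1) _ m \<Delta>0 w h s_def]; rule ad; assumption)+
  have 1: "cross d w A (X r) = cross d w (Z (r - h) s) (X r) - cross d w (Z r s) (X r)" for w
    unfolding A_def by (rule cross_diff[OF rh r(1) r(1)])
  have 2: "cross d w (X r) A = cross d w (X r) (Z (r - h) s) - cross d w (X r) (Z r s)"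
    using 1[of "\<lambda>i j. w j i"]
    by (simp add: cross_transpose[of d w "X r"])
  have "cross_cov w r h - lag_cov w r h = cross d w A (X r) + cross d w (X r) A"
    using h unfolding cross_cov_def lag_cov_def s_def[symmetric] s by (simp add: 1 2)
  then show ?thesis
    using le unfolding \<Delta>_def[symmetric] by linarith
qed

text \<open>For a fixed lag \<open>h\<close>, each \<open>\<delta> u\<close> is counted for at most
  \<open>h\<close> values of \<open>r\<close>, so the sum over \<open>r\<close> costs
  \<open>h * \<Gamma> * \<Theta>\<close>. As \<beta> > 2, \<open>h * \<rho> h\<close> is at most a
  multiple of \<open>h powr (-1/2)\<close>, and the lags below \<open>b\<close> sum to
  \<open>2 * sqrt b\<close>. The 6 rounds up \<open>4 * sqrt 2\<close>.\<close>

lemma sum_cross_cov_diff_le: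
  assumes w: "contractive d w" and k: "k \<le> n"
  shows "(\<Sum>r=1..k. \<Sum>h<r. lag_weight b k r h * \<bar>cross_cov w r h - lag_cov w r h\<bar>) \<le> 6 * \<Theta>\<^sup>2 * \<Gamma> * sqrt b"
proof -
  have "(\<Sum>r=1..k. \<Sum>h<r. lag_weight b k r h * \<bar>cross_cov w r h - lag_cov w r h\<bar>) \<le>
    (\<Sum>r=1..k. \<Sum>h=1..<b. if h < r then 2 * (\<Sum>u=r-h+1..r. \<delta> u) * \<rho> h else 0)"
  proof (rule sum_mono)
    fix r assume r: "r \<in> {1..k}"
    let ?g = "\<lambda>h. lag_weight b k r h * \<bar>cross_cov w r h - lag_cov w r h\<bar>"
    have "(\<Sum>h<r. ?g h) = (\<Sum>h\<in>{1..<b} \<inter> {..<r}. ?g h)"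
    proof (rule sum.mono_neutral_right)
      show "\<forall>h\<in>{..<r} - {1..<b} \<inter> {..<r}. ?g h = 0"
      proof
        fix h assume "h \<in> {..<r} - {1..<b} \<inter> {..<r}"
        then have "h = 0 \<or> b \<le> h"
          by auto
        then show "?g h = 0"
          using lag_weight_eq_0[of b h k r] by (auto simp: cross_cov_def lag_cov_def)
      qed
    qed auto
    also have "\<dots> \<le> (\<Sum>h\<in>{1..<b} \<inter> {..<r}. 2 * (\<Sum>u=r-h+1..r. \<delta> u) * \<rho> h)"
    proof (rule sum_mono)
      fix h assume h: "h \<in> {1..<b} \<inter> {..<r}"
      have "?g h \<le> 1 * \<bar>cross_cov w r h - lag_cov w r h\<bar>"
        using lag_weight_bounds by (intro mult_right_mono) auto
      also have "\<dots> \<le> 2 * (\<Sum>u=r-h+1..r. \<delta> u) * \<rho> h"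
        using cross_cov_diff_le[OF _ _ w, of r h] r h k by simp
      finally show "?g h \<le> 2 * (\<Sum>u=r-h+1..r. \<delta> u) * \<rho> h" .
    qed
    also have "\<dots> = (\<Sum>h=1..<b. if h < r then 2 * (\<Sum>u=r-h+1..r. \<delta> u) * \<rho> h else 0)"
      by (subst sum.inter_restrict) auto
    finally show "(\<Sum>h<r. ?g h) \<le> (\<Sum>h=1..<b. if h < r then 2 * (\<Sum>u=r-h+1..r. \<delta> u) * \<rho> h else 0)" .
  qed
  also have "\<dots> = (\<Sum>h=1..<b. 2 * \<rho> h * (\<Sum>r=1..k. if h < r then \<Sum>u=r-h+1..r. \<delta> u else 0))"
    by (subst sum.swap) (auto simp: sum_distrib_left if_distrib mult_ac intro!: sum.cong cong: if_cong)
  also have "\<dots> \<le> (\<Sum>h=1..<b. 2 * \<rho> h * (real h * (\<Gamma> * \<Theta>)))"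
  proof (intro sum_mono mult_left_mono)
    fix h assume h: "h \<in> {1..<b}"
    have "(\<Sum>r=1..k. if h < r then \<Sum>u=r-h+1..r. \<delta> u else 0) \<le> (\<Sum>r=1..k. \<Sum>u=2..n. if u \<le> r \<and> r < u + h then \<delta> u else 0)"
    proof (rule sum_mono)
      fix r assume r: "r \<in> {1..k}"
      show "(if h < r then \<Sum>u=r-h+1..r. \<delta> u else 0) \<le> (\<Sum>u=2..n. if u \<le> r \<and> r < u + h then \<delta> u else 0)"
      proof (cases "h < r")
        case True
        \<comment> \<open>As \<open>h < r\<close>, every \<open>u\<close> here is at least 2, which
          is where the hypothesis on the total variation starts.\<close>
        have "(\<Sum>u=r-h+1..r. \<delta> u) = (\<Sum>u\<in>{u \<in> {2..n}. u \<le> r \<and> r < u + h}. \<delta> u)"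
          using True r k h by (intro sum.cong) auto
        then show ?thesis
          using True sum.inter_filter[of "{2..n}" \<delta> "\<lambda>u. u \<le> r \<and> r < u + h"] by simp
      qed (auto intro!: sum_nonneg \<delta>)
    qed
    also have "\<dots> = (\<Sum>u=2..n. \<Sum>r=1..k. if u \<le> r \<and> r < u + h then \<delta> u else 0)"
      by (rule sum.swap)
    also have "\<dots> \<le> (\<Sum>u=2..n. real h * \<delta> u)"
    proof (rule sum_mono)
      fix u
      have "(\<Sum>r=1..k. if u \<le> r \<and> r < u + h then \<delta> u else 0) = real (card {r \<in> {1..k}. u \<le> r \<and> r < u + h}) * \<delta> u"
        by (simp flip: sum.inter_filter)
      also have "card {r \<in> {1..k}. u \<le> r \<and> r < u + h} \<le> card {u..<u + h}"
        by (intro card_mono) auto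
      then have "real (card {r \<in> {1..k}. u \<le> r \<and> r < u + h}) * \<delta> u \<le> real h * \<delta> u"
        using \<delta>(1) by (intro mult_right_mono) auto
      finally show "(\<Sum>r=1..k. if u \<le> r \<and> r < u + h then \<delta> u else 0) \<le> real h * \<delta> u" .
    qed
    also have "\<dots> \<le> real h * (\<Gamma> * \<Theta>)"
      unfolding sum_distrib_left[symmetric] using \<delta>(2) by (intro mult_left_mono) auto
    finally show "(\<Sum>r=1..k. if h < r then \<Sum>u=r-h+1..r. \<delta> u else 0) \<le> real h * (\<Gamma> * \<Theta>)" .
  qed (use \<rho>_nonneg in simp)
  also have "\<dots> \<le> (\<Sum>h=1..<b. (2 * sqrt 2 * \<Theta>\<^sup>2 * \<Gamma>) * real h powr (- 1 / 2))"
  proof (rule sum_mono)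
    fix h assume "h \<in> {1..<b}"
    then have h: "real h \<ge> 1"
      by simp
    have "real h * real h powr (1 / 2 - \<beta>) = real h powr (3 / 2 - \<beta>)"
      using h by (simp add: powr_mult_base)
    also have "\<dots> \<le> real h powr (- 1 / 2)"
      using h \<beta> by (intro powr_mono) auto
    finally have "(2 * sqrt 2 * \<Theta>\<^sup>2 * \<Gamma>) * (real h * real h powr (1 / 2 - \<beta>)) \<le> (2 * sqrt 2 * \<Theta>\<^sup>2 * \<Gamma>) * real h powr (- 1 / 2)"
      using \<Gamma> by (intro mult_left_mono) auto
    then show "2 * \<rho> h * (real h * (\<Gamma> * \<Theta>)) \<le> (2 * sqrt 2 * \<Theta>\<^sup>2 * \<Gamma>) * real h powr (- 1 / 2)"
      by (simp add: \<rho>_def power2_eq_square mult_ac)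
  qed
  also have "\<dots> \<le> (2 * sqrt 2 * \<Theta>\<^sup>2 * \<Gamma>) * (2 * sqrt b)"
    unfolding sum_distrib_left[symmetric] using sum_powr_half_le \<Gamma> by (intro mult_left_mono) auto
  also have "\<dots> = (4 * sqrt 2) * (\<Theta>\<^sup>2 * \<Gamma> * sqrt b)"
    by simp
  also have "\<dots> \<le> 6 * (\<Theta>\<^sup>2 * \<Gamma> * sqrt b)"
  proof (rule mult_right_mono)
    show "4 * sqrt 2 \<le> (6 :: real)"
      using sqrt_2_le by simp
  qed (use \<Gamma> in simp)
  finally show ?thesis
    by simp
qed

text \<open>Summing \<open>decay\<close> over the lags gives \<open>decay_sum\<close>. Every time
  pays the interior rate, and at most \<open>2 * b\<close> boundary times pay an additional 1. The
  series runs over all lags; those with \<open>h \<ge> r\<close> have weight 0 in the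
  estimator.\<close>

lemma weight_defect_le:
  assumes w: "contractive d w" and k: "k \<le> n"
  shows "(\<Sum>r=1..k. \<bar>\<Sum>h. (lag_weight b k r h - 1) * lag_cov w r h\<bar>) \<le>
      3 * decay_sum * \<Theta>\<^sup>2 * (real n * (1 / real b + real b powr (2 - \<beta>)) + 2 * real b)"
    "\<And>r. r \<in> {1..n} \<Longrightarrow> summable (\<lambda>h. (lag_weight b k r h - 1) * lag_cov w r h)"
proof -
  define \<kappa> where "\<kappa> = 1 / real b + real b powr (2 - \<beta>)"
  define B where "B = (\<lambda>r. if r < b \<or> k + 1 < r + b then 1 else 0 :: real)"
  have term_le: "\<bar>(lag_weight b k r h - 1) * lag_cov w r h\<bar> \<le> decay h * (3 * \<Theta>\<^sup>2 * (\<kappa> + B r))" if r: "r \<in> {1..n}" for r h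
  proof -
    have "\<bar>(lag_weight b k r h - 1) * lag_cov w r h\<bar> \<le>
        \<bar>lag_weight b k r h - 1\<bar> * (3 * \<Theta>\<^sup>2 * (if h = 0 then 1 else real h powr (1 / 2 - \<beta>)))"
      unfolding abs_mult by (intro mult_left_mono abs_lag_cov_le[OF r w]) simp
    also have "\<dots> = 3 * \<Theta>\<^sup>2 * (\<bar>lag_weight b k r h - 1\<bar> * (if h = 0 then 1 else real h powr (1 / 2 - \<beta>)))"
      by simp
    also have "\<dots> \<le> 3 * \<Theta>\<^sup>2 * (decay h * (\<kappa> + B r))"
      unfolding \<kappa>_def B_def by (intro mult_left_mono lag_weight_defect[OF b(1) \<beta>]) simp
    finally show ?thesis
      by (simp add: mult_ac)
  qed
  have sd: "summable (\<lambda>h. decay h * c)" for c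
    by (rule summable_mult2[OF summable_decay])
  show sm: "summable (\<lambda>h. (lag_weight b k r h - 1) * lag_cov w r h)" if "r \<in> {1..n}" for r
    using term_le[OF that] by (intro summable_comparison_test'[OF sd, where N=0]) auto
  have "(\<Sum>r=1..k. \<bar>\<Sum>h. (lag_weight b k r h - 1) * lag_cov w r h\<bar>) \<le> (\<Sum>r=1..k. decay_sum * (3 * \<Theta>\<^sup>2 * (\<kappa> + B r)))"
  proof (rule sum_mono)
    fix r assume "r \<in> {1..k}"
    then have r: "r \<in> {1..n}"
      using k by auto
    have abs: "summable (\<lambda>h. \<bar>(lag_weight b k r h - 1) * lag_cov w r h\<bar>)"
      using term_le[OF r] by (intro summable_comparison_test'[OF sd, where N=0]) auto
    have "\<bar>\<Sum>h. (lag_weight b k r h - 1) * lag_cov w r h\<bar> \<le> (\<Sum>h. \<bar>(lag_weight b k r h - 1) * lag_cov w r h\<bar>)"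
      by (rule summable_rabs[OF abs])
    also have "\<dots> \<le> (\<Sum>h. decay h * (3 * \<Theta>\<^sup>2 * (\<kappa> + B r)))"
      by (intro suminf_le term_le[OF r] abs sd)
    also have "\<dots> = decay_sum * (3 * \<Theta>\<^sup>2 * (\<kappa> + B r))"
      unfolding decay_sum_def by (rule suminf_mult2[OF summable_decay, symmetric])
    finally show "\<bar>\<Sum>h. (lag_weight b k r h - 1) * lag_cov w r h\<bar> \<le> decay_sum * (3 * \<Theta>\<^sup>2 * (\<kappa> + B r))" .
  qed
  also have "\<dots> = (3 * decay_sum * \<Theta>\<^sup>2) * (\<Sum>r=1..k. \<kappa> + B r)"
    by (simp add: sum_distrib_left mult_ac)
  also have "\<dots> \<le> (3 * decay_sum * \<Theta>\<^sup>2) * (real n * \<kappa> + 2 * real b)"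
  proof (rule mult_left_mono)
    have "{r \<in> {1..k}. r < b \<or> k + 1 < r + b} \<subseteq> {..<b} \<union> {k + 1 - b..<k + 1}"
      by auto
    then have "card {r \<in> {1..k}. r < b \<or> k + 1 < r + b} \<le> card ({..<b} \<union> {k + 1 - b..<k + 1})"
      by (intro card_mono) auto
    also have "\<dots> \<le> b + b"
      by (intro order_trans[OF card_Un_le] add_mono) auto
    finally have "(\<Sum>r=1..k. B r) \<le> 2 * real b"
      unfolding B_def by (simp flip: sum.inter_filter)
    moreover have "real k * \<kappa> \<le> real n * \<kappa>"
      using k by (intro mult_right_mono) (auto simp: \<kappa>_def)
    ultimately show "(\<Sum>r=1..k. \<kappa> + B r) \<le> real n * \<kappa> + 2 * real b"
      by (simp add: sum.distrib)
  qed (use decay_sum_ge_1 in simp)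
  finally show "(\<Sum>r=1..k. \<bar>\<Sum>h. (lag_weight b k r h - 1) * lag_cov w r h\<bar>) \<le>
      3 * decay_sum * \<Theta>\<^sup>2 * (real n * (1 / real b + real b powr (2 - \<beta>)) + 2 * real b)"
    by (simp add: \<kappa>_def)
qed

lemma expected_estimator:
  assumes k: "k \<in> {1..n}"
  shows "(\<Sum>t=b..k. \<Sum>i<d. \<Sum>j<d. w i j * (\<integral>\<eta>. Y t \<eta> (i, j) \<partial>innov)) =
    (\<Sum>r=1..k. \<Sum>h<r. lag_weight b k r h * cross_cov w r h)"
proof -
  have "(\<Sum>i<d. \<Sum>j<d. w i j * (\<integral>\<eta>. Y t \<eta> (i, j) \<partial>innov)) =
      1 / real b * (\<Sum>s=t-b+1..t. \<Sum>r=t-b+1..t. cross d w (X s) (X r))" if t: "t \<in> {b..k}" for t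
  proof -
    have mem: "s \<in> {1..n}" if "s \<in> {t-b+1..t}" for s
      using that t k by auto
    have int: "integrable innov (\<lambda>\<eta>. X s \<eta> i * X r \<eta> j)" if "s \<in> {t-b+1..t}" "r \<in> {t-b+1..t}" "i < d" "j < d" for s r i j
      using \<Theta> measurable_Z that mem
      by (intro integrable_cross_component[OF _ _ Z_moment2[OF mem[OF that(1)]] _ Z_moment2[OF mem[OF that(2)]]]) auto
    have EY: "(\<integral>\<eta>. Y t \<eta> (i, j) \<partial>innov) = 1 / real b * (\<Sum>s=t-b+1..t. \<Sum>r=t-b+1..t. \<integral>\<eta>. X s \<eta> i * X r \<eta> j \<partial>innov)"
      if "i < d" "j < d" for i j
    proof -
      have "(\<integral>\<eta>. Y t \<eta> (i, j) \<partial>innov) = 1 / real b * (\<integral>\<eta>. (\<Sum>s=t-b+1..t. \<Sum>r=t-b+1..t. X s \<eta> i * X r \<eta> j) \<partial>innov)"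
        by (simp add: Y_def S_def sum_product)
      also have "(\<integral>\<eta>. (\<Sum>s=t-b+1..t. \<Sum>r=t-b+1..t. X s \<eta> i * X r \<eta> j) \<partial>innov) =
          (\<Sum>s=t-b+1..t. \<integral>\<eta>. (\<Sum>r=t-b+1..t. X s \<eta> i * X r \<eta> j) \<partial>innov)"
        using int that by (intro Bochner_Integration.integral_sum Bochner_Integration.integrable_sum) auto
      also have "\<dots> = (\<Sum>s=t-b+1..t. \<Sum>r=t-b+1..t. \<integral>\<eta>. X s \<eta> i * X r \<eta> j \<partial>innov)"
        using int that by (intro sum.cong refl Bochner_Integration.integral_sum) auto
      finally show ?thesis .
    qed
    have cr: "cross d w (X s) (X r) = (\<Sum>i<d. \<Sum>j<d. w i j * (\<integral>\<eta>. X s \<eta> i * X r \<eta> j \<partial>innov))"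
      if "s \<in> {t-b+1..t}" "r \<in> {t-b+1..t}" for s r
      using \<Theta> measurable_Z mem that by (intro cross_eq_sum[OF _ _ Z_moment2[OF mem[OF that(1)]] _ Z_moment2[OF mem[OF that(2)]]]) auto
    have "(\<Sum>i<d. \<Sum>j<d. w i j * (\<integral>\<eta>. Y t \<eta> (i, j) \<partial>innov)) =
      1 / real b * (\<Sum>i<d. \<Sum>j<d. \<Sum>s=t-b+1..t. \<Sum>r=t-b+1..t. w i j * (\<integral>\<eta>. X s \<eta> i * X r \<eta> j \<partial>innov))"
      unfolding sum_distrib_left by (intro sum.cong refl) (simp add: EY sum_distrib_left sum_divide_distrib)
    also have "(\<Sum>i<d. \<Sum>j<d. \<Sum>s=t-b+1..t. \<Sum>r=t-b+1..t. w i j * (\<integral>\<eta>. X s \<eta> i * X r \<eta> j \<partial>innov)) =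
      (\<Sum>s=t-b+1..t. \<Sum>r=t-b+1..t. \<Sum>i<d. \<Sum>j<d. w i j * (\<integral>\<eta>. X s \<eta> i * X r \<eta> j \<partial>innov))"
      by (rule sum_swap4)
    also have "\<dots> = (\<Sum>s=t-b+1..t. \<Sum>r=t-b+1..t. cross d w (X s) (X r))"
      by (intro sum.cong refl) (simp add: cr)
    finally show ?thesis .
  qed
  then have "(\<Sum>t=b..k. \<Sum>i<d. \<Sum>j<d. w i j * (\<integral>\<eta>. Y t \<eta> (i, j) \<partial>innov)) =
      1 / real b * (\<Sum>t=b..k. \<Sum>s=t-b+1..t. \<Sum>r=t-b+1..t. cross d w (X s) (X r))"
    by (simp add: sum_distrib_left sum_divide_distrib)
  also have "\<dots> = 1 / real b * (\<Sum>r=1..k. \<Sum>h<r. real (overlap b k r h) * cross_cov w r h)"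
    using window_sum_eq[OF b(1), of "\<lambda>s r. cross d w (X s) (X r)" k]
    by (simp add: cross_cov_def cong: if_cong)
  also have "\<dots> = (\<Sum>r=1..k. \<Sum>h<r. lag_weight b k r h * cross_cov w r h)"
    unfolding sum_distrib_left by (intro sum.cong refl) (simp add: lag_weight_def)
  finally show ?thesis .
qed

text \<open>Splits weight times \<open>cross_cov\<close> minus \<open>lag_cov\<close> into weight
  times their difference and the weight defect times \<open>lag_cov\<close>. The finite sum over
  \<open>h < r\<close> is a full series because the weights vanish beyond. A one-sided bound is
  enough, as the trace norm is itself a value at some \<open>W\<close>.\<close>

lemma bias_le:
  assumes W: "orth_mat d W" and k: "k \<in> {1..n}"
  shows "(\<Sum>t=b..k. \<Sum>i<d. \<Sum>j<d. W $$ (i, j) * (\<integral>\<eta>. Y t \<eta> (i, j) \<partial>innov)) -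
      (\<Sum>r=1..k. \<Sum>i<d. \<Sum>j<d. W $$ (i, j) * long_run_cov innov (\<lambda>i \<eta>. \<eta> i) d (G r) $$ (i, j)) \<le>
    6 * \<Theta>\<^sup>2 * \<Gamma> * sqrt b + 3 * decay_sum * \<Theta>\<^sup>2 * (real n * (1 / real b + real b powr (2 - \<beta>)) + 2 * real b)"
proof -
  let ?w = "\<lambda>i j. W $$ (i, j)"
  have w: "contractive d ?w"
    by (rule contractive_orth[OF W])
  have kn: "k \<le> n"
    using k by simp
  have r: "r \<in> {1..n}" if "r \<in> {1..k}" for r
    using that kn by auto
  have split: "(\<Sum>h<r. lag_weight b k r h * lag_cov ?w r h) - (\<Sum>h. lag_cov ?w r h) =
      (\<Sum>h. (lag_weight b k r h - 1) * lag_cov ?w r h)" if "r \<in> {1..k}" for r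
  proof -
    have "(\<lambda>h. lag_weight b k r h * lag_cov ?w r h) sums (\<Sum>h<r. lag_weight b k r h * lag_cov ?w r h)"
      by (rule sums_finite) (auto simp: lag_weight_def)
    from sums_diff[OF this long_run_sums(2)[OF r[OF that] w]] show ?thesis
      by (simp add: left_diff_distrib sums_unique)
  qed
  have "(\<Sum>t=b..k. \<Sum>i<d. \<Sum>j<d. ?w i j * (\<integral>\<eta>. Y t \<eta> (i, j) \<partial>innov)) -
      (\<Sum>r=1..k. \<Sum>i<d. \<Sum>j<d. ?w i j * long_run_cov innov (\<lambda>i \<eta>. \<eta> i) d (G r) $$ (i, j)) =
    (\<Sum>r=1..k. (\<Sum>h<r. lag_weight b k r h * cross_cov ?w r h) - (\<Sum>h. lag_cov ?w r h))"
    using long_run_cov_inner[OF r W] by (simp add: expected_estimator[OF k] sum_subtractf)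
  also have "\<dots> = (\<Sum>r=1..k. (\<Sum>h<r. lag_weight b k r h * (cross_cov ?w r h - lag_cov ?w r h)) +
      (\<Sum>h. (lag_weight b k r h - 1) * lag_cov ?w r h))"
    by (intro sum.cong refl) (simp add: split[symmetric] right_diff_distrib sum_subtractf)
  also have "\<dots> \<le> (\<Sum>r=1..k. (\<Sum>h<r. lag_weight b k r h * \<bar>cross_cov ?w r h - lag_cov ?w r h\<bar>) +
      \<bar>\<Sum>h. (lag_weight b k r h - 1) * lag_cov ?w r h\<bar>)"
    using lag_weight_bounds by (intro sum_mono add_mono mult_left_mono) auto
  also have "\<dots> \<le> 6 * \<Theta>\<^sup>2 * \<Gamma> * sqrt b + 3 * decay_sum * \<Theta>\<^sup>2 * (real n * (1 / real b + real b powr (2 - \<beta>)) + 2 * real b)"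
    unfolding sum.distrib using sum_cross_cov_diff_le[OF w kn] weight_defect_le(1)[OF w kn] by (intro add_mono)
  finally show ?thesis .
qed

subsection \<open>Maximal error\<close>

definition err :: "(int \<Rightarrow> real) \<Rightarrow> nat \<Rightarrow> real" where
  "err \<eta> k = trace_norm (Qhat d b (\<lambda>t. G t (history (\<lambda>i \<eta>. \<eta> i) (int t) \<eta>)) k
      - mat_sum d (\<lambda>t. long_run_cov innov (\<lambda>i \<eta>. \<eta> i) d (G t)) {1..k})"

lemma err_eq:
  "err \<eta> k = trace_norm (Matrix.mat d d (\<lambda>p. (\<Sum>t=b..k. Y t \<eta> p) -
      (\<Sum>r=1..k. long_run_cov innov (\<lambda>i \<eta>. \<eta> i) d (G r) $$ p)))"
  unfolding err_def
  by (rule arg_cong[of _ _ trace_norm], rule eq_matI)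
    (auto simp: Qhat_def mat_sum_def outer_prod_def Y_def S_def frozen_def)

definition fluctuation :: "(int \<Rightarrow> real) \<Rightarrow> real" where
  "fluctuation \<eta> = Max ((\<lambda>m. L2_set (\<lambda>p. \<Sum>k<m. Yc (b + k) \<eta> p) ({..<d} \<times> {..<d})) ` {..n + 1 - b})"

definition bias :: real where
  "bias = 6 * \<Theta>\<^sup>2 * \<Gamma> * sqrt b + 3 * decay_sum * \<Theta>\<^sup>2 * (real n * (1 / real b + real b powr (2 - \<beta>)) + 2 * real b)"

text \<open>The error is split into its centred part \<open>F\<close> and its mean under one and the
  same \<open>W\<close>. The bounds for both hold for every orthogonal matrix, so the dependence of
  \<open>W\<close> on \<open>\<eta>\<close> and \<open>k\<close> does no harm.\<close>

lemma err_le: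
  assumes k: "k \<in> {1..n}"
  shows "err \<eta> k \<le> sqrt d * fluctuation \<eta> + bias"
proof -
  let ?L = "\<lambda>r p. long_run_cov innov (\<lambda>i \<eta>. \<eta> i) d (G r) $$ p"
  define A where "A = Matrix.mat d d (\<lambda>p. (\<Sum>t=b..k. Y t \<eta> p) - (\<Sum>r=1..k. ?L r p))"
  define F where "F = Matrix.mat d d (\<lambda>p. \<Sum>t=b..k. Yc t \<eta> p)"
  obtain W where W: "orth_mat d W" "trace_norm A = mat_inner d W A"
    by (rule trace_norm_orth[of A d]) (auto simp: A_def)
  have "mat_inner d W A = mat_inner d W F +
      ((\<Sum>t=b..k. \<Sum>i<d. \<Sum>j<d. W $$ (i, j) * (\<integral>\<eta>. Y t \<eta> (i, j) \<partial>innov)) -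
       (\<Sum>r=1..k. \<Sum>i<d. \<Sum>j<d. W $$ (i, j) * ?L r (i, j)))"
  proof -
    have swap: "(\<Sum>t\<in>T. \<Sum>i<d. \<Sum>j<d. W $$ (i, j) * f t (i, j)) = (\<Sum>i<d. \<Sum>j<d. W $$ (i, j) * (\<Sum>t\<in>T. f t (i, j)))"
      for T :: "nat set" and f :: "nat \<Rightarrow> nat \<times> nat \<Rightarrow> real"
      unfolding sum_distrib_left
      by (subst sum.swap, rule sum.cong[OF refl], rule sum.swap)
    show ?thesis
      unfolding swap[of "\<lambda>t p. \<integral>\<eta>. Y t \<eta> p \<partial>innov"] swap[of ?L]
      unfolding mat_inner_def sum_subtractf[symmetric] sum.distrib[symmetric]
      by (intro sum.cong refl) (simp add: A_def F_def Yc_def sum_subtractf algebra_simps)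
  qed
  also have "\<dots> \<le> sqrt d * fluctuation \<eta> + bias"
  proof (rule add_mono)
    have "mat_inner d W F \<le> sqrt d * L2_set (\<lambda>p. F $$ p) ({..<d} \<times> {..<d})"
      by (rule orth_mat_inner_le[OF W(1)])
    also have "L2_set (\<lambda>p. F $$ p) ({..<d} \<times> {..<d}) \<le> fluctuation \<eta>"
    proof -
      \<comment> \<open>For \<open>k < b\<close> the truncated difference \<open>k + 1 - b\<close>
        is 0 and both sums are empty.\<close>
      have "(\<Sum>t=b..k. f t) = (\<Sum>j<k + 1 - b. f (b + j))" for f :: "nat \<Rightarrow> real"
        by (rule sum.reindex_bij_witness[of _ "\<lambda>j. b + j" "\<lambda>t. t - b"]) auto
      then have "L2_set (\<lambda>p. F $$ p) ({..<d} \<times> {..<d}) =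
          L2_set (\<lambda>p. \<Sum>j<k + 1 - b. Yc (b + j) \<eta> p) ({..<d} \<times> {..<d})"
        by (intro L2_set_cong) (auto simp: F_def)
      also have "\<dots> \<le> fluctuation \<eta>"
        unfolding fluctuation_def using k by (intro Max_ge) auto
      finally show ?thesis .
    qed
    finally show "mat_inner d W F \<le> sqrt d * fluctuation \<eta>"
      by (simp add: mult_left_mono)
    show "(\<Sum>t=b..k. \<Sum>i<d. \<Sum>j<d. W $$ (i, j) * (\<integral>\<eta>. Y t \<eta> (i, j) \<partial>innov)) -
       (\<Sum>r=1..k. \<Sum>i<d. \<Sum>j<d. W $$ (i, j) * ?L r (i, j)) \<le> bias"
      unfolding bias_def by (rule bias_le[OF W(1) k])
  qed
  finally show ?thesis
    by (simp only: err_eq A_def[symmetric] W(2))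
qed

text \<open>The boundary term \<open>b\<close> has no counterpart in the rate and is absorbed by
  \<open>sqrt (n d b)\<close>, since \<open>b \<le> n\<close> and \<open>1 \<le> d\<close>.\<close>

lemma bias_total_le:
  "sqrt d * (72 * \<Theta>\<^sup>2 * sqrt (real n * real b)) + bias \<le> (72 + 6 * decay_sum) * \<Theta>\<^sup>2 *
    (\<Gamma> * sqrt (real b) + sqrt (real n * real d * real b) + real n * inverse (real b) + real n * real b powr (2 - \<beta>))"
proof -
  define s where "s = sqrt (real n * real d * real b)"
  have D: "decay_sum \<ge> 1"
    by (rule decay_sum_ge_1)
  have s: "sqrt d * sqrt (real n * real b) = s"
    by (simp add: s_def real_sqrt_mult mult_ac)
  have "real b * real b \<le> (real n * real d) * real b"
  proof (rule mult_right_mono)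
    have "real b * 1 \<le> real n * real d"
      using b d by (intro mult_mono) auto
    then show "real b \<le> real n * real d"
      by simp
  qed simp
  then have bs: "real b \<le> s"
    unfolding s_def by (intro real_le_rsqrt) (simp add: power2_eq_square)
  have "sqrt d * (72 * \<Theta>\<^sup>2 * sqrt (real n * real b)) + bias = \<Theta>\<^sup>2 * (72 * s + 6 * (\<Gamma> * sqrt b) +
      3 * decay_sum * (real n * inverse (real b)) + 3 * decay_sum * (real n * real b powr (2 - \<beta>)) + 6 * decay_sum * real b)"
    by (simp add: bias_def s[symmetric] algebra_simps inverse_eq_divide)
  also have "\<dots> \<le> \<Theta>\<^sup>2 * (72 * s + (72 + 6 * decay_sum) * (\<Gamma> * sqrt b) + (72 + 6 * decay_sum) * (real n * inverse (real b)) +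
      (72 + 6 * decay_sum) * (real n * real b powr (2 - \<beta>)) + 6 * decay_sum * s)"
    using D \<Gamma> bs by (intro mult_left_mono add_mono mult_right_mono) auto
  also have "\<dots> = (72 + 6 * decay_sum) * \<Theta>\<^sup>2 *
      (\<Gamma> * sqrt (real b) + s + real n * inverse (real b) + real n * real b powr (2 - \<beta>))"
    by (simp add: algebra_simps)
  finally show ?thesis
    by (simp add: s_def)
qed

lemma max_err_bound:
  "integrable innov (\<lambda>\<eta>. Max (err \<eta> ` {1..n}))"
  "(\<integral>\<eta>. Max (err \<eta> ` {1..n}) \<partial>innov) \<le> (72 + 6 * decay_sum) * \<Theta>\<^sup>2 *
    (\<Gamma> * sqrt (real b) + sqrt (real n * real d * real b) + real n * inverse (real b) + real n * real b powr (2 - \<beta>))"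
proof -
  have ne: "1 \<in> {1..n}"
    using b by simp
  have fl: "moment_le innov 2 fluctuation (72 * \<Theta>\<^sup>2 * sqrt (real n * real b))"
    using fluctuation_moment by (simp add: fluctuation_def[abs_def])
  have ifl: "integrable innov fluctuation" "\<bar>\<integral>\<eta>. fluctuation \<eta> \<partial>innov\<bar> \<le> 72 * \<Theta>\<^sup>2 * sqrt (real n * real b)"
    using moment_le_2_integrable[OF prob_space_innov fl] by simp_all
  have meas: "(\<lambda>\<eta>. err \<eta> k) \<in> borel_measurable innov" if "k \<in> {1..n}" for k
    unfolding err_eq
    using that integrable_Y by (intro borel_measurable_trace_norm borel_measurable_diff borel_measurable_sum) auto
  have measM: "(\<lambda>\<eta>. Max (err \<eta> ` {1..n})) \<in> borel_measurable innov"
    using meas by (intro borel_measurable_Max) auto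
  have nonneg: "0 \<le> Max (err \<eta> ` {1..n})" for \<eta>
  proof -
    have "0 \<le> err \<eta> 1"
      unfolding err_eq by (rule trace_norm_nonneg[OF mat_carrier])
    also have "\<dots> \<le> Max (err \<eta> ` {1..n})"
      using ne by (intro Max_ge) auto
    finally show ?thesis .
  qed
  have le: "Max (err \<eta> ` {1..n}) \<le> sqrt d * fluctuation \<eta> + bias" for \<eta>
    using ne err_le by (intro Max.boundedI) auto
  have i: "integrable innov (\<lambda>\<eta>. sqrt d * fluctuation \<eta> + bias)"
    using ifl(1) by simp
  show int: "integrable innov (\<lambda>\<eta>. Max (err \<eta> ` {1..n}))"
    using order_trans[OF le abs_ge_self] nonneg
    by (intro Bochner_Integration.integrable_bound[OF i measM] AE_I2) simp
  have "(\<integral>\<eta>. Max (err \<eta> ` {1..n}) \<partial>innov) \<le> (\<integral>\<eta>. sqrt d * fluctuation \<eta> + bias \<partial>innov)"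
    by (intro integral_mono int i le)
  also have "\<dots> = sqrt d * (\<integral>\<eta>. fluctuation \<eta> \<partial>innov) + bias"
    using ifl(1) by simp
  also have "\<dots> \<le> sqrt d * (72 * \<Theta>\<^sup>2 * sqrt (real n * real b)) + bias"
    using ifl(2) by (intro add_right_mono mult_left_mono) auto
  also note bias_total_le
  finally show "(\<integral>\<eta>. Max (err \<eta> ` {1..n}) \<partial>innov) \<le> (72 + 6 * decay_sum) * \<Theta>\<^sup>2 *
    (\<Gamma> * sqrt (real b) + sqrt (real n * real d * real b) + real n * inverse (real b) + real n * real b powr (2 - \<beta>))" .
qed

end

section \<open>Transfer to an arbitrary probability space\<close>

text \<open>Young's inequality with weights \<open>4 / q\<close> and \<open>1 - 4 / q\<close>; the
  second may be 0.\<close>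

lemma power4_le_powr:
  fixes y q :: real
  assumes "q \<ge> 4" "y \<ge> 0"
  shows "y ^ 4 \<le> 4 / q * y powr q + (1 - 4 / q)"
proof (cases "y = 0")
  case True
  then show ?thesis
    using assms by simp
next
  case False
  then have y: "y > 0"
    using assms by simp
  have "(y powr q) powr (4 / q) * 1 powr (1 - 4 / q) \<le> 4 / q * y powr q + (1 - 4 / q) * 1"
    using assms y by (intro Youngs_inequality_0) auto
  moreover have "(y powr q) powr (4 / q) = y ^ 4"
    using assms y by (simp add: powr_powr powr_numeral)
  ultimately show ?thesis
    by simp
qed

text \<open>Applying the pointwise inequality to \<open>|f| / c\<close> makes the two weights add up
  to 1 after integration, so the constant \<open>c\<close> is kept exactly.\<close>

lemma Lp_norm_le_moment4:
  assumes "prob_space N" and q: "q \<ge> 4" and c: "c > 0" and f: "f \<in> borel_measurable N" and L: "Lp_norm_le N q f c"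
  shows "moment_le N 4 f c"
proof -
  interpret prob_space N by fact
  define E where "E = (\<integral>x. \<bar>f x\<bar> powr q \<partial>N)"
  have i: "integrable N (\<lambda>x. \<bar>f x\<bar> powr q)" and E1: "E powr (1 / q) \<le> c"
    using L by (auto simp: Lp_norm_le_def E_def)
  have E0: "E \<ge> 0"
    unfolding E_def by (intro Bochner_Integration.integral_nonneg) simp
  have "(E powr (1 / q)) powr q \<le> c powr q"
    using E1 q by (intro powr_mono2) auto
  then have E: "E \<le> c powr q"
    using q E0 by (simp add: powr_powr)
  define u where "u = (\<lambda>x. c ^ 4 * (4 / q * (\<bar>f x\<bar> powr q / c powr q) + (1 - 4 / q)))"
  have le: "f x ^ 4 \<le> u x" for x
  proof -
    have "f x ^ 4 = c ^ 4 * (\<bar>f x\<bar> / c) ^ 4"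
      using c by (simp add: power_divide)
    also have "\<dots> \<le> u x"
      unfolding u_def using power4_le_powr[OF q, of "\<bar>f x\<bar> / c"] c
      by (intro mult_left_mono) (auto simp: powr_divide)
    finally show ?thesis .
  qed
  have iu: "integrable N u"
    unfolding u_def[abs_def] using i by auto
  have if4: "integrable N (\<lambda>x. f x ^ 4)"
    using order_trans[OF le abs_ge_self] f
    by (intro Bochner_Integration.integrable_bound[OF iu] AE_I2) auto
  have "(\<integral>x. f x ^ 4 \<partial>N) \<le> (\<integral>x. u x \<partial>N)"
    by (intro integral_mono if4 iu le)
  also have "\<dots> = c ^ 4 * (4 / q * (E / c powr q) + (1 - 4 / q))"
    unfolding u_def using i by (simp add: E_def prob_space)
  also have "\<dots> \<le> c ^ 4 * (4 / q * 1 + (1 - 4 / q))"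
    using E c q by (intro mult_left_mono add_right_mono) (auto simp: divide_le_eq_1)
  finally show ?thesis
    using f if4 by (simp add: moment_le_def)
qed

lemma distr_iid_uniform_fst:
  assumes "prob_space M" "iid_uniform_pair M \<epsilon> \<epsilon>'"
  shows "(\<lambda>\<omega> i. \<epsilon> i \<omega>) \<in> measurable M innov" "distr M innov (\<lambda>\<omega> i. \<epsilon> i \<omega>) = innov"
proof -
  let ?T = "\<lambda>\<omega>. (\<lambda>i. \<epsilon> i \<omega>, \<lambda>i. \<epsilon>' i \<omega>)"
  note T = distr_iid_uniform_pair[OF assms]
  show "(\<lambda>\<omega> i. \<epsilon> i \<omega>) \<in> measurable M innov"
    using measurable_compose[OF T(1) measurable_fst] by simp
  have "innov = distr (distr M (innov \<Otimes>\<^sub>M innov) ?T) innov fst"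
    by (simp only: T(2) distr_fst_innov)
  also have "\<dots> = distr M innov (\<lambda>\<omega> i. \<epsilon> i \<omega>)"
    by (subst distr_distr[OF measurable_fst T(1)]) (simp add: comp_def)
  finally show "distr M innov (\<lambda>\<omega> i. \<epsilon> i \<omega>) = innov" ..
qed

lemma long_run_cov_transfer:
  fixes g :: "(nat \<Rightarrow> real) \<Rightarrow> nat \<Rightarrow> real"
  assumes law: "(\<lambda>\<omega> i. \<epsilon> i \<omega>) \<in> measurable M innov" "distr M innov (\<lambda>\<omega> i. \<epsilon> i \<omega>) = innov"
    and g: "\<And>i. i < d \<Longrightarrow> (\<lambda>x. g x i) \<in> borel_measurable (PiM UNIV (\<lambda>_. borel))"
  shows "long_run_cov M \<epsilon> d g = long_run_cov innov (\<lambda>i \<eta>. \<eta> i) d g"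
proof -
  let ?e = "\<lambda>i (\<eta> :: int \<Rightarrow> real). \<eta> i"
  have hist: "history \<epsilon> s \<omega> = history ?e s (\<lambda>i. \<epsilon> i \<omega>)" for s \<omega>
    by (simp add: history_def)
  have m: "(\<lambda>\<eta>. g (history ?e s \<eta>) i) \<in> borel_measurable innov" if "i < d" for s i
  proof -
    have "(\<lambda>\<eta>. history ?e s \<eta>) \<in> measurable innov (PiM UNIV (\<lambda>_. borel))"
      unfolding history_def by (rule measurable_PiM_single') auto
    from measurable_compose[OF this g[OF that]] show ?thesis .
  qed
  have I: "(\<integral>\<omega>. f (\<lambda>i. \<epsilon> i \<omega>) \<partial>M) = (\<integral>\<eta>. f \<eta> \<partial>innov)" if "f \<in> borel_measurable innov" for f :: "_ \<Rightarrow> real"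
    using integral_distr[OF law(1) that] by (simp add: law(2))
  have "Cov M d (\<lambda>\<omega>. g (history \<epsilon> 0 \<omega>)) (\<lambda>\<omega>. g (history \<epsilon> h \<omega>)) $$ (i, j) =
      Cov innov d (\<lambda>\<omega>. g (history ?e 0 \<omega>)) (\<lambda>\<omega>. g (history ?e h \<omega>)) $$ (i, j)" if ij: "i < d" "j < d" for h i j
  proof -
    have E: "(\<integral>\<omega>. g (history ?e s (\<lambda>i. \<epsilon> i \<omega>)) k \<partial>M) = (\<integral>\<eta>. g (history ?e s \<eta>) k \<partial>innov)" if "k < d" for s k
      by (rule I[OF m[OF that]])
    define a where "a = (\<integral>\<eta>. g (history ?e 0 \<eta>) i \<partial>innov)"
    define c where "c = (\<integral>\<eta>. g (history ?e h \<eta>) j \<partial>innov)"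
    have "(\<integral>\<omega>. (g (history ?e 0 (\<lambda>i. \<epsilon> i \<omega>)) i - a) * (g (history ?e h (\<lambda>i. \<epsilon> i \<omega>)) j - c) \<partial>M) =
        (\<integral>\<eta>. (g (history ?e 0 \<eta>) i - a) * (g (history ?e h \<eta>) j - c) \<partial>innov)"
      using m ij by (intro I borel_measurable_times borel_measurable_diff) auto
    then show ?thesis
      using ij by (simp add: Cov_def hist E a_def c_def)
  qed
  then show ?thesis
    unfolding long_run_cov_def by (intro eq_matI) simp_all
qed

text \<open>Every hypothesis is an integral of a Borel function of the two sequences, hence depends
  only on their joint law. The exact L2 norms of the changes of \<open>G\<close> serve as
  \<open>\<delta>\<close>.\<close>

lemma window_model_transfer:
  fixes M :: "'a measure" and G :: "nat \<Rightarrow> (nat \<Rightarrow> real) \<Rightarrow> (nat \<Rightarrow> real)"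
  assumes q: "q \<ge> 4" and \<beta>: "\<beta> > 2" and M: "prob_space M" and iid: "iid_uniform_pair M \<epsilon> \<epsilon>'"
    and d: "d \<ge> 1" and \<Theta>: "\<Theta> > 0" and \<Gamma>: "\<Gamma> \<ge> 1" and b: "b \<in> {1..n}"
    and G: "\<forall>t\<in>{1..n}. G t \<in> measurable (PiM UNIV (\<lambda>_. borel)) (PiM {..<d} (\<lambda>_. borel))"
    and mean: "\<forall>t\<in>{1..n}. \<forall>i<d. (\<integral>\<omega>. G t (history \<epsilon> (int t) \<omega>) i \<partial>M) = 0"
    and dep: "\<forall>t\<in>{1..n}. \<forall>j::nat. Lp_norm_le M q
         (\<lambda>\<omega>. eucl_norm d (\<lambda>i. G t (history \<epsilon> (int t) \<omega>) i
             - G t (history (\<epsilon>(int t - int j := \<epsilon>' (int t - int j))) (int t) \<omega>) i))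
         (\<Theta> * real (max j 1) powr (-\<beta>))"
    and moment: "\<forall>t\<in>{1..n}. Lp_norm_le M q (\<lambda>\<omega>. eucl_norm d (G t (history \<epsilon> 0 \<omega>))) \<Theta>"
    and var: "(\<Sum>t=2..n. sqrt (\<integral>\<omega>. (eucl_norm d (\<lambda>i. G t (history \<epsilon> 0 \<omega>) i
             - G (t - 1) (history \<epsilon> 0 \<omega>) i))\<^sup>2 \<partial>M)) \<le> \<Gamma> * \<Theta>"
  shows "window_model n d b G \<Theta> \<Gamma> \<beta>
    (\<lambda>t. sqrt (\<integral>\<eta>. (eucl_norm d (\<lambda>i. frozen G t 0 \<eta> i - frozen G (t - 1) 0 \<eta> i))\<^sup>2 \<partial>innov))"
proof -
  interpret M: prob_space M by fact
  let ?T = "\<lambda>\<omega>. (\<lambda>i. \<epsilon> i \<omega>, \<lambda>i. \<epsilon>' i \<omega>)"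
  let ?e = "\<lambda>i (\<eta> :: int \<Rightarrow> real). \<eta> i"
  note T = distr_iid_uniform_pair[OF M iid]
  note law = distr_iid_uniform_fst[OF M iid]
  have frozen: "G t (history \<epsilon> s \<omega>) = frozen G t s (\<lambda>i. \<epsilon> i \<omega>)" for t s \<omega>
    by (simp add: frozen_def history_def)
  have frozen': "G t (history (\<epsilon>(j := \<epsilon>' j)) s \<omega>) = frozen G t s ((\<lambda>i. \<epsilon> i \<omega>)(j := \<epsilon>' j \<omega>))" for t s j \<omega>
    unfolding frozen_def by (rule arg_cong[of _ _ "G t"]) (auto simp: history_def)
  have Gc: "(\<lambda>x. G t x i) \<in> borel_measurable (PiM UNIV (\<lambda>_. borel))" if "t \<in> {1..n}" "i < d" for t i
    using measurable_compose[OF G[rule_format, OF that(1)] measurable_component_singleton[of i "{..<d}"]] that by simp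
  have Fm: "(\<lambda>\<eta>. frozen G t s \<eta> i) \<in> borel_measurable innov" if "t \<in> {1..n}" "i < d" for t s i
  proof -
    have "(\<lambda>\<eta>. history ?e s \<eta>) \<in> measurable innov (PiM UNIV (\<lambda>_. borel))"
      unfolding history_def by (rule measurable_PiM_single') auto
    from measurable_compose[OF this Gc[OF that]] show ?thesis
      by (simp add: frozen_def)
  qed
  have nF: "(\<lambda>\<eta>. eucl_norm d (frozen G t s \<eta>)) \<in> borel_measurable innov" if "t \<in> {1..n}" for t s
    using Fm[OF that] by (intro borel_measurable_L2_set) auto
  have m4: "moment_le innov 4 (\<lambda>\<eta>. eucl_norm d (frozen G t 0 \<eta>)) \<Theta>" if t: "t \<in> {1..n}" for t
  proof -
    have "moment_le M 4 (\<lambda>\<omega>. eucl_norm d (frozen G t 0 (\<lambda>i. \<epsilon> i \<omega>))) \<Theta>"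
      using moment[rule_format, OF t] measurable_compose[OF law(1) nF[OF t]]
      by (intro Lp_norm_le_moment4[OF M q \<Theta>]) (auto simp: frozen)
    then show ?thesis
      using moment_le_distr[OF law(2,1) nF[OF t]] by blast
  qed
  have m2: "moment_le innov 2 (\<lambda>\<eta>. eucl_norm d (frozen G t 0 \<eta>)) \<Theta>" if t: "t \<in> {1..n}" for t
    using moment_le_4_2[OF prob_space_innov m4[OF t]] \<Theta> by simp
  show ?thesis
  proof
    show "(\<integral>\<eta>. frozen G t (int t) \<eta> i \<partial>innov) = 0" if "t \<in> {1..n}" "i < d" for t i
      using mean that integral_distr[OF law(1) Fm[OF that, of "int t"]] by (simp add: frozen law(2))
    show "coupling_le 4 {..<d} (frozen G t (int t)) (int t - int j) (\<Theta> * real (max j 1) powr (- \<beta>))"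
      if t: "t \<in> {1..n}" for t j
    proof -
      define k where "k = int t - int j"
      define f where "f = (\<lambda>z. eucl_norm d (\<lambda>i. frozen G t (int t) (fst z) i - frozen G t (int t) ((fst z)(k := snd z k)) i))"
      have fm: "f \<in> borel_measurable (innov \<Otimes>\<^sub>M innov)"
        unfolding f_def
        using measurable_compose[OF measurable_fst Fm[OF t]] measurable_compose[OF measurable_coupling Fm[OF t]]
        by (intro borel_measurable_L2_set borel_measurable_diff) auto
      have "moment_le M 4 (\<lambda>\<omega>. f (?T \<omega>)) (\<Theta> * real (max j 1) powr (- \<beta>))"
        using dep[rule_format, OF t, of j] measurable_compose[OF T(1) fm] \<Theta>
        by (intro Lp_norm_le_moment4[OF M q]) (auto simp: frozen frozen' f_def k_def)
      then show ?thesis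
        using moment_le_distr[OF T(2,1) fm] by (simp add: coupling_le_def f_def k_def)
    qed
    show "(\<Sum>t=2..n. sqrt (\<integral>\<eta>. (eucl_norm d (\<lambda>i. frozen G t 0 \<eta> i - frozen G (t - 1) 0 \<eta> i))\<^sup>2 \<partial>innov)) \<le> \<Gamma> * \<Theta>"
    proof -
      have "(\<integral>\<omega>. (eucl_norm d (\<lambda>i. G t (history \<epsilon> 0 \<omega>) i - G (t - 1) (history \<epsilon> 0 \<omega>) i))\<^sup>2 \<partial>M) =
        (\<integral>\<eta>. (eucl_norm d (\<lambda>i. frozen G t 0 \<eta> i - frozen G (t - 1) 0 \<eta> i))\<^sup>2 \<partial>innov)" if t: "t \<in> {2..n}" for t
      proof -
        have "(\<lambda>\<eta>. (eucl_norm d (\<lambda>i. frozen G t 0 \<eta> i - frozen G (t - 1) 0 \<eta> i))\<^sup>2) \<in> borel_measurable innov"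
          using t by (intro borel_measurable_power borel_measurable_L2_set borel_measurable_diff Fm) auto
        from integral_distr[OF law(1) this] show ?thesis
          by (simp add: frozen law(2))
      qed
      then show ?thesis
        using var by simp
    qed
    show "moment_le innov 2 (\<lambda>\<eta>. eucl_norm d (\<lambda>i. frozen G t 0 \<eta> i - frozen G (t - 1) 0 \<eta> i))
        (sqrt (\<integral>\<eta>. (eucl_norm d (\<lambda>i. frozen G t 0 \<eta> i - frozen G (t - 1) 0 \<eta> i))\<^sup>2 \<partial>innov))" if t: "t \<in> {2..n}" for t
    proof -
      have t': "t \<in> {1..n}" "t - 1 \<in> {1..n}"
        using t by auto
      let ?f = "\<lambda>\<eta>. eucl_norm d (\<lambda>i. frozen G t 0 \<eta> i - frozen G (t - 1) 0 \<eta> i)"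
      have fm: "?f \<in> borel_measurable innov"
        using t' by (intro borel_measurable_L2_set borel_measurable_diff Fm) auto
      \<comment> \<open>The variation hypothesis contains bare integrals; that the square is
        integrable comes from the moment bounds of the two maps and the triangle inequality.\<close>
      have "moment_le innov 2 (\<lambda>\<eta>. eucl_norm d (frozen G t 0 \<eta>) + eucl_norm d (frozen G (t - 1) 0 \<eta>)) (\<Theta> + \<Theta>)"
        using \<Theta> by (intro moment_le_add m2 t') auto
      then have "moment_le innov 2 ?f (\<Theta> + \<Theta>)"
      proof (rule moment_le_mono[OF _ _ fm])
        have "?f \<eta> \<le> eucl_norm d (frozen G t 0 \<eta>) + eucl_norm d (frozen G (t - 1) 0 \<eta>)" for \<eta>
          using L2_set_triangle_ineq[of "frozen G t 0 \<eta>" "\<lambda>i. - frozen G (t - 1) 0 \<eta> i" "{..<d}"]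
          by (simp add: L2_set_def)
        then show "AE \<eta> in innov. \<bar>?f \<eta>\<bar> \<le> \<bar>eucl_norm d (frozen G t 0 \<eta>) + eucl_norm d (frozen G (t - 1) 0 \<eta>)\<bar>"
          by (intro AE_I2) simp
      qed (use \<Theta> in auto)
      then show ?thesis
        by (auto simp: moment_le_def)
    qed
  qed (use \<beta> d \<Theta> \<Gamma> b Gc m4 in auto)
qed

theorem theorem4p1:
  fixes q \<beta> :: real
  assumes "q \<ge> 4" and "\<beta> > 2"
  shows "\<exists>C :: real. \<forall>(M :: 'a measure) (\<epsilon> :: int \<Rightarrow> 'a \<Rightarrow> real) (\<epsilon>' :: int \<Rightarrow> 'a \<Rightarrow> real)
      (n :: nat) (d :: nat) (G :: nat \<Rightarrow> (nat \<Rightarrow> real) \<Rightarrow> (nat \<Rightarrow> real)) (\<Theta> :: real) (\<Gamma> :: real) (b :: nat).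
    prob_space M \<and> iid_uniform_pair M \<epsilon> \<epsilon>' \<and>
    d \<ge> 1 \<and> \<Theta> > 0 \<and> \<Gamma> \<ge> 1 \<and> b \<in> {1..n} \<and>
    (\<forall>t\<in>{1..n}. G t \<in> measurable (PiM UNIV (\<lambda>_. borel)) (PiM {..<d} (\<lambda>_. borel))) \<and>
    (\<forall>t\<in>{1..n}. \<forall>i<d. (\<integral>\<omega>. G t (history \<epsilon> (int t) \<omega>) i \<partial>M) = 0) \<and>
    (\<forall>t\<in>{1..n}. \<forall>j::nat.
       Lp_norm_le M q
         (\<lambda>\<omega>. eucl_norm d (\<lambda>i. G t (history \<epsilon> (int t) \<omega>) i
             - G t (history (\<epsilon>(int t - int j := \<epsilon>' (int t - int j))) (int t) \<omega>) i))
         (\<Theta> * real (max j 1) powr (-\<beta>))) \<and>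
    (\<forall>t\<in>{1..n}. Lp_norm_le M q (\<lambda>\<omega>. eucl_norm d (G t (history \<epsilon> 0 \<omega>))) \<Theta>) \<and>
    (\<Sum>t=2..n. sqrt (\<integral>\<omega>. (eucl_norm d (\<lambda>i. G t (history \<epsilon> 0 \<omega>) i
             - G (t - 1) (history \<epsilon> 0 \<omega>) i))\<^sup>2 \<partial>M)) \<le> \<Gamma> * \<Theta>
    \<longrightarrow>
    (let err = (\<lambda>\<omega>. Max ((\<lambda>k. trace_norm
             (Qhat d b (\<lambda>t. G t (history \<epsilon> (int t) \<omega>)) k
               - mat_sum d (\<lambda>t. long_run_cov M \<epsilon> d (G t)) {1..k})) ` {1..n}))
     in integrable M err \<and>
        (\<integral>\<omega>. err \<omega> \<partial>M) \<le> C * \<Theta>\<^sup>2 *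
          (\<Gamma> * sqrt (real b) + sqrt (real n * real d * real b)
            + real n * inverse (real b) + real n * real b powr (2 - \<beta>)))"
proof (rule exI[of _ "72 + 6 * decay_sum"], intro allI impI, elim conjE)
  fix M :: "'a measure" and \<epsilon> \<epsilon>' :: "int \<Rightarrow> 'a \<Rightarrow> real" and n d :: nat
    and G :: "nat \<Rightarrow> (nat \<Rightarrow> real) \<Rightarrow> (nat \<Rightarrow> real)" and \<Theta> \<Gamma> :: real and b :: nat
  assume M: "prob_space M" and iid: "iid_uniform_pair M \<epsilon> \<epsilon>'"
    and asm: "d \<ge> 1" "\<Theta> > 0" "\<Gamma> \<ge> 1" "b \<in> {1..n}"
    and G: "\<forall>t\<in>{1..n}. G t \<in> measurable (PiM UNIV (\<lambda>_. borel)) (PiM {..<d} (\<lambda>_. borel))"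
    and hyps: "\<forall>t\<in>{1..n}. \<forall>i<d. (\<integral>\<omega>. G t (history \<epsilon> (int t) \<omega>) i \<partial>M) = 0"
      "\<forall>t\<in>{1..n}. \<forall>j::nat. Lp_norm_le M q
         (\<lambda>\<omega>. eucl_norm d (\<lambda>i. G t (history \<epsilon> (int t) \<omega>) i
             - G t (history (\<epsilon>(int t - int j := \<epsilon>' (int t - int j))) (int t) \<omega>) i))
         (\<Theta> * real (max j 1) powr (-\<beta>))"
      "\<forall>t\<in>{1..n}. Lp_norm_le M q (\<lambda>\<omega>. eucl_norm d (G t (history \<epsilon> 0 \<omega>))) \<Theta>"
      "(\<Sum>t=2..n. sqrt (\<integral>\<omega>. (eucl_norm d (\<lambda>i. G t (history \<epsilon> 0 \<omega>) i
             - G (t - 1) (history \<epsilon> 0 \<omega>) i))\<^sup>2 \<partial>M)) \<le> \<Gamma> * \<Theta>"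
  interpret W: window_model n d b G \<Theta> \<Gamma> \<beta>
    "\<lambda>t. sqrt (\<integral>\<eta>. (eucl_norm d (\<lambda>i. frozen G t 0 \<eta> i - frozen G (t - 1) 0 \<eta> i))\<^sup>2 \<partial>innov)"
    by (rule window_model_transfer[OF assms M iid asm G hyps])
  note law = distr_iid_uniform_fst[OF M iid]
  \<comment> \<open>The maximal error as a function of the innovation sequence alone, so that its
    integrability and mean are determined by the law of \<open>\<epsilon>\<close>.\<close>
  define e where "e = (\<lambda>\<eta>. Max (W.err \<eta> ` {1..n}))"
  have e: "Max ((\<lambda>k. trace_norm (Qhat d b (\<lambda>t. G t (history \<epsilon> (int t) \<omega>)) k
      - mat_sum d (\<lambda>t. long_run_cov M \<epsilon> d (G t)) {1..k})) ` {1..n}) = e (\<lambda>i. \<epsilon> i \<omega>)" for \<omega>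
  proof -
    have "mat_sum d (\<lambda>t. long_run_cov M \<epsilon> d (G t)) {1..k} =
        mat_sum d (\<lambda>t. long_run_cov innov (\<lambda>i \<eta>. \<eta> i) d (G t)) {1..k}" if "k \<in> {1..n}" for k
      unfolding mat_sum_def using that W.G_meas
      by (intro eq_matI) (auto intro!: sum.cong simp: long_run_cov_transfer[OF law])
    moreover have "history \<epsilon> s \<omega> = history (\<lambda>i \<eta>. \<eta> i) s (\<lambda>i. \<epsilon> i \<omega>)" for s
      by (simp add: history_def)
    ultimately show ?thesis
      unfolding e_def W.err_def by (intro arg_cong[of _ _ Max] image_cong) auto
  qed
  have ie: "integrable innov e"
    unfolding e_def by (rule W.max_err_bound(1))
  have "integrable M (\<lambda>\<omega>. e (\<lambda>i. \<epsilon> i \<omega>))"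
    using integrable_distr[OF law(1), of e] ie by (simp add: law(2))
  moreover have "(\<integral>\<omega>. e (\<lambda>i. \<epsilon> i \<omega>) \<partial>M) = (\<integral>\<eta>. e \<eta> \<partial>innov)"
    using integral_distr[OF law(1), of e] ie by (simp add: law(2))
  ultimately show "let err = (\<lambda>\<omega>. Max ((\<lambda>k. trace_norm
             (Qhat d b (\<lambda>t. G t (history \<epsilon> (int t) \<omega>)) k
               - mat_sum d (\<lambda>t. long_run_cov M \<epsilon> d (G t)) {1..k})) ` {1..n}))
     in integrable M err \<and>
        (\<integral>\<omega>. err \<omega> \<partial>M) \<le> (72 + 6 * decay_sum) * \<Theta>\<^sup>2 *
          (\<Gamma> * sqrt (real b) + sqrt (real n * real d * real b)
            + real n * inverse (real b) + real n * real b powr (2 - \<beta>))"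
    unfolding Let_def e using W.max_err_bound(2) by (simp only: e_def)
qed

end
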